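(* Let $R$ be an excellent ring and let $I$ be an ideal of $R$. Then there exists an element $f \notin \sqrt{I}$ such that $R_f/I^nR_f$ is Cohen-Macaulay for all $n$.
   Context: Rings are commutative with identity; excellent rings are in particular Noetherian. The element $f$ is taken in $R$, and $R_f$ denotes the localization of $R$ at the powers of $f$. A Noetherian ring is Cohen-Macaulay if all its localizations at prime ideals are Cohen-Macaulay local rings.
   Formalization: The ideal I is assumed to be proper (I ≠ R); for I = R the radical of I is all of R, so no element f outside it exists and the claim fails. *)

theory Defs
  imports "HOL-Algebra.Algebra" "HOL-Library.Extended_Nat" "HOL-Library.Poly_Mapping"
begin

subsection \<open>Radicals and localization\<close>

definition radical :: "('a, 'm) ring_scheme \<Rightarrow> 'a set \<Rightarrow> 'a set" where
  "radical R I = {x \<in> carrier R. \<exists>n::nat. x [^]\<^bsub>R\<^esub> n \<in> I}"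

definition frac :: "('a, 'm) ring_scheme \<Rightarrow> 'a set \<Rightarrow> 'a \<Rightarrow> 'a \<Rightarrow> ('a \<times> 'a) set" where
  "frac R S r s = {(r', s'). r' \<in> carrier R \<and> s' \<in> S \<and>
     (\<exists>t\<in>S. t \<otimes>\<^bsub>R\<^esub> ((s' \<otimes>\<^bsub>R\<^esub> r) \<ominus>\<^bsub>R\<^esub> (s \<otimes>\<^bsub>R\<^esub> r')) = \<zero>\<^bsub>R\<^esub>)}"

text \<open>Sums and products of classes are unions over all representatives; the sets joined are
  all equal when \<open>S\<close> is multiplicatively closed.\<close>

definition localization :: "('a, 'm) ring_scheme \<Rightarrow> 'a set \<Rightarrow> ('a \<times> 'a) set ring" where
  "localization R S =
    \<lparr>carrier = {frac R S r s | r s. r \<in> carrier R \<and> s \<in> S},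
     monoid.mult = (\<lambda>u v. \<Union>(r, s)\<in>u. \<Union>(r', s')\<in>v. frac R S (r \<otimes>\<^bsub>R\<^esub> r') (s \<otimes>\<^bsub>R\<^esub> s')),
     one = frac R S \<one>\<^bsub>R\<^esub> \<one>\<^bsub>R\<^esub>,
     ring.zero = frac R S \<zero>\<^bsub>R\<^esub> \<one>\<^bsub>R\<^esub>,
     add = (\<lambda>u v. \<Union>(r, s)\<in>u. \<Union>(r', s')\<in>v.
              frac R S ((s' \<otimes>\<^bsub>R\<^esub> r) \<oplus>\<^bsub>R\<^esub> (s \<otimes>\<^bsub>R\<^esub> r')) (s \<otimes>\<^bsub>R\<^esub> s'))\<rparr>"

definition loc_map :: "('a, 'm) ring_scheme \<Rightarrow> 'a set \<Rightarrow> 'a \<Rightarrow> ('a \<times> 'a) set" where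
  "loc_map R S r = frac R S r \<one>\<^bsub>R\<^esub>"

definition powers :: "('a, 'm) ring_scheme \<Rightarrow> 'a \<Rightarrow> 'a set" where
  "powers R f = {f [^]\<^bsub>R\<^esub> n | n::nat. True}"

definition loc_prime :: "('a, 'm) ring_scheme \<Rightarrow> 'a set \<Rightarrow> ('a \<times> 'a) set ring" where
  "loc_prime R P = localization R (carrier R - P)"


subsection \<open>Spectrum, chains of primes and dimension\<close>

definition spec :: "('a, 'm) ring_scheme \<Rightarrow> 'a set set" where
  "spec R = {P. primeideal P R}"

definition zariski_open :: "('a, 'm) ring_scheme \<Rightarrow> 'a set set \<Rightarrow> bool" where
  "zariski_open R U \<longleftrightarrow> (\<exists>J. ideal J R \<and> U = {P \<in> spec R. \<not> J \<subseteq> P})"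

definition prime_chain :: "('a, 'm) ring_scheme \<Rightarrow> nat \<Rightarrow> (nat \<Rightarrow> 'a set) \<Rightarrow> bool" where
  "prime_chain R n c \<longleftrightarrow> (\<forall>i\<le>n. c i \<in> spec R) \<and> (\<forall>i<n. c i \<subset> c (Suc i))"

definition krull_dim :: "('a, 'm) ring_scheme \<Rightarrow> enat" where
  "krull_dim R = Sup {enat n | n. \<exists>c. prime_chain R n c}"

definition saturated_prime_chain :: "('a, 'm) ring_scheme \<Rightarrow> nat \<Rightarrow> (nat \<Rightarrow> 'a set) \<Rightarrow> bool" where
  "saturated_prime_chain R n c \<longleftrightarrow> prime_chain R n c \<and>
     (\<forall>i<n. \<not> (\<exists>Q \<in> spec R. c i \<subset> Q \<and> Q \<subset> c (Suc i)))"

definition catenary :: "('a, 'm) ring_scheme \<Rightarrow> bool" where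
  "catenary R \<longleftrightarrow> (\<forall>P \<in> spec R. \<forall>Q \<in> spec R. P \<subseteq> Q \<longrightarrow>
     (\<exists>N. \<forall>n c. prime_chain R n c \<and> c 0 = P \<and> c n = Q \<longrightarrow> n \<le> N) \<and>
     (\<forall>m n c d. saturated_prime_chain R m c \<and> c 0 = P \<and> c m = Q \<and>
        saturated_prime_chain R n d \<and> d 0 = P \<and> d n = Q \<longrightarrow> m = n))"


subsection \<open>Regular and Cohen-Macaulay rings\<close>

definition noetherian_cring :: "('a, 'm) ring_scheme \<Rightarrow> bool" where
  "noetherian_cring R \<longleftrightarrow> cring R \<and> noetherian_ring R"

definition noetherian_local :: "('a, 'm) ring_scheme \<Rightarrow> bool" where
  "noetherian_local R \<longleftrightarrow> noetherian_cring R \<and> (\<exists>!M. maximalideal M R)"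

definition max_ideal :: "('a, 'm) ring_scheme \<Rightarrow> 'a set" where
  "max_ideal R = (THE M. maximalideal M R)"

text \<open>The first clause says that \<open>xs ! i\<close> is a nonzerodivisor modulo the preceding elements.\<close>

definition regular_sequence :: "('a, 'm) ring_scheme \<Rightarrow> 'a list \<Rightarrow> bool" where
  "regular_sequence R xs \<longleftrightarrow> set xs \<subseteq> carrier R \<and>
     (\<forall>i<length xs. \<forall>a \<in> carrier R.
        xs ! i \<otimes>\<^bsub>R\<^esub> a \<in> genideal R (set (take i xs)) \<longrightarrow> a \<in> genideal R (set (take i xs))) \<and>
     genideal R (set xs) \<noteq> carrier R"

definition depth :: "('a, 'm) ring_scheme \<Rightarrow> enat" where
  "depth R = Sup {enat (length xs) | xs. set xs \<subseteq> max_ideal R \<and> regular_sequence R xs}"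

definition cohen_macaulay_local :: "('a, 'm) ring_scheme \<Rightarrow> bool" where
  "cohen_macaulay_local R \<longleftrightarrow> noetherian_local R \<and> depth R = krull_dim R"

definition cohen_macaulay :: "('a, 'm) ring_scheme \<Rightarrow> bool" where
  "cohen_macaulay R \<longleftrightarrow>
     noetherian_cring R \<and> (\<forall>P \<in> spec R. cohen_macaulay_local (loc_prime R P))"

definition regular_local :: "('a, 'm) ring_scheme \<Rightarrow> bool" where
  "regular_local R \<longleftrightarrow> noetherian_local R \<and>
     (\<exists>G \<subseteq> carrier R. finite G \<and> genideal R G = max_ideal R \<and> enat (card G) = krull_dim R)"

definition regular_ring :: "('a, 'm) ring_scheme \<Rightarrow> bool" where
  "regular_ring R \<longleftrightarrow>
     noetherian_cring R \<and> (\<forall>P \<in> spec R. regular_local (loc_prime R P))"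

definition regular_locus :: "('a, 'm) ring_scheme \<Rightarrow> 'a set set" where
  "regular_locus R = {P \<in> spec R. regular_local (loc_prime R P)}"


subsection \<open>Tensor products of algebras\<close>

text \<open>The monoid ring over the integers of the multiplicative monoid of \<open>B \<times> C\<close>.  The
  basis element of a pair \<open>(b, c)\<close> becomes the pure tensor in the quotient below.  The additive
  span of the bilinear relations is already an ideal, because multiplying a relation
  by a basis element gives a relation.\<close>

definition pair_monoid_ring ::
  "('b, 'm) ring_scheme \<Rightarrow> ('c, 'n) ring_scheme \<Rightarrow> ('b \<times> 'c \<Rightarrow>\<^sub>0 int) ring" where
  "pair_monoid_ring B C =
    \<lparr>carrier = {u. Poly_Mapping.keys u \<subseteq> carrier B \<times> carrier C},
     monoid.mult = (\<lambda>u v. frag_extend (\<lambda>(b, c). frag_extend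
               (\<lambda>(b', c'). frag_of (b \<otimes>\<^bsub>B\<^esub> b', c \<otimes>\<^bsub>C\<^esub> c')) v) u),
     one = frag_of (\<one>\<^bsub>B\<^esub>, \<one>\<^bsub>C\<^esub>),
     ring.zero = 0,
     add = (+)\<rparr>"

definition tensor_relations ::
  "('a, 'l) ring_scheme \<Rightarrow> ('b, 'm) ring_scheme \<Rightarrow> ('a \<Rightarrow> 'b) \<Rightarrow>
   ('c, 'n) ring_scheme \<Rightarrow> ('a \<Rightarrow> 'c) \<Rightarrow> ('b \<times> 'c \<Rightarrow>\<^sub>0 int) set" where
  "tensor_relations A B \<beta> C \<gamma> =
     {frag_of (b \<oplus>\<^bsub>B\<^esub> b', c) - frag_of (b, c) - frag_of (b', c) | b b' c.
        b \<in> carrier B \<and> b' \<in> carrier B \<and> c \<in> carrier C} \<union>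
     {frag_of (b, c \<oplus>\<^bsub>C\<^esub> c') - frag_of (b, c) - frag_of (b, c') | b c c'.
        b \<in> carrier B \<and> c \<in> carrier C \<and> c' \<in> carrier C} \<union>
     {frag_of (\<beta> a \<otimes>\<^bsub>B\<^esub> b, c) - frag_of (b, \<gamma> a \<otimes>\<^bsub>C\<^esub> c) | a b c.
        a \<in> carrier A \<and> b \<in> carrier B \<and> c \<in> carrier C}"

definition tensor_ideal ::
  "('a, 'l) ring_scheme \<Rightarrow> ('b, 'm) ring_scheme \<Rightarrow> ('a \<Rightarrow> 'b) \<Rightarrow>
   ('c, 'n) ring_scheme \<Rightarrow> ('a \<Rightarrow> 'c) \<Rightarrow> ('b \<times> 'c \<Rightarrow>\<^sub>0 int) set" where
  "tensor_ideal A B \<beta> C \<gamma> = genideal (pair_monoid_ring B C) (tensor_relations A B \<beta> C \<gamma>)"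

definition tensor ::
  "('a, 'l) ring_scheme \<Rightarrow> ('b, 'm) ring_scheme \<Rightarrow> ('a \<Rightarrow> 'b) \<Rightarrow>
   ('c, 'n) ring_scheme \<Rightarrow> ('a \<Rightarrow> 'c) \<Rightarrow> ('b \<times> 'c \<Rightarrow>\<^sub>0 int) set ring" where
  "tensor A B \<beta> C \<gamma> = pair_monoid_ring B C Quot tensor_ideal A B \<beta> C \<gamma>"

definition tensor_inr ::
  "('a, 'l) ring_scheme \<Rightarrow> ('b, 'm) ring_scheme \<Rightarrow> ('a \<Rightarrow> 'b) \<Rightarrow>
   ('c, 'n) ring_scheme \<Rightarrow> ('a \<Rightarrow> 'c) \<Rightarrow> 'c \<Rightarrow> ('b \<times> 'c \<Rightarrow>\<^sub>0 int) set" where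
  "tensor_inr A B \<beta> C \<gamma> c =
     tensor_ideal A B \<beta> C \<gamma> +>\<^bsub>pair_monoid_ring B C\<^esub> frag_of (\<one>\<^bsub>B\<^esub>, c)"


subsection \<open>Completion and formal fibres\<close>

text \<open>The inverse limit of the rings \<open>A / M\<^sup>n\<close>.  A coset modulo the next power maps to the coset
  that contains it.\<close>

definition completion :: "('a, 'm) ring_scheme \<Rightarrow> 'a set \<Rightarrow> (nat \<Rightarrow> 'a set) ring" where
  "completion A M = (let Q = (\<lambda>n::nat. A Quot (M [^]\<^bsub>ideals_set A\<^esub> n)) in
    \<lparr>carrier = {x. \<forall>n. x n \<in> carrier (Q n) \<and> x (Suc n) \<subseteq> x n},
     monoid.mult = (\<lambda>x y n. x n \<otimes>\<^bsub>Q n\<^esub> y n),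
     one = (\<lambda>n. \<one>\<^bsub>Q n\<^esub>),
     ring.zero = (\<lambda>n. \<zero>\<^bsub>Q n\<^esub>),
     add = (\<lambda>x y n. x n \<oplus>\<^bsub>Q n\<^esub> y n)\<rparr>)"

definition completion_map :: "('a, 'm) ring_scheme \<Rightarrow> 'a set \<Rightarrow> 'a \<Rightarrow> (nat \<Rightarrow> 'a set)" where
  "completion_map A M a = (\<lambda>n. (M [^]\<^bsub>ideals_set A\<^esub> n) +>\<^bsub>A\<^esub> a)"

definition residue_field :: "('a, 'm) ring_scheme \<Rightarrow> 'a set \<Rightarrow> ('a \<times> 'a) set set ring" where
  "residue_field A P = loc_prime A P Quot max_ideal (loc_prime A P)"

definition residue_map :: "('a, 'm) ring_scheme \<Rightarrow> 'a set \<Rightarrow> 'a \<Rightarrow> ('a \<times> 'a) set set" where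
  "residue_map A P a =
     max_ideal (loc_prime A P) +>\<^bsub>loc_prime A P\<^esub> loc_map A (carrier A - P) a"

definition finite_field_extension ::
  "('a, 'm) ring_scheme \<Rightarrow> ('b, 'n) ring_scheme \<Rightarrow> ('a \<Rightarrow> 'b) \<Rightarrow> bool" where
  "finite_field_extension K L \<phi> \<longleftrightarrow> field K \<and> field L \<and> \<phi> \<in> ring_hom K L \<and>
     ring.finite_dimension L (\<phi> ` carrier K) (carrier L)"

text \<open>A finite extension of a field with carrier in \<open>'k\<close> has at most as many elements as there are
  lists over \<open>'k\<close>.  Up to isomorphism, the quantifier over \<open>L\<close> below therefore covers all finite
  extensions.\<close>

definition geometrically_regular ::
  "('k, 'm) ring_scheme \<Rightarrow> ('b, 'n) ring_scheme \<Rightarrow> ('k \<Rightarrow> 'b) \<Rightarrow> bool" where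
  "geometrically_regular K B \<psi> \<longleftrightarrow> (\<forall>(L :: 'k list ring) \<phi>.
     finite_field_extension K L \<phi> \<longrightarrow> regular_ring (tensor K B \<psi> L \<phi>))"

definition geometrically_regular_formal_fibres :: "('a, 'm) ring_scheme \<Rightarrow> bool" where
  "geometrically_regular_formal_fibres A \<longleftrightarrow> (\<forall>q \<in> spec A.
     let C = completion A (max_ideal A); \<iota> = completion_map A (max_ideal A);
         \<kappa> = residue_field A q; \<rho> = residue_map A q
     in geometrically_regular \<kappa> (tensor A C \<iota> \<kappa> \<rho>) (tensor_inr A C \<iota> \<kappa> \<rho>))"


subsection \<open>Excellent rings\<close>

definition finite_type_algebra ::
  "('a, 'm) ring_scheme \<Rightarrow> ('b, 'n) ring_scheme \<Rightarrow> ('a \<Rightarrow> 'b) \<Rightarrow> bool" where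
  "finite_type_algebra R B \<phi> \<longleftrightarrow> cring B \<and> \<phi> \<in> ring_hom R B \<and>
     (\<exists>G \<subseteq> carrier B. finite G \<and> generate_ring B (\<phi> ` carrier R \<union> G) = carrier B)"

text \<open>As for finite field extensions, lists over \<open>'a\<close> are numerous enough for the quantifiers over
  \<open>B\<close> below to cover all finitely generated algebras up to isomorphism.\<close>

definition universally_catenary :: "('a, 'm) ring_scheme \<Rightarrow> bool" where
  "universally_catenary R \<longleftrightarrow> noetherian_cring R \<and>
     (\<forall>(B :: 'a list ring) \<phi>. finite_type_algebra R B \<phi> \<longrightarrow> catenary B)"

definition G_ring :: "('a, 'm) ring_scheme \<Rightarrow> bool" where
  "G_ring R \<longleftrightarrow> noetherian_cring R \<and>
     (\<forall>P \<in> spec R. geometrically_regular_formal_fibres (loc_prime R P))"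

definition J2_ring :: "('a, 'm) ring_scheme \<Rightarrow> bool" where
  "J2_ring R \<longleftrightarrow> noetherian_cring R \<and>
     (\<forall>(B :: 'a list ring) \<phi>. finite_type_algebra R B \<phi> \<longrightarrow> zariski_open B (regular_locus B))"

definition excellent_ring :: "('a, 'm) ring_scheme \<Rightarrow> bool" where
  "excellent_ring R \<longleftrightarrow>
     noetherian_cring R \<and> universally_catenary R \<and> G_ring R \<and> J2_ring R"

end

theory Submission
  imports Defs
begin

text \<open>Choose a prime \<open>P\<close> minimal over \<open>I\<close>; off the zero set of some \<open>g \<notin> P\<close> it is the only minimal prime
of \<open>I\<close>.  Suppose that, after inverting one further element outside \<open>P\<close>, the ring \<open>R/P\<close> is regular and
each \<open>R/I\<^sup>n\<close> has a finite filtration whose quotients are isomorphic to \<open>R/P\<close>.  Localize at a prime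
\<open>q\<close> that survives.  A system of parameters that generates the maximal ideal of \<open>(R/P)\<^sub>q\<close> is a regular
sequence there, hence is regular on \<open>(R/I\<^sup>n)\<^sub>q\<close> by the filtration, and the two rings have the same dimension
because \<open>P\<close> and \<open>I\<^sup>n\<close> lie in the same primes.  So \<open>(R/I\<^sup>n)\<^sub>q\<close> is Cohen-Macaulay.

Regularity of \<open>R/P\<close> off a proper closed set is where excellence enters: the regular locus of \<open>R/P\<close> is
open and contains the generic point (\<open>J2_generically_regular\<close>).

The filtration has to be obtained for all \<open>n\<close> with one denominator (\<open>generic_normal_flatness\<close>).  Let the \<open>v\<^sub>i\<close>
be generators of \<open>I\<close> together with generators of \<open>P\<close>, and order the monomials in the \<open>v\<^sub>i\<close> by weight and then
lexicographically.  The ideals spanned by the monomials from a given one onwards form a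
descending filtration with cyclic quotients \<open>R/L\<^sub>e\<close>, one for each exponent \<open>e\<close>.  Multiplying by
\<open>v\<^sub>i \<in> P\<close> raises a monomial, so \<open>P \<subseteq> L\<^sub>e\<close>; multiplying by any monomial shows that \<open>L\<^sub>e\<close> grows with \<open>e\<close>.  By
Dickson's lemma finitely many \<open>e\<close> decide where \<open>L\<^sub>e \<noteq> P\<close>, so one \<open>f \<notin> P\<close> lies in every \<open>L\<^sub>e\<close> different from \<open>P\<close>.
Once \<open>f\<close> is inverted every quotient is \<open>R/P\<close> or zero.  If the generators of \<open>I\<close> have a weight \<open>k\<close>
that is large compared with the nilpotency of \<open>P\<close> modulo \<open>I\<close> and those of \<open>P\<close> have weight one, then the part of
weight at least \<open>nk\<close> becomes \<open>I\<^sup>n\<close> after localization.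

The dimension theory (Krull's principal ideal theorem, and its consequence that a regular
local ring is a domain in which parameters form a regular sequence) is developed inside one Noetherian
ring \<open>R\<close>.  Ideals of \<open>R\<^sub>q\<close> are represented by ideals of \<open>R\<close> that are saturated with respect to the complement
of \<open>q\<close>, which avoids a tower of localizations.  Only in the end are the rings in the
theorem compared with \<open>R\<close>, through the locale \<open>fraction_hom\<close> of homomorphisms whose target consists of fractions.\<close>

section \<open>Ideals and their saturations\<close>

context cring begin

lemma ideal_subset: "ideal J R \<Longrightarrow> J \<subseteq> carrier R"
  by (meson ideal.Icarr subsetI)

lemma ideal_zero: "ideal J R \<Longrightarrow> \<zero> \<in> J"
  by (meson additive_subgroup.zero_closed ideal.axioms(1))

lemma ideal_add: "ideal J R \<Longrightarrow> a \<in> J \<Longrightarrow> b \<in> J \<Longrightarrow> a \<oplus> b \<in> J"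
  by (meson additive_subgroup.a_closed ideal.axioms(1))

lemma ideal_mult: "ideal J R \<Longrightarrow> a \<in> J \<Longrightarrow> r \<in> carrier R \<Longrightarrow> r \<otimes> a \<in> J"
  by (meson ideal.I_l_closed)

lemma ideal_minus: "ideal J R \<Longrightarrow> a \<in> J \<Longrightarrow> b \<in> J \<Longrightarrow> a \<ominus> b \<in> J"
  unfolding a_minus_def
  by (metis additive_subgroup.a_inv_closed abelian_group.a_inv_closed ideal.axioms(1) ideal_add)

lemma idealI':
  assumes "J \<subseteq> carrier R" "\<zero> \<in> J" "\<And>a b. a \<in> J \<Longrightarrow> b \<in> J \<Longrightarrow> a \<oplus> b \<in> J"
    and "\<And>a r. a \<in> J \<Longrightarrow> r \<in> carrier R \<Longrightarrow> r \<otimes> a \<in> J"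
  shows "ideal J R"
proof (rule idealI[OF ring_axioms])
  show "subgroup J (add_monoid R)"
  proof (rule add.subgroupI)
    fix a assume "a \<in> J"
    then have "(\<ominus> \<one>) \<otimes> a \<in> J" using assms(4) by simp
    moreover have "(\<ominus> \<one>) \<otimes> a = \<ominus> a" using \<open>a \<in> J\<close> assms(1) by (simp add: l_minus subset_iff)
    ultimately show "\<ominus> a \<in> J" by simp
  qed (use assms in auto)
next
  fix a x assume "a \<in> J" "x \<in> carrier R"
  then show "x \<otimes> a \<in> J" "a \<otimes> x \<in> J" using assms(1,4) m_comm[of a x] by auto
qed

lemma prime_mem:
  assumes "primeideal p R" "a \<otimes> b \<in> p" "a \<in> carrier R" "b \<in> carrier R" "a \<notin> p"
  shows "b \<in> p"
  using primeideal.I_prime[OF assms(1,3,4,2)] assms(5) by simp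

lemma prime_ideal: "primeideal p R \<Longrightarrow> ideal p R"
  by (simp add: primeideal.axioms(1))

lemma prime_one: "primeideal p R \<Longrightarrow> \<one> \<notin> p"
  by (metis ideal.one_imp_carrier prime_ideal primeideal.I_notcarr)

lemma primeidealI':
  assumes "ideal p R" "\<one> \<notin> p"
    "\<And>a b. a \<in> carrier R \<Longrightarrow> b \<in> carrier R \<Longrightarrow> a \<otimes> b \<in> p \<Longrightarrow> a \<notin> p \<Longrightarrow> b \<in> p"
  shows "primeideal p R"
proof (rule primeidealI[OF assms(1) is_cring])
  show "carrier R \<noteq> p" using assms(2) by (metis one_closed)
qed (metis assms(3))

definition adjoin :: "'a set \<Rightarrow> 'a \<Rightarrow> 'a set" where
  "adjoin J x = {j \<oplus> r \<otimes> x | j r. j \<in> J \<and> r \<in> carrier R}"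

text \<open>The contraction to \<open>R\<close> of the extension of \<open>J\<close> to the local ring \<open>R\<^sub>q\<close>.\<close>

definition sat :: "'a set \<Rightarrow> 'a set \<Rightarrow> 'a set" where
  "sat q J = {a \<in> carrier R. \<exists>t \<in> carrier R - q. t \<otimes> a \<in> J}"

definition colon :: "'a set \<Rightarrow> 'a \<Rightarrow> 'a set" where
  "colon J m = {a \<in> carrier R. a \<otimes> m \<in> J}"

lemma colon_ideal: "ideal J R \<Longrightarrow> m \<in> carrier R \<Longrightarrow> ideal (colon J m) R"
  by (rule idealI') (auto simp: colon_def ideal_zero l_distr ideal_add m_assoc ideal_mult)

lemma adjoin_ideal:
  assumes "ideal J R" "x \<in> carrier R"
  shows "ideal (adjoin J x) R"
proof (rule idealI')
  show "adjoin J x \<subseteq> carrier R"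
    using assms ideal_subset[OF assms(1)] by (auto simp: adjoin_def)
  have "\<zero> = \<zero> \<oplus> \<zero> \<otimes> x" using assms by simp
  then show "\<zero> \<in> adjoin J x" using ideal_zero[OF assms(1)] unfolding adjoin_def by blast
next
  fix a b assume "a \<in> adjoin J x" "b \<in> adjoin J x"
  then obtain j r j' r' where ab: "a = j \<oplus> r \<otimes> x" "b = j' \<oplus> r' \<otimes> x"
    and m: "j \<in> J" "j' \<in> J" "r \<in> carrier R" "r' \<in> carrier R" unfolding adjoin_def by blast
  then have c: "j \<in> carrier R" "j' \<in> carrier R" using ideal_subset[OF assms(1)] by auto
  have "a \<oplus> b = (j \<oplus> j') \<oplus> (r \<oplus> r') \<otimes> x"
    unfolding ab using c m assms(2) by algebra
  then show "a \<oplus> b \<in> adjoin J x" using m ideal_add[OF assms(1)] unfolding adjoin_def by blast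
next
  fix a s assume "a \<in> adjoin J x" and s: "s \<in> carrier R"
  then obtain j r where ab: "a = j \<oplus> r \<otimes> x"
    and m: "j \<in> J" "r \<in> carrier R" unfolding adjoin_def by blast
  then have c: "j \<in> carrier R" using ideal_subset[OF assms(1)] by auto
  have "s \<otimes> a = (s \<otimes> j) \<oplus> (s \<otimes> r) \<otimes> x"
    unfolding ab using c m s assms(2) by algebra
  then show "s \<otimes> a \<in> adjoin J x" using m s ideal_mult[OF assms(1)] unfolding adjoin_def by blast
qed

lemma adjoin_superset: "ideal J R \<Longrightarrow> x \<in> carrier R \<Longrightarrow> J \<subseteq> adjoin J x"
proof
  fix j assume "ideal J R" "x \<in> carrier R" "j \<in> J"
  then have "j \<in> carrier R" using ideal_subset by blast
  then have "j = j \<oplus> \<zero> \<otimes> x" using \<open>x \<in> carrier R\<close> by simp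
  then show "j \<in> adjoin J x" using \<open>j \<in> J\<close> unfolding adjoin_def by blast
qed

lemma adjoin_self: "ideal J R \<Longrightarrow> x \<in> carrier R \<Longrightarrow> x \<in> adjoin J x"
proof -
  assume a: "ideal J R" "x \<in> carrier R"
  then have "x = \<zero> \<oplus> \<one> \<otimes> x" by auto
  then show "x \<in> adjoin J x" using ideal_zero[OF a(1)] unfolding adjoin_def by blast
qed

lemma adjoin_least: "ideal K R \<Longrightarrow> J \<subseteq> K \<Longrightarrow> x \<in> K \<Longrightarrow> adjoin J x \<subseteq> K"
  unfolding adjoin_def by (auto intro!: ideal_add ideal_mult)

lemma adjoin_mono: "J \<subseteq> K \<Longrightarrow> adjoin J x \<subseteq> adjoin K x"
  unfolding adjoin_def by blast

lemma adjoin_commute_le: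
  assumes J: "ideal J R" and x: "x \<in> carrier R" and y: "y \<in> carrier R"
  shows "adjoin (adjoin J x) y \<subseteq> adjoin (adjoin J y) x"
proof (rule adjoin_least)
  have Jy: "ideal (adjoin J y) R" using adjoin_ideal[OF J y] .
  show "ideal (adjoin (adjoin J y) x) R" using adjoin_ideal[OF Jy x] .
  show "adjoin J x \<subseteq> adjoin (adjoin J y) x" using adjoin_mono[OF adjoin_superset[OF J y]] .
  show "y \<in> adjoin (adjoin J y) x" using adjoin_self[OF J y] adjoin_superset[OF Jy x] by blast
qed

lemma adjoin_commute:
  "ideal J R \<Longrightarrow> x \<in> carrier R \<Longrightarrow> y \<in> carrier R \<Longrightarrow> adjoin (adjoin J x) y = adjoin (adjoin J y) x"
  by (simp add: adjoin_commute_le subset_antisym)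

lemma adjoin_eq_genideal:
  assumes "A \<subseteq> carrier R" "x \<in> carrier R"
  shows "adjoin (genideal R A) x = genideal R (insert x A)"
proof
  have A: "ideal (genideal R A) R" and xA: "ideal (genideal R (insert x A)) R"
    using assms by (auto intro: genideal_ideal)
  have "insert x A \<subseteq> genideal R (insert x A)" using assms by (intro genideal_self) auto
  then show "adjoin (genideal R A) x \<subseteq> genideal R (insert x A)"
    using xA by (intro adjoin_least genideal_minimal) auto
  have "insert x A \<subseteq> adjoin (genideal R A) x"
    using adjoin_self[OF A assms(2)] adjoin_superset[OF A assms(2)] genideal_self[OF assms(1)] by auto
  then show "genideal R (insert x A) \<subseteq> adjoin (genideal R A) x"
    by (intro genideal_minimal adjoin_ideal A assms(2))
qed

lemma sat_subset: "sat q J \<subseteq> carrier R" by (auto simp: sat_def)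

lemma sat_mono: "J \<subseteq> K \<Longrightarrow> sat q J \<subseteq> sat q K" by (auto simp: sat_def)

lemma satI: "a \<in> carrier R \<Longrightarrow> t \<in> carrier R \<Longrightarrow> t \<notin> q \<Longrightarrow> t \<otimes> a \<in> J \<Longrightarrow> a \<in> sat q J"
  by (auto simp: sat_def)

lemma satE:
  assumes "a \<in> sat q J"
  obtains t where "a \<in> carrier R" "t \<in> carrier R" "t \<notin> q" "t \<otimes> a \<in> J"
  using assms by (auto simp: sat_def)

lemma prime_mult_notin:
  "primeideal q R \<Longrightarrow> s \<in> carrier R \<Longrightarrow> t \<in> carrier R \<Longrightarrow> s \<notin> q \<Longrightarrow> t \<notin> q \<Longrightarrow> s \<otimes> t \<notin> q"
  using prime_mem by blast

lemma sat_superset: "primeideal q R \<Longrightarrow> ideal J R \<Longrightarrow> J \<subseteq> sat q J"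
  using prime_one ideal_subset[of J] by (auto intro!: satI[of _ \<one>])

lemma sat_ideal:
  assumes q: "primeideal q R" and J: "ideal J R"
  shows "ideal (sat q J) R"
proof (rule idealI'[OF sat_subset])
  show "\<zero> \<in> sat q J" using sat_superset[OF q J] ideal_zero[OF J] by auto
next
  fix a b assume "a \<in> sat q J" "b \<in> sat q J"
  then obtain s t where st: "a \<in> carrier R" "t \<in> carrier R" "t \<notin> q" "t \<otimes> a \<in> J"
     "b \<in> carrier R" "s \<in> carrier R" "s \<notin> q" "s \<otimes> b \<in> J" by (metis satE)
  have "(s \<otimes> t) \<otimes> (a \<oplus> b) = s \<otimes> (t \<otimes> a) \<oplus> t \<otimes> (s \<otimes> b)" using st by algebra
  also have "\<dots> \<in> J" using st J ideal_add ideal_mult by simp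
  finally show "a \<oplus> b \<in> sat q J"
    using st prime_mult_notin[OF q] by (intro satI[of _ "s \<otimes> t"]) auto
next
  fix a r assume "a \<in> sat q J" and r: "r \<in> carrier R"
  then obtain t where st: "a \<in> carrier R" "t \<in> carrier R" "t \<notin> q" "t \<otimes> a \<in> J" by (metis satE)
  have "t \<otimes> (r \<otimes> a) = r \<otimes> (t \<otimes> a)" using st r by algebra
  also have "\<dots> \<in> J" using st r J ideal_mult by simp
  finally show "r \<otimes> a \<in> sat q J" using st r by (intro satI[of _ t]) auto
qed

text \<open>The smaller prime \<open>p\<close> has the larger complement, so saturation at \<open>p\<close> absorbs saturation at \<open>q\<close>.\<close>

lemma sat_closed:
  assumes q: "primeideal q R" and p: "primeideal p R" "p \<subseteq> q" and J: "ideal J R"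
  shows "sat q (sat p J) = sat p J"
proof
  show "sat q (sat p J) \<subseteq> sat p J"
  proof
    fix a assume "a \<in> sat q (sat p J)"
    then obtain s t where st: "a \<in> carrier R" "t \<in> carrier R" "t \<notin> q" "t \<otimes> a \<in> carrier R"
      "s \<in> carrier R" "s \<notin> p" "s \<otimes> (t \<otimes> a) \<in> J" by (metis satE)
    then show "a \<in> sat p J"
      using prime_mult_notin[OF p(1), of s t] p(2) by (intro satI[of _ "s \<otimes> t"]) (auto simp: m_assoc)
  qed
qed (rule sat_superset[OF q sat_ideal[OF p(1) J]])

lemma sat_closedD:
  assumes "sat q J = J" "t \<in> carrier R" "t \<notin> q" "a \<in> carrier R" "t \<otimes> a \<in> J" shows "a \<in> J"
  using assms satI by blast

lemma sat_prime:
  assumes q: "primeideal q R" and p: "primeideal p R" "p \<subseteq> q"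
  shows "sat q p = p"
proof
  show "sat q p \<subseteq> p"
    using prime_mem[OF p(1)] p(2) by (auto elim!: satE)
qed (rule sat_superset[OF q prime_ideal[OF p(1)]])

lemma sat_least:
  assumes "primeideal q R" "primeideal p R" "p \<subseteq> q" "J \<subseteq> p" shows "sat q J \<subseteq> p"
  using sat_mono[OF assms(4), of q] sat_prime[OF assms(1-3)] by simp

lemma sat_eq_carrier:
  assumes "primeideal q R" "ideal J R" "\<not> J \<subseteq> q" shows "sat q J = carrier R"
proof
  obtain t where t: "t \<in> J" "t \<notin> q" using assms(3) by blast
  then have "t \<in> carrier R" using ideal_subset[OF assms(2)] by auto
  show "carrier R \<subseteq> sat q J"
  proof
    fix a assume "a \<in> carrier R"
    then have "t \<otimes> a \<in> J" using ideal_mult[OF assms(2) t(1)] \<open>t \<in> carrier R\<close> m_comm by metis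
    then show "a \<in> sat q J" using t \<open>a \<in> _\<close> \<open>t \<in> carrier R\<close> by (intro satI[of _ t]) auto
  qed
qed (rule sat_subset)

end

section \<open>Nakayama's lemma and descending chains\<close>

locale noeth_cring = cring R + noetherian_ring R for R (structure)
begin

lemma ideal_max:
  assumes "family \<noteq> {}" "\<And>K. K \<in> family \<Longrightarrow> ideal K R"
  obtains K where "K \<in> family" "\<And>K'. K' \<in> family \<Longrightarrow> K \<subseteq> K' \<Longrightarrow> K' = K"
proof -
  have "\<exists>M\<in>family. \<forall>Y\<in>family. M \<subseteq> Y \<longrightarrow> Y = M"
  proof (rule subset_Zorn_nonempty[OF assms(1)])
    fix C assume C: "C \<noteq> {}" "subset.chain family C"
    then have "subset.chain {I. ideal I R} C"
      using assms(2) by (auto simp: subset.chain_def)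
    then show "\<Union> C \<in> family" using ideal_chain_is_trivial[OF C(1)] C(2) by (auto simp: subset.chain_def)
  qed
  then show thesis using that by blast
qed

text \<open>Among the annihilators of nonzero elements of \<open>R/K\<close> a maximal one is prime: it is an associated prime.\<close>

lemma colon_prime_exists:
  assumes Ki: "ideal K R" and ne: "K \<noteq> carrier R"
  shows "\<exists>s \<in> carrier R. s \<notin> K \<and> primeideal (colon K s) R"
proof -
  obtain s0 where s0: "s0 \<in> carrier R" "s0 \<notin> K" using ideal_subset[OF Ki] ne by blast
  define PP where "PP = {colon K s | s. s \<in> carrier R \<and> s \<notin> K}"
  obtain p where p: "p \<in> PP" and pmax: "\<And>K'. K' \<in> PP \<Longrightarrow> p \<subseteq> K' \<Longrightarrow> K' = p"
  proof (rule ideal_max[of PP])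
    show "PP \<noteq> {}" using s0 unfolding PP_def by blast
  qed (use colon_ideal[OF Ki] in \<open>auto simp: PP_def\<close>)
  obtain s where s: "s \<in> carrier R" "s \<notin> K" "p = colon K s" using p unfolding PP_def by blast
  have pid: "ideal p R" using colon_ideal[OF Ki s(1)] s by simp
  have "primeideal p R"
  proof (rule primeidealI'[OF pid])
    show "\<one> \<notin> p" using s by (simp add: colon_def)
    fix a b assume ab: "a \<in> carrier R" "b \<in> carrier R" "a \<otimes> b \<in> p" "a \<notin> p"
    then have "a \<otimes> s \<notin> K" using s by (simp add: colon_def)
    then have 1: "colon K (a \<otimes> s) \<in> PP" using ab s unfolding PP_def by blast
    have "p \<subseteq> colon K (a \<otimes> s)"
    proof
      fix c assume "c \<in> p"
      then have c: "c \<in> carrier R" "c \<otimes> s \<in> K" using s by (auto simp: colon_def)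
      have "c \<otimes> (a \<otimes> s) = a \<otimes> (c \<otimes> s)" using c(1) ab(1) s(1) by algebra
      then show "c \<in> colon K (a \<otimes> s)" using c ideal_mult[OF Ki] ab by (auto simp: colon_def)
    qed
    then have eq: "colon K (a \<otimes> s) = p" using pmax[OF 1] by simp
    have "(a \<otimes> b) \<otimes> s \<in> K" using ab(3) unfolding s(3) colon_def by simp
    moreover have "b \<otimes> (a \<otimes> s) = (a \<otimes> b) \<otimes> s" using ab(1,2) s(1) by algebra
    ultimately have "b \<in> colon K (a \<otimes> s)" using ab(2) by (simp add: colon_def)
    then show "b \<in> p" unfolding eq .
  qed
  then show ?thesis using s by blast
qed

text \<open>Nakayama's lemma for \<open>N = N' + x N\<close> in \<open>R\<^sub>q\<close> with \<open>x\<close> in the maximal ideal.  Choose a saturated ideal \<open>K \<supseteq> N'\<close> that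
is maximal among those not containing \<open>N\<close>, and \<open>a \<in> N\<close> outside \<open>K\<close>.  Then \<open>N\<close> lies in \<open>K + (a)\<close> locally, and
the hypothesis gives \<open>(u - x r) a \<in> K\<close> with a unit \<open>u\<close>, which forces \<open>a \<in> K\<close>.\<close>

lemma nakayama:
  assumes q: "primeideal q R" and N': "ideal N' R" and x: "x \<in> q"
    and N: "\<And>a. a \<in> N \<Longrightarrow> \<exists>t \<in> carrier R - q. \<exists>n' \<in> N'. \<exists>n \<in> N. t \<otimes> a = n' \<oplus> x \<otimes> n"
    and Nc: "N \<subseteq> carrier R"
  shows "N \<subseteq> sat q N'"
proof (rule ccontr)
  assume not: "\<not> N \<subseteq> sat q N'"
  have qi: "ideal q R" using q prime_ideal by blast
  have xc: "x \<in> carrier R" using x qi ideal_subset by blast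
  define family where "family = {K. ideal K R \<and> sat q K = K \<and> N' \<subseteq> K \<and> \<not> N \<subseteq> K}"
  have "sat q N' \<in> family"
    using not sat_ideal[OF q N'] sat_closed[OF q q _ N'] sat_superset[OF q N'] by (simp add: family_def)
  then obtain K where K: "K \<in> family" and max: "\<And>K'. K' \<in> family \<Longrightarrow> K \<subseteq> K' \<Longrightarrow> K' = K"
    using ideal_max[of family] family_def by (metis (mono_tags, lifting) empty_iff mem_Collect_eq)
  have Ki: "ideal K R" and Ks: "sat q K = K" and NK: "N' \<subseteq> K" using K by (auto simp: family_def)
  obtain a where a: "a \<in> N" "a \<notin> K" using K by (auto simp: family_def)
  then have ac: "a \<in> carrier R" using Nc by auto
  define K1 where "K1 = sat q (adjoin K a)"
  have aK: "ideal (adjoin K a) R" using adjoin_ideal[OF Ki ac] .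
  have "K \<subseteq> K1" "a \<in> K1"
    using adjoin_superset[OF Ki ac] adjoin_self[OF Ki ac] sat_superset[OF q aK] by (auto simp: K1_def)
  then have "K1 \<notin> family" using max a by blast
  then have NK1: "N \<subseteq> K1"
    using \<open>K \<subseteq> K1\<close> NK sat_ideal[OF q aK] sat_closed[OF q q _ aK] unfolding family_def K1_def by auto
  obtain t n' n where t: "t \<in> carrier R" "t \<notin> q" "n' \<in> N'" "n \<in> N" "t \<otimes> a = n' \<oplus> x \<otimes> n"
    using N[OF a(1)] by blast
  obtain s where s: "s \<in> carrier R" "s \<notin> q" "s \<otimes> n \<in> adjoin K a"
    using NK1 t(4) unfolding K1_def by (meson satE subsetD)
  then obtain k r where kr: "k \<in> K" "r \<in> carrier R" "s \<otimes> n = k \<oplus> r \<otimes> a" unfolding adjoin_def by blast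
  have c: "n \<in> carrier R" "n' \<in> carrier R" "k \<in> carrier R"
    using Nc t N' kr Ki ideal_subset by blast+
  have "(s \<otimes> t \<ominus> x \<otimes> r) \<otimes> a = s \<otimes> (t \<otimes> a) \<ominus> x \<otimes> r \<otimes> a"
    using s(1) t(1) kr(2) ac xc by algebra
  also have "\<dots> = s \<otimes> n' \<oplus> x \<otimes> (s \<otimes> n) \<ominus> x \<otimes> r \<otimes> a"
    unfolding t(5) using s(1) xc c kr(2) ac by algebra
  also have "\<dots> = s \<otimes> n' \<oplus> x \<otimes> k"
    unfolding kr(3) using s(1) xc c kr(2) ac by algebra
  also have "\<dots> \<in> K" using ideal_add[OF Ki] ideal_mult[OF Ki] NK t(3) kr(1) s(1) xc by auto
  finally have *: "(s \<otimes> t \<ominus> x \<otimes> r) \<otimes> a \<in> K" .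
  have "s \<otimes> t \<ominus> x \<otimes> r \<notin> q"
  proof
    assume A: "s \<otimes> t \<ominus> x \<otimes> r \<in> q"
    have "x \<otimes> r \<in> q" using ideal_mult[OF qi x kr(2)] m_comm xc kr(2) by simp
    then have "(s \<otimes> t \<ominus> x \<otimes> r) \<oplus> x \<otimes> r \<in> q" using A ideal_add[OF qi] by blast
    moreover have "(s \<otimes> t \<ominus> x \<otimes> r) \<oplus> x \<otimes> r = s \<otimes> t" using s t xc kr by algebra
    ultimately show False using prime_mult_notin[OF q s(1) t(1) s(2) t(2)] by simp
  qed
  moreover have "s \<otimes> t \<ominus> x \<otimes> r \<in> carrier R" using s(1) t(1) xc kr(2) by simp
  ultimately have "a \<in> K" using sat_closedD[OF Ks _ _ ac *] by blast
  then show False using a by simp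
qed

text \<open>When \<open>q\<close> is the only prime between \<open>J\<close> and \<open>q\<close>, the ring \<open>R\<^sub>q/JR\<^sub>q\<close> is Artinian, and this is its descending
chain condition.  Take a maximal saturated \<open>K \<supseteq> J\<close> for which it fails.  The associated prime of \<open>K\<close> must be \<open>q\<close>, so
some \<open>s \<notin> K\<close> spans a simple submodule of \<open>R\<^sub>q/KR\<^sub>q\<close>.  A descending chain above \<open>K\<close> stabilises after adding \<open>s\<close>, by
maximality, and also in the question whether it contains \<open>s\<close>; together these determine it.\<close>

lemma stabilises:
  assumes q: "primeideal q R" and J: "ideal J R"
    and only: "\<And>p. primeideal p R \<Longrightarrow> J \<subseteq> p \<Longrightarrow> p \<subseteq> q \<Longrightarrow> p = q"
    and D: "\<And>n. ideal (D n) R" "\<And>n. sat q (D n) = D n" "\<And>n. J \<subseteq> D n"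
      "decseq D"
  shows "\<exists>n. \<forall>m\<ge>n. D m = D n"
proof (rule ccontr)
  assume not: "\<not> ?thesis"
  define bad where "bad = (\<lambda>K. ideal K R \<and> sat q K = K \<and> J \<subseteq> K \<and>
     (\<exists>D. (\<forall>n. ideal (D n) R \<and> sat q (D n) = D n \<and> K \<subseteq> D n) \<and> decseq D \<and> \<not> (\<exists>n. \<forall>m\<ge>n. D m = D n)))"
  have DJ: "\<forall>n. ideal (D n) R \<and> sat q (D n) = D n \<and> sat q J \<subseteq> D n"
  proof
    fix n show "ideal (D n) R \<and> sat q (D n) = D n \<and> sat q J \<subseteq> D n"
      using D(1)[of n] D(2)[of n] sat_mono[OF D(3)[of n], of q] by simp
  qed
  have "bad (sat q J)"
    unfolding bad_def
    by (rule conjI[OF sat_ideal[OF q J] conjI[OF sat_closed[OF q q subset_refl J] conjI[OF sat_superset[OF q J]]]],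
        rule exI[of _ D], rule conjI[OF DJ conjI[OF D(4) not]])
  have bad_ideal: "ideal K R" if "bad K" for K using that unfolding bad_def by blast
  obtain K where K: "bad K" and max: "\<And>K'. bad K' \<Longrightarrow> K \<subseteq> K' \<Longrightarrow> K' = K"
  proof (rule ideal_max[of "Collect bad"])
    show "Collect bad \<noteq> {}" using \<open>bad (sat q J)\<close> by blast
  qed (use bad_ideal in auto)
  from K obtain D where D: "\<And>n. ideal (D n) R" "\<And>n. sat q (D n) = D n" "\<And>n. K \<subseteq> D n" "decseq D"
    and nst: "\<not> (\<exists>n. \<forall>m\<ge>n. D m = D n)" unfolding bad_def by blast
  have Ki: "ideal K R" and Ks: "sat q K = K" and JK: "J \<subseteq> K" using K by (auto simp: bad_def)
  have "K \<noteq> carrier R" using nst D(1,3) ideal_subset by (metis subset_antisym)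
  then obtain s where s: "s \<in> carrier R" "s \<notin> K" and pp: "primeideal (colon K s) R"
    using colon_prime_exists[OF Ki] by blast
  define p where "p = colon K s"
  have "p \<subseteq> q"
    using s sat_closedD[OF Ks] unfolding p_def colon_def by blast
  moreover have "J \<subseteq> p"
  proof
    fix c assume c: "c \<in> J"
    then have cc: "c \<in> carrier R" using ideal_subset[OF J] by blast
    have "s \<otimes> c \<in> K" using ideal_mult[OF Ki _ s(1)] JK c by blast
    then show "c \<in> p" unfolding p_def colon_def using cc m_comm[OF cc s(1)] by simp
  qed
  ultimately have pq: "p = q" using only pp unfolding p_def by blast
  define K1 where "K1 = sat q (adjoin K s)"
  have aK: "ideal (adjoin K s) R" using adjoin_ideal[OF Ki s(1)] .
  have K1: "K \<subseteq> K1" "s \<in> K1"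
    using adjoin_superset[OF Ki s(1)] adjoin_self[OF Ki s(1)] sat_superset[OF q aK] by (auto simp: K1_def)
  then have "\<not> bad K1" using max s by blast
  moreover have "ideal K1 R" "sat q K1 = K1" "J \<subseteq> K1"
    using sat_ideal[OF q aK] sat_closed[OF q q _ aK] K1 JK unfolding K1_def by auto
  ultimately have good: "\<And>D. (\<And>n. ideal (D n) R \<and> sat q (D n) = D n \<and> K1 \<subseteq> D n) \<Longrightarrow> decseq D \<Longrightarrow> \<exists>n. \<forall>m\<ge>n. D m = D n"
    unfolding bad_def by blast
  define D' where "D' = (\<lambda>n. sat q (adjoin (D n) s))"
  have "\<exists>n. \<forall>m\<ge>n. D' m = D' n"
  proof (rule good)
    fix n
    show "ideal (D' n) R \<and> sat q (D' n) = D' n \<and> K1 \<subseteq> D' n"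
      unfolding D'_def K1_def
      using sat_ideal[OF q adjoin_ideal[OF D(1) s(1)]] sat_closed[OF q q _ adjoin_ideal[OF D(1) s(1)]]
        sat_mono[OF adjoin_mono[OF D(3)]] by auto
  next
    show "decseq D'" using D(4) unfolding D'_def decseq_def by (simp add: adjoin_mono sat_mono)
  qed
  then obtain n1 where n1: "\<And>m. m \<ge> n1 \<Longrightarrow> D' m = D' n1" by blast
  obtain n2 where n2: "\<And>m. m \<ge> n2 \<Longrightarrow> s \<in> D m \<longleftrightarrow> s \<in> D n2"
  proof (cases "\<exists>n. s \<notin> D n")
    case True
    then obtain n where "s \<notin> D n" by blast
    then have "s \<notin> D m" if "m \<ge> n" for m using D(4) that unfolding decseq_def by blast
    then show thesis using that \<open>s \<notin> D n\<close> by blast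
  qed (use that in blast)
  define n where "n = max n1 n2"
  have "D m = D n" if m: "m \<ge> n" for m
  proof
    show "D m \<subseteq> D n" using D(4) m unfolding decseq_def by blast
    show "D n \<subseteq> D m"
    proof
      fix d assume d: "d \<in> D n"
      have dc: "d \<in> carrier R" using d D(1) ideal_subset by blast
      have "d \<in> D' n" unfolding D'_def
        using d sat_superset[OF q adjoin_ideal[OF D(1) s(1)]] adjoin_superset[OF D(1) s(1)] by blast
      also have "D' n = D' m" using n1 m unfolding n_def by (metis max.bounded_iff order_refl)
      finally obtain t where t: "t \<in> carrier R" "t \<notin> q" "t \<otimes> d \<in> adjoin (D m) s"
        unfolding D'_def by (metis satE)
      then obtain d' r where dr: "d' \<in> D m" "r \<in> carrier R" "t \<otimes> d = d' \<oplus> r \<otimes> s" unfolding adjoin_def by blast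
      have d'c: "d' \<in> carrier R" using dr D(1) ideal_subset by blast
      have "d' \<in> D n" using dr D(4) m unfolding decseq_def by blast
      have "r \<otimes> s = t \<otimes> d \<ominus> d'" unfolding dr(3) using dr(2) s(1) d'c by algebra
      then have rsn: "r \<otimes> s \<in> D n"
        using ideal_minus[OF D(1) ideal_mult[OF D(1) d t(1)] \<open>d' \<in> D n\<close>] by simp
      \<comment> \<open>If \<open>r\<close> is not a unit at \<open>q\<close> then \<open>r \<otimes> s\<close> vanishes modulo \<open>K\<close>; otherwise \<open>s\<close> itself lies in \<open>D n\<close>.\<close>
      have "r \<otimes> s \<in> D m"
      proof (cases "r \<in> q")
        case True
        then show ?thesis using pq D(3) unfolding p_def colon_def by blast
      next
        case False
        then have "s \<in> D n" using sat_closedD[OF D(2) dr(2) _ s(1) rsn] by simp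
        then have "s \<in> D m" using n2 m unfolding n_def by (metis max.bounded_iff order_refl)
        then show ?thesis using ideal_mult[OF D(1) _ dr(2)] by blast
      qed
      then have "t \<otimes> d \<in> D m" using dr ideal_add[OF D(1)] by simp
      then show "d \<in> D m" using sat_closedD[OF D(2) t(1,2) dc] by blast
    qed
  qed
  then show False using nst by blast
qed

end

section \<open>Chains of primes and regular local rings\<close>

context noeth_cring begin

lemma prime_pow_mem:
  assumes "primeideal p R" "x \<in> carrier R" "x [^] (n::nat) \<in> p" shows "x \<in> p"
  using assms(3)
proof (induction n)
  case 0 then show ?case using prime_one[OF assms(1)] by simp
next
  case (Suc n)
  then show ?case using prime_mem[OF assms(1), of "x [^] n" x] assms(2) by auto
qed

text \<open>Krull's principal ideal theorem, in the form that serves for changing chains.  If no such \<open>p\<close> exists then \<open>q\<close> is minimal over \<open>p0 + (x)\<close>.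
Take \<open>y \<in> p1\<close> outside \<open>p0\<close>.  Saturating the ideals \<open>p0 + (y\<^sup>n)\<close> at \<open>p1\<close> gives a descending sequence \<open>E n\<close>, in the
role that symbolic powers usually have.  It stabilises modulo \<open>x\<close>, and \<open>x\<close> is a
nonzerodivisor modulo each \<open>E n\<close>, so Nakayama's lemma makes it stabilise.  This puts \<open>y\<^sup>n\<close> into
\<open>p0 + (y\<^sup>n\<^sup>+\<^sup>1)\<close> at \<open>p1\<close>, and cancelling \<open>y\<^sup>n\<close> in the domain \<open>R/p0\<close> gives a contradiction.\<close>

lemma prime_between:
  assumes p0: "primeideal p0 R" and p1: "primeideal p1 R" and q: "primeideal q R"
    and l: "p0 \<subset> p1" "p1 \<subset> q" and x: "x \<in> q"
  shows "\<exists>p. primeideal p R \<and> p0 \<subset> p \<and> p \<subset> q \<and> x \<in> p"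
proof (cases "x \<in> p1")
  case True
  then show ?thesis using p1 l by blast
next
  case xp1: False
  have i0: "ideal p0 R" using prime_ideal[OF p0] .
  have xc: "x \<in> carrier R" using x ideal_subset[OF prime_ideal[OF q]] by blast
  show ?thesis
  proof (rule ccontr)
    assume no: "\<not> ?thesis"
    obtain y where y: "y \<in> p1" "y \<notin> p0" using l by blast
    have yc: "y \<in> carrier R" using y ideal_subset[OF prime_ideal[OF p1]] by blast
    define J where "J = adjoin p0 x"
    have J: "ideal J R" unfolding J_def using adjoin_ideal[OF i0 xc] .
    have only: "p = q" if p: "primeideal p R" "J \<subseteq> p" "p \<subseteq> q" for p
    proof -
      have "p0 \<subseteq> p" "x \<in> p" using p(2) adjoin_superset[OF i0 xc] adjoin_self[OF i0 xc] unfolding J_def by auto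
      moreover have "x \<notin> p0" using l xp1 by blast
      ultimately show ?thesis using no p by blast
    qed
    \<comment> \<open>Saturation is at the smaller prime \<open>p1\<close>, so that \<open>x \<notin> p1\<close> can be cancelled.\<close>
    define E where "E = (\<lambda>n::nat. sat p1 (adjoin p0 (y [^] n)))"
    have aE: "ideal (adjoin p0 (y [^] n)) R" for n :: nat using adjoin_ideal[OF i0] yc by simp
    have E: "ideal (E n) R" for n unfolding E_def using sat_ideal[OF p1 aE] .
    have Esat1: "sat p1 (E n) = E n" for n unfolding E_def using sat_closed[OF p1 p1 _ aE] by simp
    have Esat: "sat q (E n) = E n" for n unfolding E_def using sat_closed[OF q p1 _ aE] l by blast
    have Edec: "E (Suc n) \<subseteq> E n" for n
    proof -
      have "y [^] Suc n \<in> adjoin p0 (y [^] n)"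
        using ideal_mult[OF aE adjoin_self[OF i0 nat_pow_closed[OF yc]] yc, of n] yc m_comm[of y "y [^] n"] by simp
      then have "adjoin p0 (y [^] Suc n) \<subseteq> adjoin p0 (y [^] n)"
        using adjoin_superset[OF i0, of "y [^] n"] yc by (intro adjoin_least aE) auto
      then show ?thesis unfolding E_def by (rule sat_mono)
    qed
    define D where "D = (\<lambda>n. sat q (adjoin (E n) x))"
    have aD: "ideal (adjoin (E n) x) R" for n using adjoin_ideal[OF E xc] .
    have "\<exists>n. \<forall>m\<ge>n. D m = D n"
    proof (rule stabilises[OF q J only])
      fix n
      show "ideal (D n) R" unfolding D_def using sat_ideal[OF q aD] .
      show "sat q (D n) = D n" unfolding D_def using sat_closed[OF q q _ aD] by simp
      have "p0 \<subseteq> E n" unfolding E_def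
        using adjoin_superset[OF i0, of "y [^] n"] sat_superset[OF p1 aE] yc by blast
      then have "J \<subseteq> adjoin (E n) x" unfolding J_def by (rule adjoin_mono)
      then show "J \<subseteq> D n" unfolding D_def using sat_superset[OF q aD] by blast
    next
      show "decseq D" unfolding D_def
        by (rule decseq_SucI) (rule sat_mono[OF adjoin_mono[OF Edec]])
    qed
    then obtain n where n: "D (Suc n) = D n" by (meson le_SucI order_refl)
    have "E n \<subseteq> sat q (E (Suc n))"
    proof (rule nakayama[OF q E x])
      fix a assume a: "a \<in> E n"
      have ac: "a \<in> carrier R" using a ideal_subset[OF E] by blast
      have "a \<in> D (Suc n)" unfolding n unfolding D_def
        using a adjoin_superset[OF E xc] sat_superset[OF q aD] by blast
      then obtain t where t: "t \<in> carrier R" "t \<notin> q" "t \<otimes> a \<in> adjoin (E (Suc n)) x"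
        unfolding D_def by (metis satE)
      then obtain e r where e: "e \<in> E (Suc n)" "r \<in> carrier R" "t \<otimes> a = e \<oplus> r \<otimes> x"
        unfolding adjoin_def by blast
      have ec: "e \<in> carrier R" using e(1) ideal_subset[OF E] by blast
      have eq: "x \<otimes> r = t \<otimes> a \<ominus> e" unfolding e(3) using e(2) ec xc by algebra
      have "x \<otimes> r \<in> E n" unfolding eq
        using ideal_minus[OF E ideal_mult[OF E a t(1)]] e(1) Edec by blast
      then have "r \<in> E n" using sat_closedD[OF Esat1 xc xp1 e(2)] by blast
      moreover have "t \<otimes> a = e \<oplus> x \<otimes> r" unfolding e(3) using e(2) xc by (simp add: m_comm)
      ultimately show "\<exists>t\<in>carrier R - q. \<exists>n'\<in>E (Suc n). \<exists>k\<in>E n. t \<otimes> a = n' \<oplus> x \<otimes> k"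
        using t(1,2) e(1) by blast
    qed (rule ideal_subset[OF E])
    then have "E n \<subseteq> E (Suc n)" unfolding Esat .
    moreover have "y [^] n \<in> E n" unfolding E_def
      using subsetD[OF sat_superset[OF p1 aE] adjoin_self[OF i0 nat_pow_closed[OF yc]]] .
    ultimately have "y [^] n \<in> E (Suc n)" by (rule subsetD)
    then obtain t where t: "t \<in> carrier R" "t \<notin> p1" "t \<otimes> y [^] n \<in> adjoin p0 (y [^] Suc n)"
      unfolding E_def by (rule satE)
    then obtain e r where e: "e \<in> p0" "r \<in> carrier R" "t \<otimes> y [^] n = e \<oplus> r \<otimes> y [^] Suc n"
      unfolding adjoin_def by blast
    have ec: "e \<in> carrier R" using e(1) ideal_subset[OF i0] by blast
    have ync: "y [^] n \<in> carrier R" using yc by simp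
    have "y [^] n \<otimes> (t \<ominus> r \<otimes> y) = t \<otimes> y [^] n \<ominus> r \<otimes> (y [^] n \<otimes> y)"
      using t(1) ync yc e(2) by algebra
    also have "\<dots> = (e \<oplus> r \<otimes> (y [^] n \<otimes> y)) \<ominus> r \<otimes> (y [^] n \<otimes> y)"
      unfolding e(3) by simp
    also have "\<dots> = e" using ec ync yc e(2) by algebra
    finally have "y [^] n \<otimes> (t \<ominus> r \<otimes> y) \<in> p0" using e(1) by simp
    moreover have "y [^] n \<notin> p0" using prime_pow_mem[OF p0 yc] y(2) by blast
    ultimately have "t \<ominus> r \<otimes> y \<in> p0" using prime_mem[OF p0 _ ync] t(1) yc e(2) by simp
    then have 1: "t \<ominus> r \<otimes> y \<in> p1" using l by blast
    have "r \<otimes> y \<in> p1" using ideal_mult[OF prime_ideal[OF p1] y(1) e(2)] .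
    then have "(t \<ominus> r \<otimes> y) \<oplus> r \<otimes> y \<in> p1" using 1 ideal_add[OF prime_ideal[OF p1]] by blast
    moreover have "(t \<ominus> r \<otimes> y) \<oplus> r \<otimes> y = t" using t(1) yc e(2) by algebra
    ultimately show False using t(2) by simp
  qed
qed

lemma prime_chain_primeideal: "prime_chain R n c \<Longrightarrow> i \<le> n \<Longrightarrow> primeideal (c i) R"
  by (simp add: prime_chain_def spec_def)

lemma prime_chain_mono:
  assumes "prime_chain R n c" "i \<le> j" "j \<le> n" shows "c i \<subseteq> c j"
  using assms(2,3)
proof (induction rule: dec_induct)
  case (step k)
  then have "c k \<subset> c (Suc k)" using assms(1) by (simp add: prime_chain_def)
  then show ?case using step by auto
qed simp

lemma prime_chain_raise_top:
  assumes "prime_chain R n c" "primeideal q R" "c n \<subseteq> q"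
  shows "prime_chain R n (c(n := q))"
  unfolding prime_chain_def
proof (intro conjI allI impI)
  fix i assume "i \<le> n" then show "(c(n := q)) i \<in> spec R"
    using assms by (auto simp: prime_chain_def spec_def)
next
  fix i assume i: "i < n"
  then have "c i \<subset> c (Suc i)" using assms(1) by (simp add: prime_chain_def)
  then show "(c(n := q)) i \<subset> (c(n := q)) (Suc i)" using i assms(3) by auto
qed

text \<open>The chain is changed from the top downwards: \<open>prime_between\<close> replaces the last
prime but one by a prime that contains \<open>x\<close>, and so on.  One step is lost at the bottom.\<close>

lemma prime_chain_through:
  assumes "prime_chain R (Suc n) c" "x \<in> c (Suc n)"
  shows "\<exists>c'. prime_chain R n c' \<and> c' n = c (Suc n) \<and> x \<in> c' 0 \<and> c 0 \<subseteq> c' 0"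
  using assms
proof (induction n arbitrary: c)
  case 0
  then show ?case by (intro exI[of _ "\<lambda>_. c 1"]) (auto simp: prime_chain_def)
next
  case (Suc n)
  have pr: "primeideal (c i) R" if "i \<le> Suc (Suc n)" for i
    using prime_chain_primeideal[OF Suc.prems(1) that] .
  have "c n \<subset> c (Suc n)" "c (Suc n) \<subset> c (Suc (Suc n))"
    using Suc.prems(1) by (auto simp: prime_chain_def)
  then obtain p where p: "primeideal p R" "c n \<subset> p" "p \<subset> c (Suc (Suc n))" "x \<in> p"
    using prime_between[OF pr[of n] pr[of "Suc n"] pr[of "Suc (Suc n)"] _ _ Suc.prems(2)] by auto
  have "prime_chain R (Suc n) (c(Suc n := p))"
    using Suc.prems(1) p unfolding prime_chain_def by (auto simp: spec_def less_Suc_eq)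
  then obtain c' where c': "prime_chain R n c'" "c' n = p" "x \<in> c' 0" "c 0 \<subseteq> c' 0"
    using Suc.IH[of "c(Suc n := p)"] p(4) by (metis fun_upd_same fun_upd_other nat.distinct(1))
  have "prime_chain R (Suc n) (c'(Suc n := c (Suc (Suc n))))"
    using c'(1) p pr[of "Suc (Suc n)"] c'(2) unfolding prime_chain_def
    by (auto simp: spec_def less_Suc_eq le_Suc_eq)
  moreover have "(c'(Suc n := c (Suc (Suc n)))) (Suc n) = c (Suc (Suc n))"
    "(c'(Suc n := c (Suc (Suc n)))) 0 = c' 0" by simp_all
  ultimately show ?case using c'(3,4) by metis
qed

definition adjoins :: "'a set \<Rightarrow> 'a list \<Rightarrow> 'a set" where
  "adjoins J xs = foldl adjoin J xs"

lemma adjoins_simps [simp]: "adjoins J [] = J" "adjoins J (x # xs) = adjoins (adjoin J x) xs"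
  by (simp_all add: adjoins_def)

text \<open>A local ring whose maximal ideal has \<open>k\<close> generators has dimension at most \<open>k\<close>: passing to the quotient by one
generator shortens a chain by at most one.\<close>

lemma height_bound:
  assumes "primeideal q R" "ideal J R" "set xs \<subseteq> q" "q \<subseteq> sat q (adjoins J xs)"
    "prime_chain R n c" "J \<subseteq> c 0" "c n \<subseteq> q"
  shows "n \<le> length xs"
  using assms(2-)
proof (induction xs arbitrary: J n c)
  case Nil
  show ?case
  proof (rule ccontr)
    assume "\<not> ?thesis"
    then have n: "0 < n" by simp
    have "c 0 \<subseteq> c n" using prime_chain_mono[OF Nil.prems(4)] by simp
    then have "q \<subseteq> c 0"
      using Nil.prems sat_least[OF assms(1) prime_chain_primeideal[OF Nil.prems(4), of 0] _ Nil.prems(5)] by auto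
    moreover have "c 0 \<subset> c 1" "c 1 \<subseteq> c n"
      using n Nil.prems(4) prime_chain_mono[OF Nil.prems(4), of 1 n] by (auto simp: prime_chain_def)
    ultimately show False using Nil.prems(6) by blast
  qed
next
  case (Cons x xs)
  show ?case
  proof (cases n)
    case (Suc m)
    have xc: "x \<in> carrier R" using Cons.prems(2) ideal_subset[OF prime_ideal[OF assms(1)]] by auto
    have "prime_chain R (Suc m) (c(n := q))" "x \<in> (c(n := q)) (Suc m)"
      using prime_chain_raise_top[OF Cons.prems(4) assms(1) Cons.prems(6)] Suc Cons.prems(2) by auto
    from prime_chain_through[OF this] Suc obtain c' where
      c': "prime_chain R m c'" "c' m = q" "x \<in> c' 0" "c 0 \<subseteq> c' 0" by auto
    have "adjoin J x \<subseteq> c' 0"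
      using prime_ideal[OF prime_chain_primeideal[OF c'(1)]] c' Cons.prems(5) by (intro adjoin_least) auto
    then have "m \<le> length xs"
      using Cons.IH[of "adjoin J x" m c'] adjoin_ideal[OF Cons.prems(1) xc] Cons.prems c' by auto
    then show ?thesis using Suc by simp
  qed simp
qed

text \<open>\<open>xs\<close> is a regular sequence on \<open>(R/J)\<^sub>q\<close>, without the demand that the last quotient be nonzero.\<close>

fun weakly_regular :: "'a set \<Rightarrow> 'a set \<Rightarrow> 'a list \<Rightarrow> bool" where
  "weakly_regular q J [] \<longleftrightarrow> True"
| "weakly_regular q J (x # xs) \<longleftrightarrow> (\<forall>a \<in> carrier R. x \<otimes> a \<in> sat q J \<longrightarrow> a \<in> sat q J) \<and> weakly_regular q (adjoin J x) xs"

text \<open>The quotient \<open>(R/J)\<^sub>q\<close> is regular of dimension \<open>length xs\<close>, with parameters \<open>xs\<close>.  By induction the ideal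
\<open>J' = J + (x)\<close> is prime at \<open>q\<close>.  The bound on chains gives \<open>x \<notin> c 0\<close>, and it shows that the prime \<open>c' 0\<close> above \<open>c 0\<close>
through which the shortened chain starts is \<open>J'\<close> itself.  Hence \<open>c 0 \<subseteq> J + (x)\<close>, and since \<open>x\<close> is not in
the prime \<open>c 0\<close> this means \<open>c 0 = J + x c 0\<close>, so \<open>c 0 = J\<close> at \<open>q\<close> by Nakayama's lemma.  Thus \<open>J\<close> is prime and \<open>x\<close> is a
nonzerodivisor modulo it.\<close>

lemma regular_imp_weakly_regular:
  assumes "primeideal q R" "ideal J R" "set xs \<subseteq> q" "q \<subseteq> sat q (adjoins J xs)"
    "prime_chain R (length xs) c" "J \<subseteq> c 0" "c (length xs) \<subseteq> q"
  shows "primeideal (sat q J) R \<and> weakly_regular q J xs"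
  using assms(2-)
proof (induction xs arbitrary: J c)
  case Nil
  have "primeideal (c 0) R" using Nil.prems(4) prime_chain_primeideal by simp
  then have "sat q J \<subseteq> c 0" using sat_least[OF assms(1)] Nil.prems by simp
  then have "sat q J = q" using Nil.prems by auto
  then show ?case using assms(1) by simp
next
  case (Cons x xs)
  let ?d = "length xs"
  have qi: "ideal q R" using prime_ideal[OF assms(1)] .
  have xc: "x \<in> carrier R" and xq: "x \<in> q" using Cons.prems(2) ideal_subset[OF qi] by auto
  define c1 where "c1 = c(Suc ?d := q)"
  have "prime_chain R (Suc ?d) c1" "x \<in> c1 (Suc ?d)"
    using prime_chain_raise_top[OF Cons.prems(4) assms(1) Cons.prems(6)] Cons.prems(2) by (auto simp: c1_def)
  note c1 = this
  from prime_chain_through[OF this] obtain c' where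
    c': "prime_chain R ?d c'" "c' ?d = q" "x \<in> c' 0" "c 0 \<subseteq> c' 0" by (auto simp: c1_def)
  define J' where "J' = adjoin J x"
  have J': "ideal J' R" unfolding J'_def using adjoin_ideal[OF Cons.prems(1) xc] .
  have p0: "primeideal (c 0) R" and p': "primeideal (c' 0) R"
    using prime_chain_primeideal[OF Cons.prems(4)] prime_chain_primeideal[OF c'(1)] by auto
  have p0q: "c 0 \<subseteq> q" using prime_chain_mono[OF Cons.prems(4), of 0 "Suc ?d"] Cons.prems(6) by auto
  have p'q: "c' 0 \<subseteq> q" using prime_chain_mono[OF c'(1), of 0 ?d] c'(2) by auto
  have J'c': "J' \<subseteq> c' 0" unfolding J'_def
    using prime_ideal[OF p'] c' Cons.prems(5) by (intro adjoin_least) auto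
  have gen: "q \<subseteq> sat q (adjoins J' xs)" using Cons.prems(3) by (simp add: J'_def)
  have bound: "n \<le> ?d" if "prime_chain R n e" "J' \<subseteq> e 0" "e n \<subseteq> q" for n e
    using height_bound[OF assms(1) J' _ gen that] Cons.prems(2) by auto
  have Q: "primeideal (sat q J') R" and w: "weakly_regular q J' xs"
    using Cons.IH[OF J' _ gen c'(1) J'c'] Cons.prems(2) c'(2) by auto
  have xp0: "x \<notin> c 0"
  proof
    assume "x \<in> c 0"
    then have "J' \<subseteq> c1 0" unfolding J'_def c1_def
      using adjoin_least[OF prime_ideal[OF p0] Cons.prems(5)] by simp
    then have "Suc ?d \<le> ?d" by (intro bound[OF c1(1)]) (auto simp: c1_def)
    then show False by simp
  qed
  have Qc': "sat q J' = c' 0"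
  proof (rule ccontr)
    assume ne: "sat q J' \<noteq> c' 0"
    have "sat q J' \<subseteq> c' 0" using sat_least[OF assms(1) p' p'q J'c'] .
    then have lt: "sat q J' \<subset> c' 0" using ne by auto
    \<comment> \<open>Otherwise \<open>sat q J'\<close> could be put in front of \<open>c'\<close>, and the chain would be too long.\<close>
    define e where "e = (\<lambda>i. case i of 0 \<Rightarrow> sat q J' | Suc i \<Rightarrow> c' i)"
    have "prime_chain R (Suc ?d) e"
      using c'(1) lt Q unfolding prime_chain_def e_def spec_def by (auto split: nat.split)
    moreover have "J' \<subseteq> e 0" "e (Suc ?d) \<subseteq> q" unfolding e_def using sat_superset[OF assms(1) J'] c'(2) by auto
    ultimately have "Suc ?d \<le> ?d" by (rule bound)
    then show False by simp
  qed
  have sub: "c 0 \<subseteq> sat q J"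
  proof (rule nakayama[OF assms(1) Cons.prems(1) xq])
    fix a assume a: "a \<in> c 0"
    have ac: "a \<in> carrier R" using a ideal_subset[OF prime_ideal[OF p0]] by blast
    have "a \<in> sat q J'" using a c'(4) Qc' by blast
    then obtain t where t: "t \<in> carrier R" "t \<notin> q" "t \<otimes> a \<in> adjoin J x" unfolding J'_def by (metis satE)
    then obtain j r where j: "j \<in> J" "r \<in> carrier R" "t \<otimes> a = j \<oplus> r \<otimes> x" unfolding adjoin_def by blast
    have jc: "j \<in> carrier R" using j(1) ideal_subset[OF Cons.prems(1)] by blast
    have eq: "x \<otimes> r = t \<otimes> a \<ominus> j" unfolding j(3) using j(2) jc xc by algebra
    have "x \<otimes> r \<in> c 0" unfolding eq
      using ideal_minus[OF prime_ideal[OF p0] ideal_mult[OF prime_ideal[OF p0] a t(1)]] j(1) Cons.prems(5) by blast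
    then have "r \<in> c 0" using prime_mem[OF p0 _ xc j(2) xp0] by blast
    moreover have "t \<otimes> a = j \<oplus> x \<otimes> r" unfolding j(3) using j(2) xc by (simp add: m_comm)
    ultimately show "\<exists>t\<in>carrier R - q. \<exists>n'\<in>J. \<exists>k\<in>c 0. t \<otimes> a = n' \<oplus> x \<otimes> k"
      using t(1,2) j(1) by blast
  qed (rule ideal_subset[OF prime_ideal[OF p0]])
  moreover have "sat q J \<subseteq> c 0" using sat_least[OF assms(1) p0 p0q Cons.prems(5)] .
  ultimately have eq: "sat q J = c 0" by blast
  have "\<forall>a \<in> carrier R. x \<otimes> a \<in> sat q J \<longrightarrow> a \<in> sat q J"
    unfolding eq using prime_mem[OF p0 _ xc _ xp0] by blast
  then show ?case using w p0 unfolding eq[symmetric] J'_def by simp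
qed

text \<open>The prime is an ideal that is maximal among those that contain \<open>J\<close> and avoid the multiplicative set of the elements \<open>s \<otimes> x [^] n\<close>.\<close>

lemma prime_extending:
  assumes J: "ideal J R" and q: "primeideal q R" and x: "x \<in> carrier R"
    and dis: "\<And>s n. s \<in> carrier R \<Longrightarrow> s \<notin> q \<Longrightarrow> s \<otimes> x [^] (n::nat) \<notin> J"
  shows "\<exists>p. primeideal p R \<and> J \<subseteq> p \<and> p \<subseteq> q \<and> x \<notin> p"
proof -
  define S where "S = {s \<otimes> x [^] n | s n. s \<in> carrier R \<and> s \<notin> q \<and> n \<in> (UNIV :: nat set)}"
  define family where "family = {K. ideal K R \<and> J \<subseteq> K \<and> K \<inter> S = {}}"
  have "J \<in> family" using J dis unfolding family_def S_def by blast
  obtain p where pK: "p \<in> family" and max: "\<And>K'. K' \<in> family \<Longrightarrow> p \<subseteq> K' \<Longrightarrow> K' = p"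
  proof (rule ideal_max[of family])
    show "family \<noteq> {}" using \<open>J \<in> family\<close> by blast
  qed (auto simp: family_def)
  have p: "ideal p R" "J \<subseteq> p" "p \<inter> S = {}" using pK by (auto simp: family_def)
  have S1: "s \<in> S" if "s \<in> carrier R" "s \<notin> q" for s
  proof -
    have "s = s \<otimes> x [^] (0::nat)" using that by simp
    then show ?thesis unfolding S_def using that by blast
  qed
  have Smult: "a \<otimes> b \<in> S" if ab: "a \<in> S" "b \<in> S" for a b
  proof -
    obtain s n t m where st: "a = s \<otimes> x [^] (n::nat)" "s \<in> carrier R" "s \<notin> q"
      "b = t \<otimes> x [^] (m::nat)" "t \<in> carrier R" "t \<notin> q"
      using ab unfolding S_def by blast
    have "a \<otimes> b = (s \<otimes> t) \<otimes> (x [^] n \<otimes> x [^] m)"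
      unfolding st using st(2,5) x nat_pow_closed[OF x, of n] nat_pow_closed[OF x, of m] by algebra
    also have "\<dots> = (s \<otimes> t) \<otimes> x [^] (n + m)" using x by (simp add: nat_pow_mult)
    finally show ?thesis unfolding S_def using prime_mult_notin[OF q st(2,5,3,6)] st(2,5) by blast
  qed
  have hit: "\<exists>s\<in>S. \<exists>k\<in>p. \<exists>r\<in>carrier R. s = k \<oplus> r \<otimes> a" if a: "a \<in> carrier R" "a \<notin> p" for a
  proof -
    have "adjoin p a \<notin> family" using max[of "adjoin p a"] adjoin_superset[OF p(1) a(1)] adjoin_self[OF p(1) a(1)] a(2) by blast
    then have "adjoin p a \<inter> S \<noteq> {}"
      using adjoin_ideal[OF p(1) a(1)] adjoin_superset[OF p(1) a(1)] p(2) unfolding family_def by blast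
    then show ?thesis unfolding adjoin_def by blast
  qed
  have "primeideal p R"
  proof (rule primeidealI'[OF p(1)])
    show "\<one> \<notin> p" using S1[OF one_closed prime_one[OF q]] p(3) by blast
    fix a b assume ab: "a \<in> carrier R" "b \<in> carrier R" "a \<otimes> b \<in> p" "a \<notin> p"
    show "b \<in> p"
    proof (rule ccontr)
      assume "b \<notin> p"
      obtain s k r where 1: "s \<in> S" "k \<in> p" "r \<in> carrier R" "s = k \<oplus> r \<otimes> a" using hit[OF ab(1,4)] by blast
      obtain s' k' r' where 2: "s' \<in> S" "k' \<in> p" "r' \<in> carrier R" "s' = k' \<oplus> r' \<otimes> b"
        using hit[OF ab(2) \<open>b \<notin> p\<close>] by blast
      have c: "k \<in> carrier R" "k' \<in> carrier R" using 1(2) 2(2) ideal_subset[OF p(1)] by auto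
      have "s \<otimes> s' = s' \<otimes> k \<oplus> ((r \<otimes> a) \<otimes> k' \<oplus> (r \<otimes> r') \<otimes> (a \<otimes> b))"
        unfolding 1(4) 2(4) using c 1(3) 2(3) ab(1,2) by algebra
      also have "\<dots> \<in> p"
      proof -
        have "s' \<in> carrier R" unfolding 2(4) using c 2(3) ab(2) by simp
        then have "s' \<otimes> k \<in> p" using ideal_mult[OF p(1) 1(2)] by blast
        moreover have "(r \<otimes> a) \<otimes> k' \<in> p" using ideal_mult[OF p(1) 2(2)] 1(3) ab(1) by blast
        moreover have "(r \<otimes> r') \<otimes> (a \<otimes> b) \<in> p" using ideal_mult[OF p(1) ab(3)] 1(3) 2(3) by blast
        ultimately show ?thesis using ideal_add[OF p(1)] by blast
      qed
      finally show False using Smult[OF 1(1) 2(1)] p(3) by blast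
    qed
  qed
  moreover have "p \<subseteq> q" using S1 p(3) ideal_subset[OF p(1)] by blast
  moreover have "x \<notin> p"
  proof -
    have "x = \<one> \<otimes> x [^] (1::nat)" using x by simp
    then have "x \<in> S" unfolding S_def using prime_one[OF q] by blast
    then show ?thesis using p(3) by blast
  qed
  ultimately show ?thesis using p(2) by blast
qed

text \<open>The depth of a local ring is at most its dimension.  Start from \<open>q\<close> and remove the elements of the sequence from the end:
the last one is a nonzerodivisor modulo the ideal \<open>J\<close> of the others, so no product of one of its powers with an element outside
the current prime \<open>c 0 \<supseteq> J\<close> lies in \<open>J\<close>.  Thus there is a strictly smaller prime above \<open>J\<close>.\<close>

lemma regular_sequence_chain:
  assumes "set xs \<subseteq> q" "primeideal q R"
    and reg: "\<And>i a. i < length xs \<Longrightarrow> a \<in> carrier R \<Longrightarrow>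
        xs ! i \<otimes> a \<in> genideal R (set (take i xs)) \<Longrightarrow> a \<in> genideal R (set (take i xs))"
  shows "\<exists>c. prime_chain R (length xs) c"
proof -
  have xc: "set xs \<subseteq> carrier R" using assms(1) ideal_subset[OF prime_ideal[OF assms(2)]] by blast
  have "\<exists>c. prime_chain R i c \<and> c 0 \<subseteq> q \<and> genideal R (set (take (length xs - i) xs)) \<subseteq> c 0" if "i \<le> length xs" for i
    using that
  proof (induction i)
    case 0
    have "genideal R (set xs) \<subseteq> q" using assms(1) prime_ideal[OF assms(2)] by (intro genideal_minimal)
    then show ?case using assms(2) by (intro exI[of _ "\<lambda>_. q"]) (auto simp: prime_chain_def spec_def)
  next
    case (Suc i)
    then obtain c where c: "prime_chain R i c" "c 0 \<subseteq> q" "genideal R (set (take (length xs - i) xs)) \<subseteq> c 0" by auto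
    define k where "k = length xs - Suc i"
    have k: "length xs - i = Suc k" "k < length xs" using Suc.prems by (auto simp: k_def)
    let ?x = "xs ! k" and ?J = "genideal R (set (take k xs))"
    have tc: "set (take k xs) \<subseteq> carrier R" "set (take (Suc k) xs) \<subseteq> carrier R"
      using xc set_take_subset by fast+
    have J: "ideal ?J R" using genideal_ideal[OF tc(1)] .
    have x: "?x \<in> carrier R" using xc k by auto
    have p: "primeideal (c 0) R" using prime_chain_primeideal[OF c(1)] by simp
    have "set (take (Suc k) xs) \<subseteq> c 0" using c(3) genideal_self[OF tc(2)] unfolding k(1) by blast
    then have xin: "?x \<in> c 0" "set (take k xs) \<subseteq> c 0" using k(2) by (auto simp: take_Suc_conv_app_nth)
    have Jp: "?J \<subseteq> c 0" using genideal_minimal[OF prime_ideal[OF p] xin(2)] .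
    have nz: "s \<in> ?J" if "s \<in> carrier R" "s \<otimes> ?x [^] n \<in> ?J" for s and n :: nat
      using that(2)
    proof (induction n)
      case 0 then show ?case using that(1) by simp
    next
      case (Suc n)
      have "?x \<otimes> (s \<otimes> ?x [^] n) = s \<otimes> (?x [^] n \<otimes> ?x)"
        using that(1) x nat_pow_closed[OF x, of n] by algebra
      then have "?x \<otimes> (s \<otimes> ?x [^] n) \<in> ?J" using Suc.prems by simp
      then show ?case using reg[OF k(2), of "s \<otimes> ?x [^] n"] that(1) x Suc.IH by simp
    qed
    then obtain p' where p': "primeideal p' R" "?J \<subseteq> p'" "p' \<subseteq> c 0" "?x \<notin> p'"
      using prime_extending[OF J p x] Jp by blast
    define e where "e = (\<lambda>i. case i of 0 \<Rightarrow> p' | Suc i \<Rightarrow> c i)"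
    have "p' \<subset> c 0" using p' xin by blast
    then have "prime_chain R (Suc i) e"
      using c(1) p'(1) unfolding prime_chain_def e_def spec_def by (auto split: nat.split)
    moreover have "e 0 = p'" by (simp add: e_def)
    ultimately show ?case using p' c(2) unfolding k_def by (intro exI[of _ e]) auto
  qed
  then show ?thesis by blast
qed

end

section \<open>Regular sequences along filtrations\<close>

abbreviation lookup :: "('b \<Rightarrow>\<^sub>0 'c::zero) \<Rightarrow> 'b \<Rightarrow> 'c" where
  "lookup \<equiv> Poly_Mapping.lookup"

context noeth_cring begin

lemma weakly_regular_top:
  assumes "primeideal q R" "ideal J R" "sat q J = carrier R" "set xs \<subseteq> carrier R"
  shows "weakly_regular q J xs"
  using assms(2-)
proof (induction xs arbitrary: J)
  case (Cons x xs)
  have "sat q (adjoin J x) = carrier R"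
    using sat_mono[OF adjoin_superset[OF Cons.prems(1)], of x q] Cons.prems sat_subset[of q "adjoin J x"] by auto
  then show ?case using Cons adjoin_ideal[OF Cons.prems(1)] by auto
qed simp

text \<open>The sequence \<open>0 \<rightarrow> R/L \<rightarrow> R/J \<rightarrow> R/(J + (m)) \<rightarrow> 0\<close>, whose first map is multiplication by \<open>m\<close>, is exact at \<open>q\<close>.
A sequence that is regular on both outer modules is regular on the middle one, because exactness survives the quotient by its first
element \<open>x\<close>: that \<open>x\<close> is a nonzerodivisor on the right-hand module gives \<open>(J + (x) : m) = L + (x)\<close>.\<close>

lemma weakly_regular_extension:
  assumes q: "primeideal q R"
    and "ideal J R" "ideal L R" and m: "m \<in> carrier R"
    and "\<And>a. a \<in> carrier R \<Longrightarrow> a \<otimes> m \<in> sat q J \<longleftrightarrow> a \<in> sat q L"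
    and "weakly_regular q L xs" "weakly_regular q (adjoin J m) xs" "set xs \<subseteq> carrier R"
  shows "weakly_regular q J xs"
  using assms(2,3,5-)
proof (induction xs arbitrary: J L)
  case (Cons x xs)
  note J = Cons.prems(1) and L = Cons.prems(2) and JL = Cons.prems(3)
  have xc: "x \<in> carrier R" using Cons.prems(6) by simp
  have sJ: "ideal (sat q J) R" and sL: "ideal (sat q L) R" using sat_ideal[OF q] J L by auto
  have xL: "\<And>a. a \<in> carrier R \<Longrightarrow> x \<otimes> a \<in> sat q L \<Longrightarrow> a \<in> sat q L"
    and xJm: "\<And>a. a \<in> carrier R \<Longrightarrow> x \<otimes> a \<in> sat q (adjoin J m) \<Longrightarrow> a \<in> sat q (adjoin J m)"
    using Cons.prems(4,5) by auto
  have aJm: "ideal (adjoin J m) R" using adjoin_ideal[OF J m] .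
  have ssJ: "sat q (sat q J) = sat q J" using sat_closed[OF q q subset_refl J] .
  have ssL: "sat q (sat q L) = sat q L" using sat_closed[OF q q subset_refl L] .
  have J_le: "J \<subseteq> sat q J" using sat_superset[OF q J] .
  have first: "a \<in> sat q J" if a: "a \<in> carrier R" "x \<otimes> a \<in> sat q J" for a
  proof -
    have "a \<in> sat q (adjoin J m)" using xJm[OF a(1)] a(2) sat_mono[OF adjoin_superset[OF J m]] by blast
    then obtain t where t: "t \<in> carrier R" "t \<notin> q" "t \<otimes> a \<in> adjoin J m" by (rule satE)
    then obtain j c where j: "j \<in> J" "c \<in> carrier R" "t \<otimes> a = j \<oplus> c \<otimes> m" unfolding adjoin_def by blast
    have jc: "j \<in> carrier R" using j(1) ideal_subset[OF J] by blast
    have "(x \<otimes> c) \<otimes> m = x \<otimes> (j \<oplus> c \<otimes> m) \<ominus> x \<otimes> j" using j(2) jc xc m by algebra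
    also have "\<dots> = t \<otimes> (x \<otimes> a) \<ominus> x \<otimes> j" unfolding j(3)[symmetric] using t(1) a(1) xc jc by algebra
    also have "\<dots> \<in> sat q J"
      using ideal_minus[OF sJ ideal_mult[OF sJ a(2) t(1)] ideal_mult[OF sJ _ xc]] j(1) J_le by blast
    finally have "x \<otimes> c \<in> sat q L" using JL[of "x \<otimes> c"] xc j(2) by simp
    then have "c \<otimes> m \<in> sat q J" using xL[OF j(2)] JL[OF j(2)] by simp
    then have "t \<otimes> a \<in> sat q J" unfolding j(3) using ideal_add[OF sJ] j(1) J_le by blast
    then show ?thesis using sat_closedD[OF ssJ t(1,2) a(1)] by blast
  qed
  have "weakly_regular q (adjoin J x) xs"
  proof (rule Cons.IH)
    show "ideal (adjoin J x) R" "ideal (adjoin L x) R" using adjoin_ideal J L xc by auto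
    show "weakly_regular q (adjoin L x) xs" using Cons.prems(4) by simp
    show "weakly_regular q (adjoin (adjoin J x) m) xs" using Cons.prems(5) adjoin_commute[OF J xc m] by simp
    show "set xs \<subseteq> carrier R" using Cons.prems(6) by simp
  next
    fix a assume a: "a \<in> carrier R"
    show "a \<otimes> m \<in> sat q (adjoin J x) \<longleftrightarrow> a \<in> sat q (adjoin L x)"
    proof
      assume "a \<in> sat q (adjoin L x)"
      then obtain t where t: "t \<in> carrier R" "t \<notin> q" "t \<otimes> a \<in> adjoin L x" by (rule satE)
      then obtain l r where l: "l \<in> L" "r \<in> carrier R" "t \<otimes> a = l \<oplus> r \<otimes> x" unfolding adjoin_def by blast
      have lc: "l \<in> carrier R" using l(1) ideal_subset[OF L] by blast
      have "l \<otimes> m \<in> sat q J" using JL[OF lc] sat_superset[OF q L] l(1) by blast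
      then obtain s where s: "s \<in> carrier R" "s \<notin> q" "s \<otimes> (l \<otimes> m) \<in> J" by (rule satE)
      have "(s \<otimes> t) \<otimes> (a \<otimes> m) = s \<otimes> (t \<otimes> a) \<otimes> m" using s(1) t(1) a m by algebra
      also have "\<dots> = s \<otimes> (l \<otimes> m) \<oplus> (s \<otimes> r \<otimes> m) \<otimes> x" unfolding l(3) using s(1) lc m l(2) xc by algebra
      finally have "(s \<otimes> t) \<otimes> (a \<otimes> m) \<in> adjoin J x" unfolding adjoin_def using s(1,3) l(2) m by blast
      then show "a \<otimes> m \<in> sat q (adjoin J x)"
        using satI[of "a \<otimes> m" "s \<otimes> t"] prime_mult_notin[OF q s(1) t(1) s(2) t(2)] s(1) t(1) a m by simp
    next
      assume "a \<otimes> m \<in> sat q (adjoin J x)"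
      then obtain t where t: "t \<in> carrier R" "t \<notin> q" "t \<otimes> (a \<otimes> m) \<in> adjoin J x" by (rule satE)
      then obtain j b where j: "j \<in> J" "b \<in> carrier R" "t \<otimes> (a \<otimes> m) = j \<oplus> b \<otimes> x" unfolding adjoin_def by blast
      have jc: "j \<in> carrier R" using j(1) ideal_subset[OF J] by blast
      have tam: "t \<otimes> (a \<otimes> m) \<in> adjoin J m"
        using ideal_mult[OF aJm adjoin_self[OF J m], of "t \<otimes> a"] t(1) a m by (simp add: m_assoc)
      have "x \<otimes> b = t \<otimes> (a \<otimes> m) \<ominus> j" unfolding j(3) using jc j(2) xc by algebra
      also have "\<dots> \<in> adjoin J m" using ideal_minus[OF aJm tam] j(1) adjoin_superset[OF J m] by blast
      finally have "b \<in> sat q (adjoin J m)" using xJm[OF j(2)] sat_superset[OF q aJm] by blast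
      then obtain s where s: "s \<in> carrier R" "s \<notin> q" "s \<otimes> b \<in> adjoin J m" by (rule satE)
      then obtain j' c where j': "j' \<in> J" "c \<in> carrier R" "s \<otimes> b = j' \<oplus> c \<otimes> m" unfolding adjoin_def by blast
      have j'c: "j' \<in> carrier R" using j'(1) ideal_subset[OF J] by blast
      have "(s \<otimes> (t \<otimes> a) \<ominus> c \<otimes> x) \<otimes> m = s \<otimes> (t \<otimes> (a \<otimes> m)) \<ominus> x \<otimes> (c \<otimes> m)"
        using s(1) t(1) a j'(2) xc m by algebra
      also have "\<dots> = s \<otimes> j \<oplus> x \<otimes> (s \<otimes> b) \<ominus> x \<otimes> (c \<otimes> m)"
        unfolding j(3) using s(1) jc j(2) xc j'(2) m by algebra
      also have "\<dots> = s \<otimes> j \<oplus> x \<otimes> j'" unfolding j'(3) using s(1) jc j'c xc j'(2) m by algebra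
      also have "\<dots> \<in> sat q J"
        using ideal_add[OF J ideal_mult[OF J j(1) s(1)] ideal_mult[OF J j'(1) xc]] J_le by blast
      finally have "s \<otimes> (t \<otimes> a) \<ominus> c \<otimes> x \<in> sat q L"
        using JL[of "s \<otimes> (t \<otimes> a) \<ominus> c \<otimes> x"] s(1) t(1) a j'(2) xc by simp
      then obtain u where u: "u \<in> carrier R" "u \<notin> q" "u \<otimes> (s \<otimes> (t \<otimes> a) \<ominus> c \<otimes> x) \<in> L" by (rule satE)
      have "(u \<otimes> (s \<otimes> t)) \<otimes> a = u \<otimes> (s \<otimes> (t \<otimes> a) \<ominus> c \<otimes> x) \<oplus> (u \<otimes> c) \<otimes> x"
        using u(1) s(1) t(1) a j'(2) xc by algebra
      then have "(u \<otimes> (s \<otimes> t)) \<otimes> a \<in> adjoin L x" unfolding adjoin_def using u(1,3) j'(2) by blast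
      then show "a \<in> sat q (adjoin L x)"
        using satI[of a "u \<otimes> (s \<otimes> t)"] prime_mult_notin[OF q u(1) _ u(2) prime_mult_notin[OF q s(1) t(1) s(2) t(2)]]
          u(1) s(1) t(1) a by simp
    qed
  qed
  then show ?case using first by simp
qed simp

lemma sat_adjoin_mono:
  assumes q: "primeideal q R" and J: "ideal J R" "ideal J' R" and x: "x \<in> carrier R" and le: "sat q J \<subseteq> sat q J'"
  shows "sat q (adjoin J x) \<subseteq> sat q (adjoin J' x)"
proof -
  have i: "ideal (adjoin J' x) R" using adjoin_ideal[OF J(2) x] .
  have "J \<subseteq> sat q (adjoin J' x)"
    using sat_superset[OF q J(1)] le sat_mono[OF adjoin_superset[OF J(2) x]] by blast
  then have "adjoin J x \<subseteq> sat q (adjoin J' x)"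
    using adjoin_self[OF J(2) x] sat_superset[OF q i] by (intro adjoin_least sat_ideal[OF q i]) auto
  then show ?thesis using sat_mono[of "adjoin J x" "sat q (adjoin J' x)" q] sat_closed[OF q q subset_refl i] by simp
qed

lemma weakly_regular_cong:
  assumes "primeideal q R" "ideal J R" "ideal J' R" "sat q J = sat q J'" "set xs \<subseteq> carrier R"
  shows "weakly_regular q J xs \<longleftrightarrow> weakly_regular q J' xs"
  using assms(2-)
proof (induction xs arbitrary: J J')
  case (Cons x xs)
  have "weakly_regular q (adjoin J x) xs \<longleftrightarrow> weakly_regular q (adjoin J' x) xs"
    using Cons.prems adjoin_ideal sat_adjoin_mono[OF assms(1)] by (intro Cons.IH subset_antisym) auto
  then show ?case using Cons.prems(3) by simp
qed simp

end

section \<open>The monomial filtration\<close>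

text \<open>Induction on the index set.  Let \<open>B\<close> dominate \<open>U\<close> from below in the coordinates \<open>T\<close>.  An element whose new coordinate exceeds those
in \<open>B\<close> is dominated by \<open>B\<close> in all coordinates; the others lie in finitely many slices, where that coordinate is constant.\<close>

lemma dickson:
  fixes f :: "'b \<Rightarrow> 'i \<Rightarrow> nat"
  assumes "finite T"
  shows "\<exists>B \<subseteq> U. finite B \<and> (\<forall>e\<in>U. \<exists>b\<in>B. \<forall>i\<in>T. f b i \<le> f e i)"
  using assms
proof (induction T arbitrary: U rule: finite_induct)
  case empty
  show ?case
  proof (cases "U = {}")
    case False
    then obtain u where "u \<in> U" by blast
    then show ?thesis by (intro exI[of _ "{u}"]) auto
  qed auto
next
  case (insert i T)
  obtain B where B: "\<And>U. B U \<subseteq> U \<and> finite (B U) \<and> (\<forall>e\<in>U. \<exists>b\<in>B U. \<forall>i\<in>T. f b i \<le> f e i)"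
    using insert.IH by metis
  define N where "N = (\<Sum>b\<in>B U. f b i)"
  define slice where "slice = (\<lambda>k. B {e \<in> U. f e i = k})"
  have N: "f b i \<le> N" if "b \<in> B U" for b
    unfolding N_def using B[of U] that by (intro member_le_sum) auto
  have "\<exists>b\<in>B U \<union> (\<Union>k<N. slice k). \<forall>j\<in>insert i T. f b j \<le> f e j" if e: "e \<in> U" for e
  proof (cases "f e i < N")
    case True
    then obtain b where "b \<in> slice (f e i)" "\<forall>j\<in>T. f b j \<le> f e j"
      unfolding slice_def using B[of "{e' \<in> U. f e' i = f e i}"] e by auto
    moreover then have "f b i = f e i" unfolding slice_def using B[of "{e' \<in> U. f e' i = f e i}"] by blast
    ultimately show ?thesis using True by (intro bexI[of _ b]) auto
  next
    case False
    obtain b where "b \<in> B U" "\<forall>j\<in>T. f b j \<le> f e j" using B[of U] e by blast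
    then show ?thesis using N[of b] False by (intro bexI[of _ b]) auto
  qed
  moreover have "B U \<union> (\<Union>k<N. slice k) \<subseteq> U" unfolding slice_def using B by blast
  moreover have "finite (B U \<union> (\<Union>k<N. slice k))" unfolding slice_def using B by blast
  ultimately show ?case by (intro exI[of _ "B U \<union> (\<Union>k<N. slice k)"]) blast
qed

locale weighted_monomials = noeth_cring +
  fixes v :: "nat \<Rightarrow> 'a" and w :: "nat \<Rightarrow> nat" and m :: nat
  assumes v_closed: "i \<in> {1..m} \<Longrightarrow> v i \<in> carrier R"
    and w_pos: "i \<in> {1..m} \<Longrightarrow> 0 < w i"
begin

text \<open>Coordinate \<open>0\<close> stores the weight of an exponent vector.  Since the library orders finitely supported functions lexicographically,
by the smallest index at which they differ, their order on this set compares
weights first, is total, and is compatible with addition.\<close>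

definition exponents :: "(nat \<Rightarrow>\<^sub>0 nat) set" where
  "exponents = {e. (\<forall>i>m. lookup e i = 0) \<and> lookup e 0 = (\<Sum>i=1..m. w i * lookup e i)}"

definition monomial :: "(nat \<Rightarrow>\<^sub>0 nat) \<Rightarrow> 'a" where
  "monomial e = finprod R (\<lambda>i. v i [^] lookup e i) {1..m}"

definition single_exp :: "nat \<Rightarrow> nat \<Rightarrow> (nat \<Rightarrow>\<^sub>0 nat)" where
  "single_exp i j = Poly_Mapping.single 0 (w i * j) + Poly_Mapping.single i j"

text \<open>The ideals spanned by the exponents from \<open>e\<close> onwards and by those beyond \<open>e\<close> have a cyclic quotient.  The second ideal
is \<open>higher e\<close>, and \<open>step_annihilator e\<close> is the annihilator of the quotient.\<close>

definition higher :: "(nat \<Rightarrow>\<^sub>0 nat) \<Rightarrow> 'a set" where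
  "higher e = genideal R (monomial ` {e' \<in> exponents. e < e'})"

definition step_annihilator :: "(nat \<Rightarrow>\<^sub>0 nat) \<Rightarrow> 'a set" where
  "step_annihilator e = colon (higher e) (monomial e)"

lemma lookup_single_exp:
  "i \<in> {1..m} \<Longrightarrow> lookup (single_exp i j) l = (if l = 0 then w i * j else if l = i then j else 0)"
  by (auto simp: single_exp_def lookup_add lookup_single when_def)

lemma exponents_zero: "0 \<in> exponents" by (simp add: exponents_def)

lemma exponents_add: "e \<in> exponents \<Longrightarrow> d \<in> exponents \<Longrightarrow> e + d \<in> exponents"
  by (auto simp: exponents_def lookup_add algebra_simps sum.distrib)

lemma exponents_single_exp: "i \<in> {1..m} \<Longrightarrow> single_exp i j \<in> exponents"
proof -
  assume i: "i \<in> {1..m}"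
  have "(\<Sum>l=1..m. w l * lookup (single_exp i j) l) = (\<Sum>l=1..m. if l = i then w i * j else 0)"
    using i by (intro sum.cong) (auto simp: lookup_single_exp)
  also have "\<dots> = w i * j" using i by simp
  finally show ?thesis using i by (auto simp: exponents_def lookup_single_exp)
qed

lemma exponents_diff:
  assumes "e \<in> exponents" "b \<in> exponents" "\<And>i. i \<in> {1..m} \<Longrightarrow> lookup b i \<le> lookup e i"
  shows "e - b \<in> exponents" "e = b + (e - b)"
proof -
  have 0: "lookup b 0 \<le> lookup e 0"
    using assms by (auto simp: exponents_def intro!: sum_mono)
  have le: "lookup b i \<le> lookup e i" for i
  proof (cases "i \<le> m")
    case True then show ?thesis using 0 assms(3)[of i] by (cases "i = 0") auto
  next
    case False then show ?thesis using assms(1,2) by (auto simp: exponents_def)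
  qed
  show "e = b + (e - b)"
    by (rule poly_mapping_eqI) (simp add: lookup_add lookup_minus le)
  have "(\<Sum>i=1..m. w i * (lookup e i - lookup b i)) = (\<Sum>i=1..m. w i * lookup e i) - (\<Sum>i=1..m. w i * lookup b i)"
    unfolding diff_mult_distrib2 using assms(3) by (intro sum_subtractf_nat) auto
  then show "e - b \<in> exponents" using assms(1,2) by (auto simp: exponents_def lookup_minus)
qed

lemma monomial_closed [simp]: "monomial e \<in> carrier R"
  unfolding monomial_def using v_closed by (intro finprod_closed) auto

lemma monomial_zero: "monomial 0 = \<one>"
  unfolding monomial_def by (simp cong: finprod_cong add: finprod_one_eqI)

lemma monomial_add: "monomial (e + d) = monomial e \<otimes> monomial d"
proof -
  have "monomial (e + d) = finprod R (\<lambda>i. v i [^] lookup e i \<otimes> v i [^] lookup d i) {1..m}"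
    unfolding monomial_def using v_closed by (intro finprod_cong') (auto simp: lookup_add nat_pow_mult)
  also have "\<dots> = monomial e \<otimes> monomial d" unfolding monomial_def using v_closed by (intro finprod_multf) auto
  finally show ?thesis .
qed

lemma monomial_single_exp:
  assumes i: "i \<in> {1..m}" shows "monomial (single_exp i j) = v i [^] j"
proof -
  have "monomial (single_exp i j) = finprod R (\<lambda>l. if i = l then v l [^] j else \<one>) {1..m}"
    unfolding monomial_def using v_closed i by (intro finprod_cong') (auto simp: lookup_single_exp)
  also have "\<dots> = v i [^] j" using i v_closed by (intro finprod_singleton) auto
  finally show ?thesis .
qed

lemma monomial_image_closed: "monomial ` A \<subseteq> carrier R" by auto

lemma higher_ideal: "ideal (higher e) R"
  unfolding higher_def by (rule genideal_ideal[OF monomial_image_closed])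

lemma step_annihilator_ideal: "ideal (step_annihilator e) R"
  unfolding step_annihilator_def by (rule colon_ideal[OF higher_ideal monomial_closed])

lemma monomial_in_higher: "e' \<in> exponents \<Longrightarrow> e < e' \<Longrightarrow> monomial e' \<in> higher e"
  unfolding higher_def by (intro subsetD[OF genideal_self[OF monomial_image_closed]] imageI) simp

lemma step_annihilator_mono:
  assumes d: "d \<in> exponents" shows "step_annihilator e \<subseteq> step_annihilator (e + d)"
proof
  fix r assume "r \<in> step_annihilator e"
  then have r: "r \<in> carrier R" "r \<otimes> monomial e \<in> higher e" by (auto simp: step_annihilator_def colon_def)
  have "monomial ` {e' \<in> exponents. e < e'} \<subseteq> colon (higher (e + d)) (monomial d)"
  proof
    fix y assume "y \<in> monomial ` {e' \<in> exponents. e < e'}"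
    then obtain e' where e': "y = monomial e'" "e' \<in> exponents" "e < e'" by blast
    have "e + d < e' + d" using e'(3) by simp
    then have "monomial (e' + d) \<in> higher (e + d)" using exponents_add[OF e'(2) d] by (rule monomial_in_higher[rotated])
    then show "y \<in> colon (higher (e + d)) (monomial d)" unfolding e'(1) colon_def by (simp add: monomial_add)
  qed
  then have "higher e \<subseteq> colon (higher (e + d)) (monomial d)"
    unfolding higher_def[of e] by (intro genideal_minimal colon_ideal higher_ideal monomial_closed)
  then have "(r \<otimes> monomial e) \<otimes> monomial d \<in> higher (e + d)" using r unfolding colon_def by blast
  then show "r \<in> step_annihilator (e + d)"
    using r(1) by (simp add: step_annihilator_def colon_def monomial_add m_assoc)
qed

lemma less_add_single_exp:
  assumes "i \<in> {1..m}" shows "e < single_exp i 1 + e"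
proof -
  have "(0 :: nat \<Rightarrow>\<^sub>0 nat) < single_exp i 1"
    unfolding less_poly_mapping.rep_eq less_fun_def
    using assms w_pos[OF assms] by (intro exI[of _ 0]) (auto simp: lookup_single_exp)
  from add_strict_right_mono[OF this, of e] show ?thesis by simp
qed

lemma gens_in_step_annihilator:
  assumes "e \<in> exponents" "i \<in> {1..m}" shows "v i \<in> step_annihilator e"
proof -
  have "monomial (single_exp i 1 + e) \<in> higher e"
    using exponents_add[OF exponents_single_exp[OF assms(2)] assms(1)] less_add_single_exp[OF assms(2)] by (rule monomial_in_higher)
  then show ?thesis using assms v_closed by (simp add: step_annihilator_def colon_def monomial_add monomial_single_exp)
qed

text \<open>\<open>P \<subseteq> step_annihilator e\<close> for all \<open>e\<close>, and the exponents where the inclusion is strict are closed under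
adding exponents.  By Dickson's lemma finitely many of them, the set \<open>B\<close>, lie below all others; a product of elements of
\<open>step_annihilator b - P\<close> for \<open>b \<in> B\<close> serves for all.\<close>

lemma generic_steps:
  assumes P: "primeideal P R" and gen: "P = genideal R (v ` {1..m})"
  shows "\<exists>f \<in> carrier R. f \<notin> P \<and> (\<forall>e\<in>exponents. step_annihilator e = P \<or> f \<in> step_annihilator e)"
proof -
  have PL: "P \<subseteq> step_annihilator e" if "e \<in> exponents" for e
    unfolding gen using gens_in_step_annihilator[OF that] by (intro genideal_minimal step_annihilator_ideal) auto
  define U where "U = {e \<in> exponents. step_annihilator e \<noteq> P}"
  obtain B where B: "B \<subseteq> U" "finite B" "\<And>e. e \<in> U \<Longrightarrow> \<exists>b\<in>B. \<forall>i\<in>{1..m}. lookup b i \<le> lookup e i"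
    using dickson[of "{1..m}" U lookup] by auto
  have "\<exists>f \<in> carrier R. f \<notin> P \<and> (\<forall>b\<in>B. f \<in> step_annihilator b)"
    using B(2,1)
  proof (induction B rule: finite_induct)
    case empty
    then show ?case using prime_one[OF P] by auto
  next
    case (insert b B)
    then obtain f where f: "f \<in> carrier R" "f \<notin> P" "\<forall>b\<in>B. f \<in> step_annihilator b" by auto
    have b: "b \<in> exponents" "step_annihilator b \<noteq> P" using insert.prems by (auto simp: U_def)
    then obtain g where g: "g \<in> step_annihilator b" "g \<notin> P" using PL by blast
    have gc: "g \<in> carrier R" using g(1) ideal_subset[OF step_annihilator_ideal] by blast
    have "f \<otimes> g \<in> step_annihilator b" using ideal_mult[OF step_annihilator_ideal g(1) f(1)] .
    moreover have "f \<otimes> g \<in> step_annihilator b'" if "b' \<in> B" for b'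
      using ideal_mult[OF step_annihilator_ideal _ gc, of f b'] f(1,3) that gc m_comm[of f g] by auto
    ultimately show ?case
      using prime_mult_notin[OF P f(1) gc f(2) g(2)] f(1) gc by (intro bexI[of _ "f \<otimes> g"]) auto
  qed
  then obtain f where f: "f \<in> carrier R" "f \<notin> P" "\<And>b. b \<in> B \<Longrightarrow> f \<in> step_annihilator b" by blast
  have "step_annihilator e = P \<or> f \<in> step_annihilator e" if e: "e \<in> exponents" for e
  proof (cases "step_annihilator e = P")
    case False
    then obtain b where b: "b \<in> B" "\<forall>i\<in>{1..m}. lookup b i \<le> lookup e i"
      using B(3)[of e] e unfolding U_def by blast
    then have bE: "b \<in> exponents" using B(1) by (auto simp: U_def)
    have "step_annihilator b \<subseteq> step_annihilator e"
      using step_annihilator_mono[OF exponents_diff(1)[OF e bE], of b] exponents_diff(2)[OF e bE] b(2) by auto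
    then show ?thesis using f(3)[OF b(1)] by blast
  qed simp
  then show ?thesis using f by blast
qed

text \<open>Descent along the filtration: removing the largest exponent \<open>b\<close> from the finite initial segment \<open>D\<close> adds one generator to the
ideal, and the quotient is \<open>R/step_annihilator b\<close>, which at \<open>q\<close> is \<open>R/P\<close> or zero.\<close>

lemma weakly_regular_filtration:
  assumes q: "primeideal q R" and P: "ideal P R" and xs: "set xs \<subseteq> carrier R" and f: "f \<notin> q"
    and steps: "\<And>e. e \<in> exponents \<Longrightarrow> step_annihilator e = P \<or> f \<in> step_annihilator e"
    and w: "weakly_regular q P xs"
    and D: "finite D" "D \<subseteq> exponents" "\<And>e e'. e \<in> D \<Longrightarrow> e' \<in> exponents \<Longrightarrow> e' < e \<Longrightarrow> e' \<in> D"
  shows "weakly_regular q (genideal R (monomial ` (exponents - D))) xs"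
  using D
proof (induction D rule: finite_linorder_max_induct)
  case empty
  have "\<one> \<in> genideal R (monomial ` exponents)"
    using genideal_self[OF monomial_image_closed, of exponents] exponents_zero monomial_zero by force
  then have "\<not> genideal R (monomial ` exponents) \<subseteq> q" using prime_one[OF q] by blast
  then show ?case
    using weakly_regular_top[OF q genideal_ideal[OF monomial_image_closed] sat_eq_carrier[OF q genideal_ideal[OF monomial_image_closed]] xs]
    by simp
next
  case (insert b A)
  have bE: "b \<in> exponents" using insert.prems(1) by simp
  have rest: "exponents - insert b A = {e \<in> exponents. b < e}"
  proof (rule subset_antisym; rule subsetI)
    fix e assume e: "e \<in> exponents - insert b A"
    then have "\<not> e < b" using insert.prems(2)[of b e] by auto
    then show "e \<in> {e \<in> exponents. b < e}" using e by auto
  next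
    fix e assume "e \<in> {e \<in> exponents. b < e}"
    then show "e \<in> exponents - insert b A" using insert.hyps(2) by force
  qed
  have "insert (monomial b) (monomial ` (exponents - insert b A)) = monomial ` (exponents - A)"
    unfolding image_insert[symmetric] using bE insert.hyps(2) by (intro arg_cong[of _ _ "(`) monomial"]) auto
  then have gen: "adjoin (higher b) (monomial b) = genideal R (monomial ` (exponents - A))"
    unfolding higher_def rest[symmetric] by (simp add: adjoin_eq_genideal[OF monomial_image_closed])
  have wA: "weakly_regular q (genideal R (monomial ` (exponents - A))) xs"
  proof (rule insert.IH)
    show "A \<subseteq> exponents" using insert.prems(1) by simp
    fix e e' assume e: "e \<in> A" "e' \<in> exponents" "e' < e"
    then have "e' \<noteq> b" using insert.hyps(2) by force
    then show "e' \<in> A" using insert.prems(2)[of e e'] e by auto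
  qed
  have wL: "weakly_regular q (step_annihilator b) xs"
  proof (cases "step_annihilator b = P")
    case False
    then have "f \<in> step_annihilator b" using steps[OF bE] by simp
    then have "sat q (step_annihilator b) = carrier R" using f by (intro sat_eq_carrier[OF q step_annihilator_ideal]) blast
    then show ?thesis using weakly_regular_top[OF q step_annihilator_ideal _ xs] by blast
  qed (use w in simp)
  have "weakly_regular q (higher b) xs"
  proof (rule weakly_regular_extension[OF q higher_ideal step_annihilator_ideal monomial_closed _ wL _ xs])
    show "weakly_regular q (adjoin (higher b) (monomial b)) xs" using wA unfolding gen .
    fix a assume a: "a \<in> carrier R"
    show "a \<otimes> monomial b \<in> sat q (higher b) \<longleftrightarrow> a \<in> sat q (step_annihilator b)"
      using a by (auto simp: sat_def step_annihilator_def colon_def m_assoc)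
  qed
  then show ?case unfolding higher_def rest .
qed

definition weight_ideal :: "nat \<Rightarrow> 'a set" where
  "weight_ideal N = genideal R (monomial ` {e \<in> exponents. N \<le> lookup e 0})"

lemma weight_ideal_ideal: "ideal (weight_ideal N) R"
  unfolding weight_ideal_def by (rule genideal_ideal[OF monomial_image_closed])

lemma finite_low_weight: "finite {e \<in> exponents. lookup e 0 < N}"
proof -
  have "lookup e i \<le> lookup e 0" if e: "e \<in> exponents" and i: "i \<in> {1..m}" for e i
  proof -
    have "lookup e i \<le> w i * lookup e i" using w_pos[OF i] by simp
    also have "\<dots> \<le> (\<Sum>i=1..m. w i * lookup e i)" using i by (intro member_le_sum) auto
    finally show ?thesis using e by (simp add: exponents_def)
  qed
  then have bd: "lookup e i < N" if "e \<in> exponents" "lookup e 0 < N" "i \<le> m" for e i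
    using that le_less_trans[of "lookup e i" "lookup e 0" N] by (cases "i = 0") auto
  have "lookup ` {e \<in> exponents. lookup e 0 < N} \<subseteq> {g. \<forall>i. (i \<in> {..m} \<longrightarrow> g i \<in> {..<N}) \<and> (i \<notin> {..m} \<longrightarrow> g i = 0)}"
    using bd by (auto simp: exponents_def)
  moreover have "finite {g. \<forall>i. (i \<in> {..m} \<longrightarrow> g i \<in> {..<N}) \<and> (i \<notin> {..m} \<longrightarrow> g i = (0::nat))}"
    by (intro finite_set_of_finite_funs) auto
  ultimately have "finite (lookup ` {e \<in> exponents. lookup e 0 < N})" by (rule finite_subset)
  then show ?thesis by (rule finite_imageD) (auto simp: inj_on_def intro: poly_mapping_eqI)
qed

lemma weakly_regular_weight_ideal:
  assumes "primeideal q R" "ideal P R" "set xs \<subseteq> carrier R" "f \<notin> q"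
    and "\<And>e. e \<in> exponents \<Longrightarrow> step_annihilator e = P \<or> f \<in> step_annihilator e" and "weakly_regular q P xs"
  shows "weakly_regular q (weight_ideal N) xs"
proof -
  have "weakly_regular q (genideal R (monomial ` (exponents - {e \<in> exponents. lookup e 0 < N}))) xs"
  proof (rule weakly_regular_filtration[OF assms finite_low_weight])
    fix e e' :: "nat \<Rightarrow>\<^sub>0 nat" assume e: "e \<in> {e \<in> exponents. lookup e 0 < N}" "e' \<in> exponents" "e' < e"
    from e(3) obtain k where "lookup e' k < lookup e k" "\<forall>j<k. lookup e' j = lookup e j"
      unfolding less_poly_mapping.rep_eq less_fun_def by blast
    then have "lookup e' 0 \<le> lookup e 0" by (cases k) auto
    then show "e' \<in> {e \<in> exponents. lookup e 0 < N}" using e by auto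
  qed auto
  moreover have "exponents - {e \<in> exponents. lookup e 0 < N} = {e \<in> exponents. N \<le> lookup e 0}" by auto
  ultimately show ?thesis by (simp add: weight_ideal_def)
qed

end

context noeth_cring begin

text \<open>A name of its own for the power keeps the simplifier from rewriting with the general laws for powers in a monoid.\<close>

definition ipow :: "'a set \<Rightarrow> nat \<Rightarrow> 'a set" where
  "ipow I n = I [^]\<^bsub>ideals_set R\<^esub> n"

lemma ipow_0: "ipow I 0 = carrier R" by (simp add: ipow_def ideals_set_def nat_pow_def)

lemma ipow_Suc: "ipow I (Suc n) = ideal_prod R (ipow I n) I"
  unfolding ipow_def nat_pow_def by (simp add: ideals_set_def)

lemma ipow_ideal: "ideal I R \<Longrightarrow> ideal (ipow I n) R"
  by (induction n) (auto simp: ipow_0 ipow_Suc oneideal ideal_prod_is_ideal)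

end

context weighted_monomials begin

lemma ipow_subset_weight_ideal:
  assumes T: "T \<subseteq> {1..m}" and I: "I = genideal R (v ` T)" and k: "\<And>i. i \<in> T \<Longrightarrow> w i = k"
  shows "ipow I n \<subseteq> weight_ideal (n * k)"
proof (induction n)
  case 0
  have "\<one> \<in> weight_ideal 0"
    unfolding weight_ideal_def using genideal_self[OF monomial_image_closed] exponents_zero monomial_zero by force
  then show ?case using ideal.one_imp_carrier[OF weight_ideal_ideal] ideal_subset[OF weight_ideal_ideal] by (simp add: ipow_0)
next
  case (Suc n)
  let ?W = "weight_ideal (Suc n * k)"
  have Ii: "ideal I R" unfolding I using T v_closed by (intro genideal_ideal) auto
  have step: "x \<otimes> y \<in> ?W" if x: "x \<in> ipow I n" and y: "y \<in> I" for x y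
  proof -
    have yc: "y \<in> carrier R" using y ideal_subset[OF Ii] by blast
    have "monomial e \<otimes> y \<in> ?W" if e: "e \<in> exponents" "n * k \<le> lookup e 0" for e
    proof -
      have "v i \<in> colon ?W (monomial e)" if i: "i \<in> T" for i
      proof -
        have im: "i \<in> {1..m}" using i T by blast
        have "lookup (single_exp i 1 + e) 0 = k + lookup e 0"
          using k[OF i] by (simp add: lookup_add lookup_single_exp[OF im])
        then have "monomial (single_exp i 1 + e) \<in> ?W" unfolding weight_ideal_def
          using exponents_add[OF exponents_single_exp[OF im] e(1)] e(2) by (intro subsetD[OF genideal_self[OF monomial_image_closed]]) auto
        then show ?thesis using v_closed[OF im] by (simp add: colon_def monomial_add monomial_single_exp[OF im])
      qed
      then have "I \<subseteq> colon ?W (monomial e)"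
        unfolding I by (intro genideal_minimal colon_ideal weight_ideal_ideal monomial_closed) auto
      then have "y \<otimes> monomial e \<in> ?W" using y unfolding colon_def by blast
      then show ?thesis using yc by (simp add: m_comm)
    qed
    then have "weight_ideal (n * k) \<subseteq> colon ?W y"
      unfolding weight_ideal_def[of "n * k"]
      by (intro genideal_minimal colon_ideal weight_ideal_ideal yc) (auto simp: colon_def)
    then show ?thesis using x Suc.IH unfolding colon_def by blast
  qed
  then show ?case
    unfolding ipow_Suc ideal_prod_eq_genideal[OF ipow_ideal[OF Ii] Ii]
    by (intro genideal_minimal weight_ideal_ideal) (auto simp: set_mult_def)
qed

text \<open>If every exponent satisfied \<open>e i < c i\<close>, the weight would be below \<open>k\<close>.  So some \<open>v i [^] c i\<close> divides the monomial; it
contributes one factor from \<open>I\<close> and uses up weight at most \<open>k\<close>.\<close>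

lemma monomial_in_sat_ipow:
  assumes q: "primeideal q R" and I: "ideal I R"
    and c: "\<And>i. i \<in> {1..m} \<Longrightarrow> v i [^] c i \<in> sat q I" "\<And>i. i \<in> {1..m} \<Longrightarrow> w i * c i \<le> k"
    and small: "(\<Sum>i=1..m. w i * (c i - 1)) < k"
  shows "e \<in> exponents \<Longrightarrow> n * k \<le> lookup e 0 \<Longrightarrow> monomial e \<in> sat q (ipow I n)"
proof (induction n arbitrary: e)
  case 0
  show ?case unfolding ipow_0 by (rule subsetD[OF sat_superset[OF q oneideal] monomial_closed])
next
  case (Suc n)
  have "\<exists>i\<in>{1..m}. c i \<le> lookup e i"
  proof (rule ccontr)
    assume "\<not> ?thesis"
    then have "lookup e i \<le> c i - 1" if "i \<in> {1..m}" for i using that by force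
    then have "lookup e 0 \<le> (\<Sum>i=1..m. w i * (c i - 1))"
      using Suc.prems(1) by (auto simp: exponents_def intro!: sum_mono)
    then show False using small Suc.prems(2) by simp
  qed
  then obtain i where i: "i \<in> {1..m}" "c i \<le> lookup e i" by blast
  let ?s = "single_exp i (c i)"
  have s: "?s \<in> exponents" using exponents_single_exp[OF i(1)] .
  have le: "lookup ?s j \<le> lookup e j" if "j \<in> {1..m}" for j
    using i that by (simp add: lookup_single_exp)
  note d = exponents_diff[OF Suc.prems(1) s le]
  have "lookup e 0 = w i * c i + lookup (e - ?s) 0"
    using arg_cong[OF d(2), of "\<lambda>e. lookup e 0"] by (simp add: lookup_add lookup_single_exp[OF i(1)])
  then have "n * k \<le> lookup (e - ?s) 0" using c(2)[OF i(1)] Suc.prems(2) by simp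
  then have "monomial (e - ?s) \<in> sat q (ipow I n)" using Suc.IH d(1) by blast
  then obtain t where t: "t \<in> carrier R" "t \<notin> q" "t \<otimes> monomial (e - ?s) \<in> ipow I n" by (rule satE)
  obtain u where u: "u \<in> carrier R" "u \<notin> q" "u \<otimes> v i [^] c i \<in> I" using c(1)[OF i(1)] by (rule satE)
  have vc: "v i [^] c i \<in> carrier R" using v_closed[OF i(1)] by simp
  have "monomial e = v i [^] c i \<otimes> monomial (e - ?s)"
    using arg_cong[OF d(2), of monomial] by (simp add: monomial_add monomial_single_exp[OF i(1)])
  then have "(t \<otimes> u) \<otimes> monomial e = (t \<otimes> monomial (e - ?s)) \<otimes> (u \<otimes> v i [^] c i)"
    using t(1) u(1) vc monomial_closed[of "e - ?s"] by algebra
  also have "\<dots> \<in> ipow I (Suc n)"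
    unfolding ipow_Suc using t(3) u(3) by (rule ideal_prod.prod)
  finally show ?case
    by (rule satI[OF monomial_closed m_closed[OF t(1) u(1)] prime_mult_notin[OF q t(1) u(1) t(2) u(2)]])
qed

end

context noeth_cring begin

text \<open>Among the ideals \<open>K g = (I : g\<^sup>\<infinity>)\<close> with \<open>g\<close> not nilpotent modulo \<open>I\<close> choose a maximal one.  If \<open>a g\<close> is not nilpotent modulo \<open>I\<close>
then \<open>K (a g) = K g\<close>, and this makes \<open>a\<close> a nonzerodivisor modulo \<open>K g\<close>.  So an associated prime \<open>P\<close> of
\<open>K g\<close> consists of elements \<open>a\<close> for which \<open>a g\<close> is nilpotent modulo \<open>I\<close>.  In other words \<open>P\<close> is the radical of \<open>I\<close> once \<open>g\<close> is inverted.\<close>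

lemma exists_isolated_prime:
  assumes I: "ideal I R" and ne: "I \<noteq> carrier R"
  shows "\<exists>P g. primeideal P R \<and> I \<subseteq> P \<and> g \<in> carrier R \<and> g \<notin> P \<and>
    (\<forall>a\<in>P. \<exists>n::nat. (a \<otimes> g) [^] n \<in> I)"
proof -
  define K where "K = (\<lambda>g. {r \<in> carrier R. \<exists>n::nat. g [^] n \<otimes> r \<in> I})"
  have K: "ideal (K g) R" if g: "g \<in> carrier R" for g
  proof (rule idealI')
    show "K g \<subseteq> carrier R" by (auto simp: K_def)
    show "\<zero> \<in> K g" unfolding K_def using ideal_zero[OF I] g by (auto intro!: exI[of _ 0])
  next
    fix a b assume "a \<in> K g" "b \<in> K g"
    then obtain n k :: nat where ab: "a \<in> carrier R" "b \<in> carrier R" "g [^] n \<otimes> a \<in> I" "g [^] k \<otimes> b \<in> I"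
      unfolding K_def by blast
    have gc: "g [^] n \<in> carrier R" "g [^] k \<in> carrier R" using g by auto
    have "g [^] (n + k) \<otimes> (a \<oplus> b) = (g [^] n \<otimes> g [^] k) \<otimes> (a \<oplus> b)" using g by (simp add: nat_pow_mult)
    also have "\<dots> = g [^] k \<otimes> (g [^] n \<otimes> a) \<oplus> g [^] n \<otimes> (g [^] k \<otimes> b)" using gc ab(1,2) by algebra
    also have "\<dots> \<in> I" using ideal_add[OF I ideal_mult[OF I ab(3) gc(2)] ideal_mult[OF I ab(4) gc(1)]] .
    finally show "a \<oplus> b \<in> K g" unfolding K_def using ab(1,2) by blast
  next
    fix a r assume "a \<in> K g" and r: "r \<in> carrier R"
    then obtain n :: nat where a: "a \<in> carrier R" "g [^] n \<otimes> a \<in> I" unfolding K_def by blast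
    have gc: "g [^] n \<in> carrier R" using g by auto
    have "g [^] n \<otimes> (r \<otimes> a) = r \<otimes> (g [^] n \<otimes> a)" using gc a(1) r by algebra
    also have "\<dots> \<in> I" using ideal_mult[OF I a(2) r] .
    finally show "r \<otimes> a \<in> K g" unfolding K_def using a(1) r by blast
  qed
  define rad where "rad = (\<lambda>g. \<exists>n::nat. g [^] n \<in> I)"
  define family where "family = {K g | g. g \<in> carrier R \<and> \<not> rad g}"
  have "\<one> \<notin> I" using ne ideal.one_imp_carrier[OF I] by blast
  then have "\<not> rad \<one>" unfolding rad_def by simp
  then have "K \<one> \<in> family" unfolding family_def by blast
  obtain K0 where K0: "K0 \<in> family" and max: "\<And>K'. K' \<in> family \<Longrightarrow> K0 \<subseteq> K' \<Longrightarrow> K' = K0"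
  proof (rule ideal_max[of family])
    show "family \<noteq> {}" using \<open>K \<one> \<in> family\<close> by blast
  qed (use K in \<open>auto simp: family_def\<close>)
  obtain g where g: "g \<in> carrier R" "\<not> rad g" "K0 = K g" using K0 unfolding family_def by blast
  have Kg: "ideal K0 R" unfolding g(3) using K[OF g(1)] .
  have IK: "I \<subseteq> K0" unfolding g(3) K_def using ideal_subset[OF I] by (auto intro!: exI[of _ 0])
  have "\<one> \<notin> K0" using g(1,2) unfolding g(3) K_def rad_def by simp
  then have "K0 \<noteq> carrier R" by (metis one_closed)
  then obtain s where s: "s \<in> carrier R" "s \<notin> K0" and P: "primeideal (colon K0 s) R"
    using colon_prime_exists[OF Kg] by blast
  define P where "P = colon K0 s"
  have pP: "primeideal P R" using P unfolding P_def .
  have zd: "rad (a \<otimes> g)" if a: "a \<in> P" for a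
  proof (rule ccontr)
    assume nr: "\<not> rad (a \<otimes> g)"
    have ac: "a \<in> carrier R" "a \<otimes> s \<in> K0" using a unfolding P_def colon_def by auto
    have "K0 \<subseteq> K (a \<otimes> g)"
    proof
      fix r assume "r \<in> K0"
      then obtain n :: nat where r: "r \<in> carrier R" "g [^] n \<otimes> r \<in> I" unfolding g(3) K_def by blast
      have c: "g [^] n \<in> carrier R" "a [^] n \<in> carrier R" using g(1) ac(1) by auto
      have "(a \<otimes> g) [^] n \<otimes> r = (a [^] n \<otimes> g [^] n) \<otimes> r" using pow_mult_distrib[OF m_comm[OF ac(1) g(1)] ac(1) g(1)] by simp
      also have "\<dots> = a [^] n \<otimes> (g [^] n \<otimes> r)" using c r(1) by algebra
      also have "\<dots> \<in> I" using ideal_mult[OF I r(2) c(2)] .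
      finally show "r \<in> K (a \<otimes> g)" unfolding K_def using r(1) by blast
    qed
    moreover have "K (a \<otimes> g) \<in> family" unfolding family_def using nr ac(1) g(1) by blast
    ultimately have eq: "K (a \<otimes> g) = K0" using max by blast
    obtain n :: nat where n: "g [^] n \<otimes> (a \<otimes> s) \<in> I" using ac(2) unfolding g(3) K_def by blast
    have c: "g [^] n \<in> carrier R" "a [^] n \<in> carrier R" using g(1) ac(1) by auto
    have "(a \<otimes> g) [^] Suc n \<otimes> s = (a [^] n \<otimes> g [^] n) \<otimes> (a \<otimes> g) \<otimes> s"
      using pow_mult_distrib[OF m_comm[OF ac(1) g(1)] ac(1) g(1)] by simp
    also have "\<dots> = (a [^] n \<otimes> g) \<otimes> (g [^] n \<otimes> (a \<otimes> s))" using c ac(1) g(1) s(1) by algebra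
    also have "\<dots> \<in> I" using ideal_mult[OF I n] c(2) g(1) by blast
    finally have "s \<in> K (a \<otimes> g)" unfolding K_def using s(1) by blast
    then show False using s(2) eq by simp
  qed
  have "I \<subseteq> P"
  proof
    fix a assume a: "a \<in> I"
    then have ac: "a \<in> carrier R" using ideal_subset[OF I] by blast
    have "s \<otimes> a \<in> K0" using ideal_mult[OF Kg _ s(1)] a IK by blast
    then show "a \<in> P" unfolding P_def colon_def using ac m_comm[OF ac s(1)] by simp
  qed
  moreover have "g \<notin> P"
  proof
    assume "g \<in> P"
    then have "rad (g \<otimes> g)" by (rule zd)
    then obtain n :: nat where "(g \<otimes> g) [^] n \<in> I" unfolding rad_def by blast
    then have "g [^] (n + n) \<in> I" using pow_mult_distrib[OF refl g(1,1)] g(1) by (simp add: nat_pow_mult)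
    then show False using g(2) unfolding rad_def by blast
  qed
  ultimately show ?thesis using pP g(1) zd unfolding rad_def by blast
qed

text \<open>The transfer of regular sequences from \<open>R/P\<close> to all \<open>R/I\<^sup>n\<close> off the zero set of one \<open>f\<close>.  Inverting \<open>g\<close> makes \<open>P\<close> nilpotent modulo \<open>I\<close>, and inverting \<open>f1\<close> kills the
steps of the monomial filtration that differ from \<open>R/P\<close>.\<close>

theorem generic_normal_flatness:
  assumes I: "ideal I R" and ne: "I \<noteq> carrier R"
  obtains P f where "primeideal P R" "I \<subseteq> P" "f \<in> carrier R" "f \<notin> P"
    and "\<And>p. primeideal p R \<Longrightarrow> I \<subseteq> p \<Longrightarrow> f \<notin> p \<Longrightarrow> P \<subseteq> p"
    and "\<And>q xs n. primeideal q R \<Longrightarrow> f \<notin> q \<Longrightarrow> set xs \<subseteq> carrier R \<Longrightarrow>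
       weakly_regular q P xs \<Longrightarrow> weakly_regular q (ipow I n) xs"
proof -
  obtain P g where P: "primeideal P R" and IP: "I \<subseteq> P" and g: "g \<in> carrier R" "g \<notin> P"
    and nil: "\<And>a. a \<in> P \<Longrightarrow> \<exists>n::nat. (a \<otimes> g) [^] n \<in> I"
    using exists_isolated_prime[OF I ne] by blast
  have Pi: "ideal P R" using prime_ideal[OF P] .
  obtain ts where ts: "set ts \<subseteq> carrier R" "I = genideal R (set ts)"
    using finetely_gen[OF I] finite_list by metis
  obtain us where us: "set us \<subseteq> carrier R" "P = genideal R (set us)"
    using finetely_gen[OF Pi] finite_list by metis
  define m where "m = length (ts @ us)"
  define v where "v = (\<lambda>i. (ts @ us) ! (i - 1))"
  define T where "T = {1..length ts}"
  have Tm: "T \<subseteq> {1..m}" by (auto simp: T_def m_def)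
  have vim: "v ` {1..m} = set ts \<union> set us"
  proof -
    have "v ` {1..m} = (\<lambda>i. (ts @ us) ! i) ` (\<lambda>i. i - 1) ` {1..m}" by (auto simp: v_def)
    also have "(\<lambda>i. i - 1) ` {1..m} = {..<m}" by (force simp: image_iff)
    also have "(\<lambda>i. (ts @ us) ! i) ` {..<m} = set (ts @ us)"
      unfolding m_def by (metis atLeast_upt image_set map_nth)
    finally show ?thesis by simp
  qed
  have vT: "v ` T = set ts"
  proof -
    have "v ` T = (\<lambda>i. ts ! i) ` (\<lambda>i. i - 1) ` T"
      unfolding image_image by (intro image_cong) (auto simp: v_def T_def nth_append)
    also have "(\<lambda>i. i - 1) ` T = {..<length ts}" unfolding T_def by (force simp: image_iff)
    also have "(\<lambda>i. ts ! i) ` {..<length ts} = set ts"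
      by (metis atLeast_upt image_set map_nth)
    finally show ?thesis .
  qed
  have vc: "v i \<in> carrier R" if "i \<in> {1..m}" for i
    using that vim ts(1) us(1) by blast
  have vP: "v i \<in> P" if "i \<in> {1..m}" for i
    using that vim genideal_self[OF us(1)] us(2) genideal_self[OF ts(1)] ts(2) IP by blast
  have PV: "P = genideal R (v ` {1..m})"
  proof (rule subset_antisym)
    show "P \<subseteq> genideal R (v ` {1..m})" unfolding us(2) vim
      using ts(1) us(1) by (intro genideal_minimal genideal_ideal) (auto intro: subsetD[OF genideal_self])
    show "genideal R (v ` {1..m}) \<subseteq> P" using vP by (intro genideal_minimal[OF Pi]) auto
  qed
  obtain N where N: "\<And>i. i \<in> {1..m} \<Longrightarrow> (v i \<otimes> g) [^] (N i :: nat) \<in> I"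
    using nil[OF vP] by metis
  define \<kappa> where "\<kappa> = (\<Sum>i=1..m. N i)"
  have \<kappa>: "(v i \<otimes> g) [^] \<kappa> \<in> I" if i: "i \<in> {1..m}" for i
  proof -
    have "N i \<le> \<kappa>" unfolding \<kappa>_def using i by (intro member_le_sum) auto
    then have "(v i \<otimes> g) [^] \<kappa> = (v i \<otimes> g) [^] (\<kappa> - N i) \<otimes> (v i \<otimes> g) [^] N i"
      using vc[OF i] g(1) by (simp add: nat_pow_mult)
    then show ?thesis using ideal_mult[OF I N[OF i]] vc[OF i] g(1) by simp
  qed
  \<comment> \<open>The weight \<open>k\<close> of the generators of \<open>I\<close> exceeds the weight of any monomial in the generators of \<open>P\<close>
    whose exponents are all below \<open>\<kappa>\<close>, and \<open>v i [^] c i\<close> lies in \<open>I\<close> once \<open>g\<close> is inverted.\<close>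
  define k where "k = m * \<kappa> + \<kappa> + 1"
  define w where "w = (\<lambda>i. if i \<in> T then k else 1)"
  define c where "c = (\<lambda>i. if i \<in> T then 1 else \<kappa>)"
  interpret weighted_monomials R v w m
    by unfold_locales (auto simp: vc w_def k_def)
  obtain f1 where f1: "f1 \<in> carrier R" "f1 \<notin> P" "\<And>e. e \<in> exponents \<Longrightarrow> step_annihilator e = P \<or> f1 \<in> step_annihilator e"
    using generic_steps[OF P PV] by blast
  define f where "f = g \<otimes> f1"
  have fc: "f \<in> carrier R" "f \<notin> P" unfolding f_def using g f1(1,2) prime_mult_notin[OF P] by auto
  have f_notin: "g \<notin> q \<and> f1 \<notin> q" if "primeideal q R" "f \<notin> q" for q
  proof -
    have qi: "ideal q R" using prime_ideal[OF that(1)] .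
    have "f1 \<notin> q" using ideal_mult[OF qi _ g(1)] that(2) unfolding f_def by blast
    moreover have "g \<notin> q" using ideal_mult[OF qi _ f1(1)] m_comm[OF g(1) f1(1)] that(2) unfolding f_def by auto
    ultimately show ?thesis by blast
  qed
  have isolated: "P \<subseteq> p" if p: "primeideal p R" "I \<subseteq> p" "f \<notin> p" for p
  proof
    fix a assume a: "a \<in> P"
    have ac: "a \<in> carrier R" using a ideal_subset[OF Pi] by blast
    have "a \<otimes> g \<in> p" using nil[OF a] p(2) prime_pow_mem[OF p(1) m_closed[OF ac g(1)]] by blast
    then have "g \<otimes> a \<in> p" using m_comm[OF ac g(1)] by simp
    then show "a \<in> p" using prime_mem[OF p(1) _ g(1) ac] f_notin[OF p(1,3)] by blast
  qed
  have transfer: "weakly_regular q (ipow I n) xs"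
    if q: "primeideal q R" "f \<notin> q" and xs: "set xs \<subseteq> carrier R" and wP: "weakly_regular q P xs" for q xs n
  proof -
    have gq: "g \<notin> q" "f1 \<notin> q" using f_notin[OF q] by auto
    have vsat: "v i [^] c i \<in> sat q I" if i: "i \<in> {1..m}" for i
    proof (cases "i \<in> T")
      case True
      then have "v i \<in> I" using vT genideal_self[OF ts(1)] ts(2) by blast
      then show ?thesis using True sat_superset[OF q(1) I] vc[OF i] by (auto simp: c_def)
    next
      case False
      have "g [^] \<kappa> \<otimes> v i [^] \<kappa> = (v i \<otimes> g) [^] \<kappa>"
        using vc[OF i] g(1) by (simp add: pow_mult_distrib m_comm)
      then have "g [^] \<kappa> \<otimes> v i [^] \<kappa> \<in> I" using \<kappa>[OF i] by simp
      then show ?thesis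
        using False satI[of "v i [^] \<kappa>" "g [^] \<kappa>" q I] prime_pow_mem[OF q(1) g(1)] gq(1) g(1) vc[OF i]
        by (auto simp: c_def)
    qed
    have wc: "w i * c i \<le> k" for i by (auto simp: w_def c_def k_def)
    have small: "(\<Sum>i=1..m. w i * (c i - 1)) < k"
    proof -
      have "(\<Sum>i=1..m. w i * (c i - 1)) \<le> (\<Sum>i=1..m. \<kappa>)"
        by (intro sum_mono) (auto simp: w_def c_def)
      then show ?thesis by (simp add: k_def)
    qed
    have Iw: "ipow I n \<subseteq> weight_ideal (n * k)"
      by (rule ipow_subset_weight_ideal[OF Tm]) (auto simp: vT ts(2) w_def)
    have "weight_ideal (n * k) \<subseteq> sat q (ipow I n)"
      unfolding weight_ideal_def
      using monomial_in_sat_ipow[OF q(1) I vsat wc small]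
      by (intro genideal_minimal sat_ideal[OF q(1)] ipow_ideal[OF I]) auto
    then have "sat q (weight_ideal (n * k)) = sat q (ipow I n)"
      using sat_mono[OF Iw, of q] sat_mono[of "weight_ideal (n * k)" "sat q (ipow I n)" q]
        sat_closed[OF q(1) q(1) subset_refl ipow_ideal[OF I]] by simp
    moreover have "weakly_regular q (weight_ideal (n * k)) xs"
      using weakly_regular_weight_ideal[OF q(1) Pi xs gq(2) f1(3) wP] by blast
    ultimately show ?thesis
      using weakly_regular_cong[OF q(1) weight_ideal_ideal ipow_ideal[OF I] _ xs] by blast
  qed
  show thesis by (rule that[OF P IP fc isolated transfer])
qed

end

section \<open>Localizations are rings\<close>

locale mult_set = cring R for R (structure) +
  fixes S
  assumes S_closed: "s \<in> S \<Longrightarrow> s \<in> carrier R"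
    and S_one: "\<one> \<in> S"
    and S_mult: "s \<in> S \<Longrightarrow> t \<in> S \<Longrightarrow> s \<otimes> t \<in> S"
begin

definition eqv where
  "eqv r s r' s' \<longleftrightarrow> (\<exists>t\<in>S. t \<otimes> ((s' \<otimes> r) \<ominus> (s \<otimes> r')) = \<zero>)"

lemma eqvI: "t \<in> S \<Longrightarrow> t \<otimes> ((s' \<otimes> r) \<ominus> (s \<otimes> r')) = \<zero> \<Longrightarrow> eqv r s r' s'"
  by (auto simp: eqv_def)

lemma eqv_eqI: "s' \<otimes> r = s \<otimes> r' \<Longrightarrow> r' \<in> carrier R \<Longrightarrow> s \<in> S \<Longrightarrow> eqv r s r' s'"
  using S_one S_closed by (intro eqvI[of \<one>]) (auto simp: r_neg a_minus_def)

lemma mem_frac: "(r', s') \<in> frac R S r s \<longleftrightarrow> r' \<in> carrier R \<and> s' \<in> S \<and> eqv r s r' s'"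
  by (auto simp: frac_def eqv_def)

lemma eqv_refl: "r \<in> carrier R \<Longrightarrow> s \<in> S \<Longrightarrow> eqv r s r s"
  by (rule eqv_eqI) auto

lemma eqv_sym:
  assumes "eqv r s r' s'" "r \<in> carrier R" "s \<in> S" "r' \<in> carrier R" "s' \<in> S"
  shows "eqv r' s' r s"
proof -
  obtain t where t: "t \<in> S" "t \<otimes> ((s' \<otimes> r) \<ominus> (s \<otimes> r')) = \<zero>" using assms(1) by (auto simp: eqv_def)
  have c: "s \<in> carrier R" "s' \<in> carrier R" "t \<in> carrier R" using assms t S_closed by auto
  have "t \<otimes> ((s \<otimes> r') \<ominus> (s' \<otimes> r)) = \<ominus> (t \<otimes> ((s' \<otimes> r) \<ominus> (s \<otimes> r')))"
    using c assms(2,4) by algebra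
  then show ?thesis using t by (intro eqvI[of t]) auto
qed

lemma eqv_trans:
  assumes "eqv r s r' s'" "eqv r' s' r'' s''" "r \<in> carrier R" "s \<in> S" "r' \<in> carrier R" "s' \<in> S"
    "r'' \<in> carrier R" "s'' \<in> S"
  shows "eqv r s r'' s''"
proof -
  obtain t where t: "t \<in> S" "t \<otimes> ((s' \<otimes> r) \<ominus> (s \<otimes> r')) = \<zero>" using assms(1) by (auto simp: eqv_def)
  obtain t' where t': "t' \<in> S" "t' \<otimes> ((s'' \<otimes> r') \<ominus> (s' \<otimes> r'')) = \<zero>" using assms(2) by (auto simp: eqv_def)
  have c: "s \<in> carrier R" "s' \<in> carrier R" "s'' \<in> carrier R" "t \<in> carrier R" "t' \<in> carrier R"
    using assms t t' S_closed by auto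
  have "(t \<otimes> t' \<otimes> s') \<otimes> ((s'' \<otimes> r) \<ominus> (s \<otimes> r'')) =
    t' \<otimes> s'' \<otimes> (t \<otimes> ((s' \<otimes> r) \<ominus> (s \<otimes> r'))) \<oplus> t \<otimes> s \<otimes> (t' \<otimes> ((s'' \<otimes> r') \<ominus> (s' \<otimes> r'')))"
    using c assms(3,5,7) by algebra
  also have "\<dots> = \<zero>" unfolding t(2) t'(2) using c by simp
  finally show ?thesis using t(1) t'(1) assms(6) S_mult by (intro eqvI[of "t \<otimes> t' \<otimes> s'"]) auto
qed

lemma frac_eq_iff:
  assumes "r \<in> carrier R" "s \<in> S" "r' \<in> carrier R" "s' \<in> S"
  shows "frac R S r s = frac R S r' s' \<longleftrightarrow> eqv r s r' s'"
proof
  assume "frac R S r s = frac R S r' s'"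
  then have "(r', s') \<in> frac R S r s" using mem_frac eqv_refl assms by blast
  then show "eqv r s r' s'" using mem_frac by blast
next
  assume e: "eqv r s r' s'"
  show "frac R S r s = frac R S r' s'"
  proof (rule subset_antisym; rule subsetI)
    fix z assume z: "z \<in> frac R S r s"
    obtain a b where ab: "z = (a, b)" by (cases z)
    have "eqv r' s' a b"
      using z eqv_trans[OF eqv_sym[OF e assms]] assms unfolding ab mem_frac by blast
    then show "z \<in> frac R S r' s'" using z unfolding ab mem_frac by blast
  next
    fix z assume z: "z \<in> frac R S r' s'"
    obtain a b where ab: "z = (a, b)" by (cases z)
    have "eqv r s a b" using z eqv_trans[OF e] assms unfolding ab mem_frac by blast
    then show "z \<in> frac R S r s" using z unfolding ab mem_frac by blast
  qed
qed

lemma Union_frac: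
  assumes "r \<in> carrier R" "s \<in> S" "r' \<in> carrier R" "s' \<in> S"
    and "\<And>a b a' b'. a \<in> carrier R \<Longrightarrow> b \<in> S \<Longrightarrow> a' \<in> carrier R \<Longrightarrow> b' \<in> S \<Longrightarrow>
      eqv r s a b \<Longrightarrow> eqv r' s' a' b' \<Longrightarrow> F a b a' b' = F r s r' s'"
  shows "(\<Union>(a, b)\<in>frac R S r s. \<Union>(a', b')\<in>frac R S r' s'. F a b a' b') = F r s r' s'"
proof -
  have "(r, s) \<in> frac R S r s" "(r', s') \<in> frac R S r' s'"
    using assms by (auto simp: mem_frac eqv_refl)
  moreover have "F a b a' b' = F r s r' s'" if "(a, b) \<in> frac R S r s" "(a', b') \<in> frac R S r' s'" for a b a' b'
    using that assms(5) by (simp add: mem_frac)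
  then have "(\<Union>(a, b)\<in>frac R S r s. \<Union>(a', b')\<in>frac R S r' s'. F a b a' b')
    = (\<Union>_\<in>frac R S r s. \<Union>_\<in>frac R S r' s'. F r s r' s')"
    by (intro SUP_cong refl) auto
  ultimately show ?thesis by auto
qed

text \<open>Representatives of a class give equal results, so the unions in the operations can be computed on any one of them.\<close>

abbreviation L where "L \<equiv> localization R S"

lemma mult_frac:
  assumes "r \<in> carrier R" "s \<in> S" "r' \<in> carrier R" "s' \<in> S"
  shows "frac R S r s \<otimes>\<^bsub>L\<^esub> frac R S r' s' = frac R S (r \<otimes> r') (s \<otimes> s')"
proof -
  have "(\<Union>(a, b)\<in>frac R S r s. \<Union>(a', b')\<in>frac R S r' s'. frac R S (a \<otimes> a') (b \<otimes> b'))
    = frac R S (r \<otimes> r') (s \<otimes> s')"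
  proof (rule Union_frac[OF assms])
    fix a b a' b' assume m: "a \<in> carrier R" "b \<in> S" "a' \<in> carrier R" "b' \<in> S"
      and e: "eqv r s a b" "eqv r' s' a' b'"
    obtain t where t: "t \<in> S" "t \<otimes> ((b \<otimes> r) \<ominus> (s \<otimes> a)) = \<zero>" using e(1) by (auto simp: eqv_def)
    obtain t' where t': "t' \<in> S" "t' \<otimes> ((b' \<otimes> r') \<ominus> (s' \<otimes> a')) = \<zero>" using e(2) by (auto simp: eqv_def)
    have c: "s \<in> carrier R" "s' \<in> carrier R" "b \<in> carrier R" "b' \<in> carrier R" "t \<in> carrier R" "t' \<in> carrier R"
      using assms m t t' S_closed by auto
    have "(t \<otimes> t') \<otimes> (((b \<otimes> b') \<otimes> (r \<otimes> r')) \<ominus> ((s \<otimes> s') \<otimes> (a \<otimes> a')))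
      = t' \<otimes> b' \<otimes> r' \<otimes> (t \<otimes> ((b \<otimes> r) \<ominus> (s \<otimes> a))) \<oplus> t \<otimes> s \<otimes> a \<otimes> (t' \<otimes> ((b' \<otimes> r') \<ominus> (s' \<otimes> a')))"
      using c assms(1,3) m(1,3) by algebra
    also have "\<dots> = \<zero>" unfolding t(2) t'(2) using c assms(1,3) m(1,3) by simp
    finally have "eqv (r \<otimes> r') (s \<otimes> s') (a \<otimes> a') (b \<otimes> b')" by (intro eqvI[OF S_mult[OF t(1) t'(1)]])
    then show "frac R S (a \<otimes> a') (b \<otimes> b') = frac R S (r \<otimes> r') (s \<otimes> s')"
      using frac_eq_iff[of "r \<otimes> r'" "s \<otimes> s'" "a \<otimes> a'" "b \<otimes> b'"] m assms S_mult by simp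
  qed
  then show ?thesis by (simp add: localization_def)
qed

lemma add_frac:
  assumes "r \<in> carrier R" "s \<in> S" "r' \<in> carrier R" "s' \<in> S"
  shows "frac R S r s \<oplus>\<^bsub>L\<^esub> frac R S r' s' = frac R S (s' \<otimes> r \<oplus> s \<otimes> r') (s \<otimes> s')"
proof -
  have "(\<Union>(a, b)\<in>frac R S r s. \<Union>(a', b')\<in>frac R S r' s'. frac R S ((b' \<otimes> a) \<oplus> (b \<otimes> a')) (b \<otimes> b'))
    = frac R S (s' \<otimes> r \<oplus> s \<otimes> r') (s \<otimes> s')"
  proof (rule Union_frac[OF assms])
    fix a b a' b' assume m: "a \<in> carrier R" "b \<in> S" "a' \<in> carrier R" "b' \<in> S"
      and e: "eqv r s a b" "eqv r' s' a' b'"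
    obtain t where t: "t \<in> S" "t \<otimes> ((b \<otimes> r) \<ominus> (s \<otimes> a)) = \<zero>" using e(1) by (auto simp: eqv_def)
    obtain t' where t': "t' \<in> S" "t' \<otimes> ((b' \<otimes> r') \<ominus> (s' \<otimes> a')) = \<zero>" using e(2) by (auto simp: eqv_def)
    have c: "s \<in> carrier R" "s' \<in> carrier R" "b \<in> carrier R" "b' \<in> carrier R" "t \<in> carrier R" "t' \<in> carrier R"
      using assms m t t' S_closed by auto
    have "(t \<otimes> t') \<otimes> (((b \<otimes> b') \<otimes> (s' \<otimes> r \<oplus> s \<otimes> r')) \<ominus> ((s \<otimes> s') \<otimes> (b' \<otimes> a \<oplus> b \<otimes> a')))
      = t' \<otimes> b' \<otimes> s' \<otimes> (t \<otimes> ((b \<otimes> r) \<ominus> (s \<otimes> a))) \<oplus> t \<otimes> s \<otimes> b \<otimes> (t' \<otimes> ((b' \<otimes> r') \<ominus> (s' \<otimes> a')))"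
      using c assms(1,3) m(1,3) by algebra
    also have "\<dots> = \<zero>" unfolding t(2) t'(2) using c assms(1,3) m(1,3) by simp
    finally have "eqv (s' \<otimes> r \<oplus> s \<otimes> r') (s \<otimes> s') (b' \<otimes> a \<oplus> b \<otimes> a') (b \<otimes> b')"
      by (intro eqvI[OF S_mult[OF t(1) t'(1)]])
    then show "frac R S ((b' \<otimes> a) \<oplus> (b \<otimes> a')) (b \<otimes> b') = frac R S (s' \<otimes> r \<oplus> s \<otimes> r') (s \<otimes> s')"
      using frac_eq_iff[of "s' \<otimes> r \<oplus> s \<otimes> r'" "s \<otimes> s'" "b' \<otimes> a \<oplus> b \<otimes> a'" "b \<otimes> b'"] m assms c S_mult by simp
  qed
  then show ?thesis by (simp add: localization_def)
qed

lemma carrier_loc: "carrier L = {frac R S r s | r s. r \<in> carrier R \<and> s \<in> S}"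
  and one_loc: "\<one>\<^bsub>L\<^esub> = frac R S \<one> \<one>"
  and zero_loc: "\<zero>\<^bsub>L\<^esub> = frac R S \<zero> \<one>"
  by (simp_all add: localization_def)

lemma frac_eqI:
  "r \<in> carrier R \<Longrightarrow> s \<in> S \<Longrightarrow> r' \<in> carrier R \<Longrightarrow> s' \<in> S \<Longrightarrow> s' \<otimes> r = s \<otimes> r' \<Longrightarrow> frac R S r s = frac R S r' s'"
  using frac_eq_iff eqv_eqI by blast

lemma frac_in_carrier: "r \<in> carrier R \<Longrightarrow> s \<in> S \<Longrightarrow> frac R S r s \<in> carrier L"
  using carrier_loc by blast

lemma locE:
  assumes "x \<in> carrier L"
  obtains r s where "x = frac R S r s" "r \<in> carrier R" "s \<in> S"
  using assms carrier_loc by blast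

lemma localization_cring: "cring L"
proof (rule cringI)
  show "abelian_group L"
  proof (rule abelian_groupI)
    fix x y assume "x \<in> carrier L" "y \<in> carrier L"
    then obtain r s r' s' where xy: "x = frac R S r s" "r \<in> carrier R" "s \<in> S" "y = frac R S r' s'" "r' \<in> carrier R" "s' \<in> S"
      by (metis locE)
    then have c: "s \<in> carrier R" "s' \<in> carrier R" using S_closed by auto
    show "x \<oplus>\<^bsub>L\<^esub> y \<in> carrier L"
      using xy c by (simp add: add_frac frac_in_carrier S_mult)
    show "x \<oplus>\<^bsub>L\<^esub> y = y \<oplus>\<^bsub>L\<^esub> x"
      using xy c by (simp add: add_frac m_comm a_comm)
  next
    show "\<zero>\<^bsub>L\<^esub> \<in> carrier L"
      by (simp add: zero_loc frac_in_carrier S_one)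
  next
    fix x y z assume "x \<in> carrier L" "y \<in> carrier L" "z \<in> carrier L"
    then obtain r s r' s' r'' s'' where xy: "x = frac R S r s" "r \<in> carrier R" "s \<in> S" "y = frac R S r' s'" "r' \<in> carrier R" "s' \<in> S"
       "z = frac R S r'' s''" "r'' \<in> carrier R" "s'' \<in> S"
      by (metis locE)
    then have c: "s \<in> carrier R" "s' \<in> carrier R" "s'' \<in> carrier R" using S_closed by auto
    have eq: "s'' \<otimes> (s' \<otimes> r \<oplus> s \<otimes> r') \<oplus> s \<otimes> s' \<otimes> r'' = s' \<otimes> s'' \<otimes> r \<oplus> s \<otimes> (s'' \<otimes> r' \<oplus> s' \<otimes> r'')"
      using c xy(2,5,8) by algebra
    show "x \<oplus>\<^bsub>L\<^esub> y \<oplus>\<^bsub>L\<^esub> z = x \<oplus>\<^bsub>L\<^esub> (y \<oplus>\<^bsub>L\<^esub> z)"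
      unfolding xy(1,4,7) using xy(2,3,5,6,8,9) c by (simp add: add_frac S_mult m_assoc eq[unfolded m_assoc])
         (use eq in \<open>simp add: m_assoc\<close>)
  next
    fix x assume "x \<in> carrier L"
    then obtain r s where x: "x = frac R S r s" "r \<in> carrier R" "s \<in> S" by (metis locE)
    then have c: "s \<in> carrier R" using S_closed by auto
    show "\<zero>\<^bsub>L\<^esub> \<oplus>\<^bsub>L\<^esub> x = x"
      using x c by (simp add: add_frac zero_loc S_one)
    have "frac R S (\<ominus> r) s \<oplus>\<^bsub>L\<^esub> x = \<zero>\<^bsub>L\<^esub>"
    proof -
      have "s \<otimes> (\<ominus> r) \<oplus> s \<otimes> r = \<zero>" using x(2) c by algebra
      then have "frac R S (s \<otimes> (\<ominus> r) \<oplus> s \<otimes> r) (s \<otimes> s) = frac R S \<zero> \<one>"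
        using c S_mult[OF x(3) x(3)] S_one by (intro frac_eqI) auto
      then show ?thesis using x by (simp add: add_frac zero_loc)
    qed
    then show "\<exists>y\<in>carrier L. y \<oplus>\<^bsub>L\<^esub> x = \<zero>\<^bsub>L\<^esub>"
      using x frac_in_carrier[of "\<ominus> r" s] by blast
  qed
  show "comm_monoid L"
  proof (rule comm_monoidI)
    fix x y assume "x \<in> carrier L" "y \<in> carrier L"
    then obtain r s r' s' where xy: "x = frac R S r s" "r \<in> carrier R" "s \<in> S" "y = frac R S r' s'" "r' \<in> carrier R" "s' \<in> S"
      by (metis locE)
    then have c: "s \<in> carrier R" "s' \<in> carrier R" using S_closed by auto
    show "x \<otimes>\<^bsub>L\<^esub> y \<in> carrier L"
      using xy c by (simp add: mult_frac frac_in_carrier S_mult)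
    show "x \<otimes>\<^bsub>L\<^esub> y = y \<otimes>\<^bsub>L\<^esub> x"
      using xy c by (simp add: mult_frac m_comm)
  next
    show "\<one>\<^bsub>L\<^esub> \<in> carrier L"
      by (simp add: one_loc frac_in_carrier S_one)
  next
    fix x y z assume "x \<in> carrier L" "y \<in> carrier L" "z \<in> carrier L"
    then obtain r s r' s' r'' s'' where xy: "x = frac R S r s" "r \<in> carrier R" "s \<in> S" "y = frac R S r' s'" "r' \<in> carrier R" "s' \<in> S"
       "z = frac R S r'' s''" "r'' \<in> carrier R" "s'' \<in> S"
      by (metis locE)
    then have c: "s \<in> carrier R" "s' \<in> carrier R" "s'' \<in> carrier R" using S_closed by auto
    show "x \<otimes>\<^bsub>L\<^esub> y \<otimes>\<^bsub>L\<^esub> z = x \<otimes>\<^bsub>L\<^esub> (y \<otimes>\<^bsub>L\<^esub> z)"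
      unfolding xy(1,4,7) using xy(2,3,5,6,8,9) c by (simp add: mult_frac S_mult m_assoc)
  next
    fix x assume "x \<in> carrier L"
    then obtain r s where x: "x = frac R S r s" "r \<in> carrier R" "s \<in> S" by (metis locE)
    then show "\<one>\<^bsub>L\<^esub> \<otimes>\<^bsub>L\<^esub> x = x"
      using S_closed by (simp add: mult_frac one_loc S_one)
  qed
  fix x y z assume "x \<in> carrier L" "y \<in> carrier L" "z \<in> carrier L"
  then obtain r s r' s' r'' s'' where xy: "x = frac R S r s" "r \<in> carrier R" "s \<in> S" "y = frac R S r' s'" "r' \<in> carrier R" "s' \<in> S"
     "z = frac R S r'' s''" "r'' \<in> carrier R" "s'' \<in> S"
    by (metis locE)
  then have c: "s \<in> carrier R" "s' \<in> carrier R" "s'' \<in> carrier R" using S_closed by auto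
  have "((s \<otimes> s'') \<otimes> (s' \<otimes> s'')) \<otimes> ((s' \<otimes> r \<oplus> s \<otimes> r') \<otimes> r'') =
    ((s \<otimes> s') \<otimes> s'') \<otimes> ((s' \<otimes> s'') \<otimes> (r \<otimes> r'') \<oplus> (s \<otimes> s'') \<otimes> (r' \<otimes> r''))"
    using c xy(2,5,8) by algebra
  then have "frac R S ((s' \<otimes> r \<oplus> s \<otimes> r') \<otimes> r'') ((s \<otimes> s') \<otimes> s'') =
    frac R S ((s' \<otimes> s'') \<otimes> (r \<otimes> r'') \<oplus> (s \<otimes> s'') \<otimes> (r' \<otimes> r'')) ((s \<otimes> s'') \<otimes> (s' \<otimes> s''))"
    using xy(2,3,5,6,8,9) c by (intro frac_eqI) (auto intro!: S_mult)
  then show "(x \<oplus>\<^bsub>L\<^esub> y) \<otimes>\<^bsub>L\<^esub> z = x \<otimes>\<^bsub>L\<^esub> z \<oplus>\<^bsub>L\<^esub> y \<otimes>\<^bsub>L\<^esub> z"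
    unfolding xy(1,4,7) using xy(2,3,5,6,8,9) c by (simp add: mult_frac add_frac S_mult)
qed

lemma loc_map_hom: "loc_map R S \<in> ring_hom R L"
proof (rule ring_hom_memI)
  fix x y assume "x \<in> carrier R" "y \<in> carrier R"
  then show "loc_map R S x \<in> carrier L"
    "loc_map R S (x \<otimes> y) = loc_map R S x \<otimes>\<^bsub>L\<^esub> loc_map R S y"
    "loc_map R S (x \<oplus> y) = loc_map R S x \<oplus>\<^bsub>L\<^esub> loc_map R S y"
    by (simp_all add: loc_map_def mult_frac add_frac S_one frac_in_carrier)
qed (simp add: loc_map_def one_loc)

lemma loc_map_eq_zero_iff:
  assumes r: "r \<in> carrier R"
  shows "loc_map R S r = \<zero>\<^bsub>L\<^esub> \<longleftrightarrow> (\<exists>t\<in>S. t \<otimes> r = \<zero>)"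
proof -
  have "t \<otimes> (\<one> \<otimes> r \<ominus> \<one> \<otimes> \<zero>) = t \<otimes> r" if "t \<in> S" for t
    using r S_closed[OF that] by (simp add: a_minus_def)
  then show ?thesis
    unfolding loc_map_def zero_loc frac_eq_iff[OF r S_one zero_closed S_one] eqv_def by auto
qed

lemma loc_map_unit:
  assumes s: "s \<in> S" shows "loc_map R S s \<in> Units L"
proof -
  have sc: "s \<in> carrier R" using S_closed[OF s] .
  have c: "frac R S \<one> s \<in> carrier L" "frac R S s \<one> \<in> carrier L"
    using s sc S_one frac_in_carrier by auto
  have "frac R S \<one> s \<otimes>\<^bsub>L\<^esub> frac R S s \<one> = \<one>\<^bsub>L\<^esub>"
       "frac R S s \<one> \<otimes>\<^bsub>L\<^esub> frac R S \<one> s = \<one>\<^bsub>L\<^esub>"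
    using s sc S_one frac_eqI[of s s \<one> \<one>] by (simp_all add: mult_frac one_loc)
  then show ?thesis unfolding Units_def loc_map_def using c by blast
qed

lemma loc_fraction:
  assumes "c \<in> carrier L"
  shows "\<exists>r\<in>carrier R. \<exists>s\<in>S. c \<otimes>\<^bsub>L\<^esub> loc_map R S s = loc_map R S r"
proof -
  obtain r s where c: "c = frac R S r s" "r \<in> carrier R" "s \<in> S" using assms by (rule locE)
  have "c \<otimes>\<^bsub>L\<^esub> loc_map R S s = loc_map R S r"
    using c(2,3) S_closed[OF c(3)] S_one frac_eqI[of "r \<otimes> s" s r \<one>]
    by (simp add: c(1) loc_map_def mult_frac m_comm)
  then show ?thesis using c(2,3) by blast
qed

end

section \<open>Rings of fractions of a quotient\<close>

lemma (in cring) unit_cancel: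
  assumes "u \<in> Units R" "a \<in> carrier R" "ideal K R" "u \<otimes> a \<in> K" shows "a \<in> K"
proof -
  have u: "u \<in> carrier R" "inv u \<in> carrier R" "inv u \<otimes> u = \<one>" using assms(1) by auto
  have "inv u \<otimes> (u \<otimes> a) \<in> K" using ideal_mult[OF assms(3,4) u(2)] .
  moreover have "inv u \<otimes> (u \<otimes> a) = (inv u \<otimes> u) \<otimes> a" using u(1,2) assms(2) by (simp only: m_assoc)
  ultimately show ?thesis using u(3) assms(2) by simp
qed

text \<open>\<open>S\<close> is a ring of fractions of \<open>R/J\<close>.  The denominators are not given separately: they are all elements that become units.  With
this convention localizations, quotients and their composites are instances of one notion.\<close>

locale fraction_hom = ring_hom_cring R S h for R (structure) and S (structure) and h +
  fixes J
  assumes J: "ideal J R"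
    and hJ: "a \<in> J \<Longrightarrow> h a = \<zero>\<^bsub>S\<^esub>"
    and fraction: "c \<in> carrier S \<Longrightarrow> \<exists>r\<in>carrier R. \<exists>s\<in>carrier R. h s \<in> Units S \<and> c \<otimes>\<^bsub>S\<^esub> h s = h r"
    and kernel: "r \<in> carrier R \<Longrightarrow> h r = \<zero>\<^bsub>S\<^esub> \<Longrightarrow> \<exists>s\<in>carrier R. h s \<in> Units S \<and> s \<otimes> r \<in> J"
begin

lemma h_minus: "a \<in> carrier R \<Longrightarrow> b \<in> carrier R \<Longrightarrow> h (a \<ominus> b) = h a \<ominus>\<^bsub>S\<^esub> h b"
  by (simp add: a_minus_def)

lemma h_eqD:
  assumes "a \<in> carrier R" "b \<in> carrier R" "h a = h b"
  shows "\<exists>s\<in>carrier R. h s \<in> Units S \<and> s \<otimes> a \<ominus> s \<otimes> b \<in> J"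
proof -
  have "h (a \<ominus> b) = \<zero>\<^bsub>S\<^esub>" using assms by (simp add: h_minus S.r_neg a_minus_def)
  then obtain s where s: "s \<in> carrier R" "h s \<in> Units S" "s \<otimes> (a \<ominus> b) \<in> J" using kernel[of "a \<ominus> b"] assms by auto
  have "s \<otimes> (a \<ominus> b) = s \<otimes> a \<ominus> s \<otimes> b" using s(1) assms(1,2) by algebra
  then show ?thesis using s by auto
qed

definition contraction :: "'c set \<Rightarrow> 'a set" where
  "contraction K = {r \<in> carrier R. h r \<in> K}"

definition extension :: "'a set \<Rightarrow> 'c set" where
  "extension A = {c \<in> carrier S. \<exists>a\<in>A. \<exists>s\<in>carrier R. h s \<in> Units S \<and> c \<otimes>\<^bsub>S\<^esub> h s = h a}"

lemma contraction_ideal: "ideal K S \<Longrightarrow> ideal (contraction K) R"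
  unfolding contraction_def by (rule ring.ideal_vimage)

lemma J_contraction: "ideal K S \<Longrightarrow> J \<subseteq> contraction K"
  using R.ideal_subset[OF J] hJ S.ideal_zero by (auto simp: contraction_def)

lemma h_unit_mult: "s \<in> carrier R \<Longrightarrow> t \<in> carrier R \<Longrightarrow> h s \<in> Units S \<Longrightarrow> h t \<in> Units S \<Longrightarrow> h (s \<otimes> t) \<in> Units S"
  by simp

lemma extension_ideal:
  assumes A: "ideal A R" shows "ideal (extension A) S"
proof (rule S.idealI')
  show "extension A \<subseteq> carrier S" by (auto simp: extension_def)
  have "\<zero> \<in> A" "h \<one> \<in> Units S" using R.ideal_zero[OF A] by auto
  moreover have "\<zero>\<^bsub>S\<^esub> \<otimes>\<^bsub>S\<^esub> h \<one> = h \<zero>" by simp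
  ultimately show "\<zero>\<^bsub>S\<^esub> \<in> extension A" unfolding extension_def by blast
next
  fix a b assume "a \<in> extension A" "b \<in> extension A"
  then obtain x s y t where x: "a \<in> carrier S" "x \<in> A" "s \<in> carrier R" "h s \<in> Units S" "a \<otimes>\<^bsub>S\<^esub> h s = h x"
    and y: "b \<in> carrier S" "y \<in> A" "t \<in> carrier R" "h t \<in> Units S" "b \<otimes>\<^bsub>S\<^esub> h t = h y"
    unfolding extension_def by blast
  have c: "x \<in> carrier R" "y \<in> carrier R" using x(2) y(2) R.ideal_subset[OF A] by auto
  have hc: "h s \<in> carrier S" "h t \<in> carrier S" "h x \<in> carrier S" "h y \<in> carrier S" using x y c by auto
  have "(a \<oplus>\<^bsub>S\<^esub> b) \<otimes>\<^bsub>S\<^esub> h (s \<otimes> t) = h t \<otimes>\<^bsub>S\<^esub> (a \<otimes>\<^bsub>S\<^esub> h s) \<oplus>\<^bsub>S\<^esub> h s \<otimes>\<^bsub>S\<^esub> (b \<otimes>\<^bsub>S\<^esub> h t)"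
    unfolding hom_mult[OF x(3) y(3)] using hc(1,2) x(1) y(1) by algebra
  also have "\<dots> = h (t \<otimes> x \<oplus> s \<otimes> y)" unfolding x(5) y(5) using c x(3) y(3) by simp
  finally have "(a \<oplus>\<^bsub>S\<^esub> b) \<otimes>\<^bsub>S\<^esub> h (s \<otimes> t) = h (t \<otimes> x \<oplus> s \<otimes> y)" .
  moreover have "t \<otimes> x \<oplus> s \<otimes> y \<in> A"
    using R.ideal_add[OF A R.ideal_mult[OF A x(2) y(3)] R.ideal_mult[OF A y(2) x(3)]] .
  ultimately show "a \<oplus>\<^bsub>S\<^esub> b \<in> extension A"
    unfolding extension_def using x(1,3) y(1,3) h_unit_mult[OF x(3) y(3) x(4) y(4)] by blast
next
  fix a b assume "a \<in> extension A" and b: "b \<in> carrier S"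
  then obtain x s where x: "a \<in> carrier S" "x \<in> A" "s \<in> carrier R" "h s \<in> Units S" "a \<otimes>\<^bsub>S\<^esub> h s = h x"
    unfolding extension_def by blast
  obtain y t where y: "y \<in> carrier R" "t \<in> carrier R" "h t \<in> Units S" "b \<otimes>\<^bsub>S\<^esub> h t = h y"
    using fraction[OF b] by blast
  have xc: "x \<in> carrier R" using x(2) R.ideal_subset[OF A] by auto
  have hc: "h s \<in> carrier S" "h t \<in> carrier S" using x y by auto
  have "(b \<otimes>\<^bsub>S\<^esub> a) \<otimes>\<^bsub>S\<^esub> h (s \<otimes> t) = (b \<otimes>\<^bsub>S\<^esub> h t) \<otimes>\<^bsub>S\<^esub> (a \<otimes>\<^bsub>S\<^esub> h s)"
    unfolding hom_mult[OF x(3) y(2)] using hc x(1) b by algebra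
  also have "\<dots> = h (y \<otimes> x)" unfolding x(5) y(4) using xc y(1) by simp
  finally have "(b \<otimes>\<^bsub>S\<^esub> a) \<otimes>\<^bsub>S\<^esub> h (s \<otimes> t) = h (y \<otimes> x)" .
  then show "b \<otimes>\<^bsub>S\<^esub> a \<in> extension A"
    unfolding extension_def using x(1,3) y(2) b h_unit_mult[OF x(3) y(2) x(4) y(3)] R.ideal_mult[OF A x(2) y(1)] by blast
qed

lemma h_in_extension:
  assumes "A \<subseteq> carrier R" "a \<in> A" shows "h a \<in> extension A"
proof -
  have a: "a \<in> carrier R" using assms by blast
  then have "h a \<otimes>\<^bsub>S\<^esub> h \<one> = h a" "h \<one> \<in> Units S" by simp_all
  then show ?thesis unfolding extension_def using a assms(2) R.one_closed hom_closed[OF a] by blast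
qed

text \<open>The contraction of the extension of \<open>A\<close> is the saturation of \<open>A\<close>.\<close>

lemma in_extension_iff:
  assumes A: "ideal A R" "J \<subseteq> A" and r: "r \<in> carrier R"
  shows "h r \<in> extension A \<longleftrightarrow> (\<exists>s\<in>carrier R. h s \<in> Units S \<and> s \<otimes> r \<in> A)"
proof
  assume "h r \<in> extension A"
  then obtain a s where a: "a \<in> A" "s \<in> carrier R" "h s \<in> Units S" "h r \<otimes>\<^bsub>S\<^esub> h s = h a" unfolding extension_def by blast
  have ac: "a \<in> carrier R" using a(1) R.ideal_subset[OF A(1)] by auto
  have "h (r \<otimes> s) = h a" using a r by simp
  then obtain t where t: "t \<in> carrier R" "h t \<in> Units S" "t \<otimes> (r \<otimes> s) \<ominus> t \<otimes> a \<in> J"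
    using h_eqD[of "r \<otimes> s" a] r a(2) ac by auto
  have "(t \<otimes> s) \<otimes> r = (t \<otimes> (r \<otimes> s) \<ominus> t \<otimes> a) \<oplus> t \<otimes> a" using t(1) a(2) ac r by algebra
  also have "\<dots> \<in> A" using R.ideal_add[OF A(1)] R.ideal_mult[OF A(1) a(1) t(1)] t(3) A(2) by blast
  finally show "\<exists>s\<in>carrier R. h s \<in> Units S \<and> s \<otimes> r \<in> A"
    using h_unit_mult[OF t(1) a(2) t(2) a(3)] t(1) a(2) by blast
next
  assume "\<exists>s\<in>carrier R. h s \<in> Units S \<and> s \<otimes> r \<in> A"
  then obtain s where s: "s \<in> carrier R" "h s \<in> Units S" "s \<otimes> r \<in> A" by blast
  have "h r \<otimes>\<^bsub>S\<^esub> h s = h (s \<otimes> r)" using s(1) r by (simp add: S.m_comm)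
  then show "h r \<in> extension A" unfolding extension_def using s r by blast
qed

lemma ideal_determined:
  assumes K: "ideal K S" shows "K = extension (contraction K)"
proof (rule subset_antisym; rule subsetI)
  fix c assume c: "c \<in> K"
  then have cc: "c \<in> carrier S" using S.ideal_subset[OF K] by auto
  obtain r s where r: "r \<in> carrier R" "s \<in> carrier R" "h s \<in> Units S" "c \<otimes>\<^bsub>S\<^esub> h s = h r" using fraction[OF cc] by blast
  have "h s \<otimes>\<^bsub>S\<^esub> c \<in> K" using S.ideal_mult[OF K c] r(2) by simp
  then have "h r \<in> K" unfolding r(4)[symmetric] using S.m_comm[OF cc, of "h s"] r(2) by simp
  then show "c \<in> extension (contraction K)" unfolding extension_def contraction_def using r cc by blast
next
  fix c assume "c \<in> extension (contraction K)"
  then obtain r s where r: "c \<in> carrier S" "h r \<in> K" "s \<in> carrier R" "h s \<in> Units S" "c \<otimes>\<^bsub>S\<^esub> h s = h r"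
    unfolding extension_def contraction_def by blast
  have "h s \<otimes>\<^bsub>S\<^esub> c \<in> K" using r(2) unfolding r(5)[symmetric] using S.m_comm[OF r(1), of "h s"] r(3) by simp
  then show "c \<in> K" using S.unit_cancel[OF r(4,1) K] by blast
qed

text \<open>Calculations with generators in \<open>S\<close> are reduced to ideals of \<open>R\<close> by this identity.\<close>

lemma genideal_image:
  assumes B: "B \<subseteq> carrier R"
  shows "genideal S (h ` B) = extension (genideal R (J \<union> B))"
proof
  have JB: "J \<union> B \<subseteq> carrier R" using B R.ideal_subset[OF J] by blast
  have hB: "h ` B \<subseteq> carrier S" using B by auto
  have G: "ideal (genideal R (J \<union> B)) R" and H: "ideal (genideal S (h ` B)) S"
    using R.genideal_ideal[OF JB] S.genideal_ideal[OF hB] .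
  show "genideal S (h ` B) \<subseteq> extension (genideal R (J \<union> B))"
    using R.genideal_self[OF JB] h_in_extension[OF R.ideal_subset[OF G]]
    by (intro S.genideal_minimal extension_ideal G) auto
  have "B \<subseteq> contraction (genideal S (h ` B))"
    using S.genideal_self[OF hB] B unfolding contraction_def by auto
  then have "genideal R (J \<union> B) \<subseteq> contraction (genideal S (h ` B))"
    using J_contraction[OF H] by (intro R.genideal_minimal contraction_ideal[OF H]) auto
  then have "extension (genideal R (J \<union> B)) \<subseteq> extension (contraction (genideal S (h ` B)))"
    unfolding extension_def by blast
  then show "extension (genideal R (J \<union> B)) \<subseteq> genideal S (h ` B)"
    using ideal_determined[OF H] by simp
qed

lemma noetherian:
  assumes "noetherian_ring R" shows "noetherian_ring S"
proof (rule S.noetherian_ringI)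
  fix K assume K: "ideal K S"
  obtain B where B: "B \<subseteq> carrier R" "finite B" "contraction K = genideal R B"
    using noetherian_ring.finetely_gen[OF assms contraction_ideal[OF K]] by blast
  have JB: "J \<union> B \<subseteq> carrier R" using B(1) R.ideal_subset[OF J] by blast
  have "B \<subseteq> contraction K" using B R.genideal_self by auto
  then have "genideal R (J \<union> B) = contraction K"
    using B J_contraction[OF K] R.genideal_self[OF JB]
    by (intro subset_antisym R.genideal_minimal contraction_ideal[OF K]) 
       (auto intro: R.genideal_minimal[OF R.genideal_ideal[OF JB], THEN subsetD])
  then have "K = genideal S (h ` B)" using genideal_image[OF B(1)] ideal_determined[OF K] by simp
  then show "\<exists>A\<subseteq>carrier S. finite A \<and> K = genideal S A"
    using B by (intro exI[of _ "h ` B"]) auto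
qed

lemma contraction_prime:
  assumes Q: "primeideal Q S" shows "primeideal (contraction Q) R"
proof (rule R.primeidealI'[OF contraction_ideal[OF S.prime_ideal[OF Q]]])
  show "\<one> \<notin> contraction Q" using S.prime_one[OF Q] by (simp add: contraction_def)
  fix a b assume "a \<in> carrier R" "b \<in> carrier R" "a \<otimes> b \<in> contraction Q" "a \<notin> contraction Q"
  then show "b \<in> contraction Q" using S.prime_mem[OF Q, of "h a" "h b"] by (auto simp: contraction_def)
qed

lemma contraction_strict_mono:
  assumes "ideal K S" "ideal L S" "K \<subset> L" shows "contraction K \<subset> contraction L"
proof -
  have "contraction K \<subseteq> contraction L" using assms(3) by (auto simp: contraction_def)
  moreover have "contraction K \<noteq> contraction L" using assms ideal_determined by (metis psubset_eq)
  ultimately show ?thesis by blast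
qed

lemma contraction_extension_prime:
  assumes p: "primeideal p R" "J \<subseteq> p" "\<And>s. s \<in> p \<Longrightarrow> h s \<notin> Units S"
  shows "contraction (extension p) = p"
proof -
  have i: "ideal p R" using R.prime_ideal[OF p(1)] .
  have "r \<in> p" if r: "r \<in> carrier R" "h r \<in> extension p" for r
    using r in_extension_iff[OF i p(2) r(1)] p(3) R.prime_mem[OF p(1)] by blast
  then show ?thesis using h_in_extension R.ideal_subset[OF i] by (auto simp: contraction_def)
qed

lemma extension_prime:
  assumes p: "primeideal p R" "J \<subseteq> p" "\<And>s. s \<in> p \<Longrightarrow> h s \<notin> Units S"
  shows "primeideal (extension p) S"
proof (rule S.primeidealI'[OF extension_ideal[OF R.prime_ideal[OF p(1)]]])
  have ce: "contraction (extension p) = p" using contraction_extension_prime[OF p] .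
  show "\<one>\<^bsub>S\<^esub> \<notin> extension p"
  proof
    assume "\<one>\<^bsub>S\<^esub> \<in> extension p"
    then have "\<one> \<in> contraction (extension p)" by (simp add: contraction_def)
    then show False using ce R.prime_one[OF p(1)] by simp
  qed
  fix a b assume ab: "a \<in> carrier S" "b \<in> carrier S" "a \<otimes>\<^bsub>S\<^esub> b \<in> extension p" "a \<notin> extension p"
  have I: "ideal (extension p) S" using extension_ideal[OF R.prime_ideal[OF p(1)]] .
  obtain x s where x: "x \<in> carrier R" "s \<in> carrier R" "h s \<in> Units S" "a \<otimes>\<^bsub>S\<^esub> h s = h x" using fraction[OF ab(1)] by blast
  obtain y t where y: "y \<in> carrier R" "t \<in> carrier R" "h t \<in> Units S" "b \<otimes>\<^bsub>S\<^esub> h t = h y" using fraction[OF ab(2)] by blast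
  have hc: "h s \<in> carrier S" "h t \<in> carrier S" using x y by auto
  have "h (x \<otimes> y) = (h s \<otimes>\<^bsub>S\<^esub> h t) \<otimes>\<^bsub>S\<^esub> (a \<otimes>\<^bsub>S\<^esub> b)"
    unfolding hom_mult[OF x(1) y(1)] x(4)[symmetric] y(4)[symmetric] using hc ab(1,2) by algebra
  then have "h (x \<otimes> y) \<in> extension p" using S.ideal_mult[OF I ab(3)] hc by simp
  then have "x \<otimes> y \<in> p" using ce x(1) y(1) unfolding contraction_def by blast
  moreover have "x \<notin> p" using ab(1,4) x unfolding extension_def by blast
  ultimately have "y \<in> p" using R.prime_mem[OF p(1) _ x(1) y(1)] by blast
  then show "b \<in> extension p" using ab(2) y unfolding extension_def by blast
qed

end

lemma (in mult_set) fraction_hom_localization: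
  "fraction_hom R L (loc_map R S) {\<zero>}"
proof -
  interpret L: cring L by (rule localization_cring)
  interpret ring_hom_cring R L "loc_map R S" by unfold_locales (rule loc_map_hom)
  show ?thesis
  proof (intro fraction_hom.intro fraction_hom_axioms.intro ring_hom_cring_axioms)
    show "ideal {\<zero>} R" by (rule zeroideal)
    show "loc_map R S a = \<zero>\<^bsub>L\<^esub>" if "a \<in> {\<zero>}" for a using that by simp
  next
    fix c assume "c \<in> carrier L"
    then obtain r s where "r \<in> carrier R" "s \<in> S" "c \<otimes>\<^bsub>L\<^esub> loc_map R S s = loc_map R S r"
      using loc_fraction by blast
    then show "\<exists>r\<in>carrier R. \<exists>s\<in>carrier R. loc_map R S s \<in> Units L \<and>
        c \<otimes>\<^bsub>L\<^esub> loc_map R S s = loc_map R S r"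
      using loc_map_unit S_closed by metis
  next
    fix r assume "r \<in> carrier R" "loc_map R S r = \<zero>\<^bsub>L\<^esub>"
    then obtain t where "t \<in> S" "t \<otimes> r = \<zero>" using loc_map_eq_zero_iff by metis
    then show "\<exists>s\<in>carrier R. loc_map R S s \<in> Units L \<and> s \<otimes> r \<in> {\<zero>}"
      using loc_map_unit S_closed by (metis singletonI)
  qed
qed

lemma (in cring) fraction_hom_quotient:
  assumes "ideal K R" shows "fraction_hom R (R Quot K) ((+>) K) K"
proof -
  have coset_eq: "K +> a = K" if "a \<in> K" for a using a_rcos_zero[OF assms that] .
  have quot_zero: "\<zero>\<^bsub>R Quot K\<^esub> = K" and quot_one: "\<one>\<^bsub>R Quot K\<^esub> = K +> \<one>"
    by (simp_all add: FactRing_def)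
  have quotE: "\<exists>r\<in>carrier R. c = K +> r" if "c \<in> carrier (R Quot K)" for c
    using that by (auto simp: FactRing_def A_RCOSETS_def')
  have rcos: "ring_hom_cring R (R Quot K) ((+>) K)"
    by (rule ideal.rcos_ring_hom_cring[OF assms is_cring])
  have memK: "r \<in> K" if "r \<in> carrier R" "K +> r = K" for r
    using ideal.rcos_const_imp_mem[OF assms that] .
  interpret Q: cring "R Quot K" using rcos by (rule ring_hom_cring.axioms)
  have unit: "K +> \<one> \<in> Units (R Quot K)" using Q.Units_one_closed unfolding quot_one .
  show ?thesis
  proof (intro fraction_hom.intro fraction_hom_axioms.intro rcos assms)
    show "K +> a = \<zero>\<^bsub>R Quot K\<^esub>" if "a \<in> K" for a unfolding quot_zero using coset_eq[OF that] .
  next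
    fix c assume c: "c \<in> carrier (R Quot K)"
    obtain r where "r \<in> carrier R" "c = K +> r" using quotE[OF c] by blast
    moreover have "c \<otimes>\<^bsub>R Quot K\<^esub> (K +> \<one>) = c" using Q.r_one[OF c] unfolding quot_one .
    ultimately show "\<exists>r\<in>carrier R. \<exists>s\<in>carrier R. K +> s \<in> Units (R Quot K) \<and> c \<otimes>\<^bsub>R Quot K\<^esub> (K +> s) = K +> r"
      using unit one_closed by metis
  next
    fix r assume r: "r \<in> carrier R" "K +> r = \<zero>\<^bsub>R Quot K\<^esub>"
    then have "\<one> \<otimes> r \<in> K" using memK[OF r(1)] unfolding quot_zero by simp
    then show "\<exists>s\<in>carrier R. K +> s \<in> Units (R Quot K) \<and> s \<otimes> r \<in> K" using unit one_closed by blast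
  qed
qed

lemma ring_hom_unit:
  assumes "ring_hom_cring A B \<psi>" "u \<in> Units A" shows "\<psi> u \<in> Units B"
proof -
  interpret ring_hom_cring A B \<psi> by fact
  have u: "u \<in> carrier A" "inv\<^bsub>A\<^esub> u \<in> carrier A" using assms(2) by auto
  have "\<psi> u \<otimes>\<^bsub>B\<^esub> \<psi> (inv\<^bsub>A\<^esub> u) = \<one>\<^bsub>B\<^esub>" "\<psi> (inv\<^bsub>A\<^esub> u) \<otimes>\<^bsub>B\<^esub> \<psi> u = \<one>\<^bsub>B\<^esub>"
    using hom_mult[OF u] hom_mult[OF u(2,1)] assms(2) by simp_all
  then show ?thesis unfolding Units_def using u by blast
qed

text \<open>The hypothesis on \<open>K\<close> covers a quotient by the extension of \<open>J\<close> as well as a further localization, where \<open>K\<close> is zero.\<close>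

lemma fraction_hom_compose:
  assumes f: "fraction_hom R C \<phi> J0" and g: "fraction_hom C D \<psi> K"
    and J: "ideal J R" "J0 \<subseteq> J" and K: "K = genideal C (\<phi> ` J)"
  shows "fraction_hom R D (\<psi> \<circ> \<phi>) J"
proof -
  interpret f: fraction_hom R C \<phi> J0 by fact
  interpret g: fraction_hom C D \<psi> K by fact
  have Jc: "J \<subseteq> carrier R" using f.R.ideal_subset[OF J(1)] .
  have KJ: "K = f.extension J"
  proof -
    have "J0 \<union> J = J" using J(2) by blast
    moreover have "genideal R J = J"
      using f.R.genideal_minimal[OF J(1) subset_refl] f.R.genideal_self[OF Jc] by blast
    ultimately show ?thesis unfolding K using f.genideal_image[OF Jc] by simp
  qed
  interpret h: ring_hom_cring R D "\<psi> \<circ> \<phi>"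
    by unfold_locales (rule ring_hom_trans[OF f.homh g.homh])
  have unit: "\<psi> (\<phi> s) \<in> Units D" if "\<phi> s \<in> Units C" for s
    using ring_hom_unit[OF g.ring_hom_cring_axioms that] .
  show ?thesis
  proof (intro fraction_hom.intro fraction_hom_axioms.intro h.ring_hom_cring_axioms)
    show "ideal J R" by fact
    show "(\<psi> \<circ> \<phi>) a = \<zero>\<^bsub>D\<^esub>" if "a \<in> J" for a
      using g.hJ f.h_in_extension[OF Jc that] KJ by simp
  next
    fix d assume "d \<in> carrier D"
    then obtain x y where xy: "x \<in> carrier C" "y \<in> carrier C" "\<psi> y \<in> Units D" "d \<otimes>\<^bsub>D\<^esub> \<psi> y = \<psi> x" and d: "d \<in> carrier D"
      using g.fraction by blast
    obtain r s where r: "r \<in> carrier R" "s \<in> carrier R" "\<phi> s \<in> Units C" "x \<otimes>\<^bsub>C\<^esub> \<phi> s = \<phi> r" using f.fraction[OF xy(1)] by blast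
    obtain r' s' where r': "r' \<in> carrier R" "s' \<in> carrier R" "\<phi> s' \<in> Units C" "y \<otimes>\<^bsub>C\<^esub> \<phi> s' = \<phi> r'" using f.fraction[OF xy(2)] by blast
    have c: "\<psi> x \<in> carrier D" "\<psi> y \<in> carrier D" "\<psi> (\<phi> s) \<in> carrier D" "\<psi> (\<phi> s') \<in> carrier D" using xy r r' by auto
    have 1: "\<psi> (\<phi> r) = \<psi> x \<otimes>\<^bsub>D\<^esub> \<psi> (\<phi> s)" using r(2) xy(1) unfolding r(4)[symmetric] by simp
    have 2: "\<psi> (\<phi> r') = \<psi> y \<otimes>\<^bsub>D\<^esub> \<psi> (\<phi> s')" using r'(2) xy(2) unfolding r'(4)[symmetric] by simp
    have "\<psi> (\<phi> (r' \<otimes>\<^bsub>R\<^esub> s)) = (\<psi> y \<otimes>\<^bsub>D\<^esub> \<psi> (\<phi> s')) \<otimes>\<^bsub>D\<^esub> \<psi> (\<phi> s)" using 2 r(2) r'(1) by simp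
    moreover have "\<dots> \<in> Units D" using unit[OF r(3)] unit[OF r'(3)] xy(3) by simp
    moreover have "d \<otimes>\<^bsub>D\<^esub> ((\<psi> y \<otimes>\<^bsub>D\<^esub> \<psi> (\<phi> s')) \<otimes>\<^bsub>D\<^esub> \<psi> (\<phi> s)) = (d \<otimes>\<^bsub>D\<^esub> \<psi> y) \<otimes>\<^bsub>D\<^esub> \<psi> (\<phi> s) \<otimes>\<^bsub>D\<^esub> \<psi> (\<phi> s')"
      using c d by (simp add: g.S.m_ac)
    moreover have "\<dots> = \<psi> (\<phi> (r \<otimes>\<^bsub>R\<^esub> s'))" unfolding xy(4) using 1 r(1) r'(2) by simp
    ultimately show "\<exists>r\<in>carrier R. \<exists>s\<in>carrier R. (\<psi> \<circ> \<phi>) s \<in> Units D \<and> d \<otimes>\<^bsub>D\<^esub> (\<psi> \<circ> \<phi>) s = (\<psi> \<circ> \<phi>) r"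
      using r(1,2) r'(1,2) by (intro bexI[of _ "r \<otimes>\<^bsub>R\<^esub> s'"] bexI[of _ "r' \<otimes>\<^bsub>R\<^esub> s"]) auto
  next
    fix r assume r: "r \<in> carrier R" "(\<psi> \<circ> \<phi>) r = \<zero>\<^bsub>D\<^esub>"
    then obtain x where x: "x \<in> carrier C" "\<psi> x \<in> Units D" "x \<otimes>\<^bsub>C\<^esub> \<phi> r \<in> K" using g.kernel[of "\<phi> r"] by auto
    obtain y s where y: "y \<in> carrier R" "s \<in> carrier R" "\<phi> s \<in> Units C" "x \<otimes>\<^bsub>C\<^esub> \<phi> s = \<phi> y" using f.fraction[OF x(1)] by blast
    have "\<phi> (y \<otimes>\<^bsub>R\<^esub> r) = \<phi> s \<otimes>\<^bsub>C\<^esub> (x \<otimes>\<^bsub>C\<^esub> \<phi> r)"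
      unfolding f.hom_mult[OF y(1) r(1)] y(4)[symmetric] using x(1) y(2) r(1) by (simp add: f.S.m_ac)
    also have "\<dots> \<in> K" using f.S.ideal_mult[OF g.J x(3)] y(2) by simp
    finally obtain u where u: "u \<in> carrier R" "\<phi> u \<in> Units C" "u \<otimes>\<^bsub>R\<^esub> (y \<otimes>\<^bsub>R\<^esub> r) \<in> J"
      unfolding KJ using f.in_extension_iff[OF J, of "y \<otimes>\<^bsub>R\<^esub> r"] y(1) r(1) by auto
    have "\<psi> (\<phi> y) = \<psi> x \<otimes>\<^bsub>D\<^esub> \<psi> (\<phi> s)" unfolding y(4)[symmetric] using x(1) y(2) by simp
    then have "\<psi> (\<phi> y) \<in> Units D" using x(2) unit[OF y(3)] by simp
    then have "\<psi> (\<phi> (u \<otimes>\<^bsub>R\<^esub> y)) \<in> Units D" using unit[OF u(2)] u(1) y(1) by simp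
    moreover have "(u \<otimes>\<^bsub>R\<^esub> y) \<otimes>\<^bsub>R\<^esub> r \<in> J" using u y(1) r(1) by (simp add: f.R.m_assoc)
    ultimately show "\<exists>s\<in>carrier R. (\<psi> \<circ> \<phi>) s \<in> Units D \<and> s \<otimes>\<^bsub>R\<^esub> r \<in> J"
      using f.R.m_closed[OF u(1) y(1)] by (metis comp_apply)
  qed
qed

section \<open>Local rings of fractions\<close>

lemma (in cring) adjoins_genideal:
  fixes A assumes "A \<subseteq> carrier R" "set xs \<subseteq> carrier R"
  shows "foldl adjoin (genideal R A) xs = genideal R (A \<union> set xs)"
  using assms
proof (induction xs arbitrary: A)
  case (Cons x xs)
  then show ?case using Cons.IH[of "insert x A"] by (simp add: adjoin_eq_genideal)
qed simp

lemma (in cring) genideal_of_ideal: "ideal J R \<Longrightarrow> genideal R J = J"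
  by (simp add: genideal_minimal genideal_self ideal_subset subset_antisym)

context noeth_cring begin

lemma adjoins_eq_genideal: "ideal J R \<Longrightarrow> set xs \<subseteq> carrier R \<Longrightarrow> adjoins J xs = genideal R (J \<union> set xs)"
  using adjoins_genideal[of J xs] by (simp add: adjoins_def genideal_of_ideal ideal_subset)

lemma weakly_regular_nth:
  "weakly_regular q J xs \<Longrightarrow> i < length xs \<Longrightarrow> a \<in> carrier R \<Longrightarrow> xs ! i \<otimes> a \<in> sat q (adjoins J (take i xs)) \<Longrightarrow>
    a \<in> sat q (adjoins J (take i xs))"
proof (induction xs arbitrary: J i)
  case (Cons x xs)
  then show ?case by (cases i) auto
qed simp

lemma chain_le_krull_dim: "prime_chain R n c \<Longrightarrow> enat n \<le> krull_dim R"
  unfolding krull_dim_def by (rule Sup_upper) blast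

lemma depth_le_krull_dim:
  assumes "primeideal (max_ideal R) R" shows "depth R \<le> krull_dim R"
  unfolding depth_def
proof (rule Sup_least)
  fix z assume "z \<in> {enat (length xs) |xs. set xs \<subseteq> max_ideal R \<and> regular_sequence R xs}"
  then obtain xs where z: "z = enat (length xs)" "set xs \<subseteq> max_ideal R" "regular_sequence R xs" by blast
  have reg: "\<And>i a. i < length xs \<Longrightarrow> a \<in> carrier R \<Longrightarrow>
      xs ! i \<otimes> a \<in> genideal R (set (take i xs)) \<Longrightarrow> a \<in> genideal R (set (take i xs))"
    using z(3) unfolding regular_sequence_def by blast
  show "z \<le> krull_dim R"
    unfolding z(1) using regular_sequence_chain[OF z(2) assms reg] chain_le_krull_dim by blast
qed

end

text \<open>A finite Krull dimension is the length of an actual chain.\<close>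

lemma Sup_enat_attained:
  assumes "Sup (A :: enat set) = enat d" "A \<noteq> {}" shows "enat d \<in> A"
proof (rule ccontr)
  assume n: "enat d \<notin> A"
  have lt: "x < enat d" if "x \<in> A" for x
    using Sup_upper[OF that] assms(1) n that by (metis order_le_imp_less_or_eq)
  obtain x where "x \<in> A" using assms(2) by blast
  then obtain k where d: "d = Suc k" using lt[of x] by (cases d) (auto simp: zero_enat_def[symmetric])
  have "Sup A \<le> enat k"
    using lt by (intro Sup_least) (metis d eSuc_enat ileI1 eSuc_ile_mono)
  then show False using assms(1) d by simp
qed

text \<open>The ring \<open>S\<close> is \<open>(R/J)\<^sub>q\<close>: the denominators are exactly the elements outside \<open>q\<close>.\<close>

locale local_fraction_hom = fraction_hom R S h J for R (structure) and S (structure) and h J +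
  fixes q
  assumes q: "primeideal q R"
    and unit_iff: "r \<in> carrier R \<Longrightarrow> h r \<in> Units S \<longleftrightarrow> r \<notin> q"
begin

lemma q_nonunit: "s \<in> q \<Longrightarrow> h s \<notin> Units S"
  using unit_iff R.ideal_subset[OF R.prime_ideal[OF q]] by blast

lemma J_q: "J \<subseteq> q"
proof
  fix a assume a: "a \<in> J"
  then have "a \<in> carrier R" using R.ideal_subset[OF J] by blast
  moreover have "h \<zero> \<notin> Units S" using q_nonunit R.ideal_zero[OF R.prime_ideal[OF q]] by blast
  ultimately show "a \<in> q" using unit_iff[of a] hJ[OF a] by simp
qed

lemma extension_q_prime: "primeideal (extension q) S"
  using extension_prime[OF q J_q q_nonunit] .

lemma extension_q_eq: "extension q = {c \<in> carrier S. c \<notin> Units S}"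
proof (rule subset_antisym; rule subsetI)
  fix c assume "c \<in> extension q"
  then obtain a s where a: "c \<in> carrier S" "a \<in> q" "s \<in> carrier R" "h s \<in> Units S" "c \<otimes>\<^bsub>S\<^esub> h s = h a"
    unfolding extension_def by blast
  have "c \<notin> Units S"
  proof
    assume "c \<in> Units S"
    then have "h a \<in> Units S" unfolding a(5)[symmetric] using a(4) by simp
    then show False using q_nonunit a(2) by blast
  qed
  then show "c \<in> {c \<in> carrier S. c \<notin> Units S}" using a(1) by blast
next
  fix c assume c: "c \<in> {c \<in> carrier S. c \<notin> Units S}"
  then obtain r s where r: "r \<in> carrier R" "s \<in> carrier R" "h s \<in> Units S" "c \<otimes>\<^bsub>S\<^esub> h s = h r"
    using fraction[of c] by blast
  have "r \<in> q"
  proof (rule ccontr)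
    assume "r \<notin> q"
    then have "c \<otimes>\<^bsub>S\<^esub> h s \<in> Units S" using unit_iff[OF r(1)] r(4) by simp
    then have "c \<in> Units S" using S.unit_factor[of c "h s"] c r(2) by simp
    then show False using c by blast
  qed
  then show "c \<in> extension q" unfolding extension_def using r c by blast
qed

lemma proper_ideal_in_extension_q: "ideal K S \<Longrightarrow> \<one>\<^bsub>S\<^esub> \<notin> K \<Longrightarrow> K \<subseteq> extension q"
proof
  fix c assume K: "ideal K S" "\<one>\<^bsub>S\<^esub> \<notin> K" "c \<in> K"
  then have c: "c \<in> carrier S" using S.ideal_subset by blast
  have "c \<notin> Units S" using S.unit_cancel[of c "\<one>\<^bsub>S\<^esub>" K] K c by auto
  then show "c \<in> extension q" unfolding extension_q_eq using c by blast
qed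

lemma maximal_unique: "maximalideal M S \<longleftrightarrow> M = extension q"
proof
  have one: "\<one>\<^bsub>S\<^esub> \<notin> extension q" by (simp add: extension_q_eq)
  have I: "ideal (extension q) S" using S.prime_ideal[OF extension_q_prime] .
  show "M = extension q" if M: "maximalideal M S"
  proof -
    have Mi: "ideal M S" using maximalideal.axioms(1)[OF M] .
    have "\<one>\<^bsub>S\<^esub> \<notin> M" using maximalideal.I_notcarr[OF M] ideal.one_imp_carrier[OF Mi] by blast
    then have "M \<subseteq> extension q" using proper_ideal_in_extension_q[OF Mi] by blast
    then have "extension q = M \<or> extension q = carrier S"
      using maximalideal.I_maximal[OF M I] S.ideal_subset[OF I] by blast
    then show ?thesis using one by auto
  qed
  show "maximalideal M S" if M: "M = extension q"
    unfolding M
  proof (rule maximalidealI[OF I])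
    show "carrier S \<noteq> extension q" using one by auto
    fix K assume K: "ideal K S" "extension q \<subseteq> K" "K \<subseteq> carrier S"
    show "K = extension q \<or> K = carrier S"
      using proper_ideal_in_extension_q[OF K(1)] ideal.one_imp_carrier[OF K(1)] K(2) by blast
  qed
qed

lemma max_ideal_eq: "max_ideal S = extension q"
  unfolding max_ideal_def using maximal_unique by simp

lemma noetherian_local:
  assumes "noetherian_ring R" shows "noetherian_local S"
  unfolding noetherian_local_def noetherian_cring_def
  using noetherian[OF assms] maximal_unique S.is_cring by simp

lemma chain_contraction:
  assumes "prime_chain S n c"
  shows "prime_chain R n (\<lambda>i. contraction (c i)) \<and> J \<subseteq> contraction (c 0) \<and> contraction (c n) \<subseteq> q"
proof -
  have p: "primeideal (c i) S" if "i \<le> n" for i using assms that by (simp add: prime_chain_def spec_def)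
  have "contraction (c i) \<subset> contraction (c (Suc i))" if "i < n" for i
    using contraction_strict_mono[OF S.prime_ideal[OF p[of i]] S.prime_ideal[OF p[of "Suc i"]]] that assms
    by (simp add: prime_chain_def)
  then have "prime_chain R n (\<lambda>i. contraction (c i))"
    using contraction_prime[OF p] by (simp add: prime_chain_def spec_def)
  moreover have "contraction (c n) \<subseteq> contraction (extension q)"
    using proper_ideal_in_extension_q[OF S.prime_ideal[OF p[of n]]] S.prime_one[OF p[of n]] by (auto simp: contraction_def)
  ultimately show ?thesis
    using contraction_extension_prime[OF q J_q q_nonunit] J_contraction[OF S.prime_ideal[OF p[of 0]]] by simp
qed

end

locale noeth_local_fraction_hom = local_fraction_hom R S h J q + noeth_cring R
  for R (structure) and S (structure) and h J q
begin

lemma extension_sat: "ideal A R \<Longrightarrow> J \<subseteq> A \<Longrightarrow> r \<in> carrier R \<Longrightarrow> h r \<in> extension A \<longleftrightarrow> r \<in> R.sat q A"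
  using in_extension_iff unit_iff by (auto simp: R.sat_def)

lemma genideal_map: "set xs \<subseteq> carrier R \<Longrightarrow> genideal S (h ` set xs) = extension (adjoins J xs)"
  using genideal_image adjoins_eq_genideal[OF J] by simp

lemma adjoins_ideal: "set xs \<subseteq> carrier R \<Longrightarrow> ideal (adjoins J xs) R \<and> J \<subseteq> adjoins J xs"
  using adjoins_eq_genideal[OF J] R.genideal_ideal[of "J \<union> set xs"] R.genideal_self[of "J \<union> set xs"] R.ideal_subset[OF J]
  by auto

text \<open>Generators of the maximal ideal of \<open>S\<close> are unit multiples of images of elements of \<open>q\<close>, and a longest chain of primes of \<open>S\<close> contracts to \<open>R\<close>.\<close>

lemma regular_local_parameters:
  assumes "regular_local S"
  shows "\<exists>xs c. set xs \<subseteq> q \<and> q \<subseteq> R.sat q (adjoins J xs) \<and> prime_chain R (length xs) c \<and> J \<subseteq> c 0 \<and> c (length xs) \<subseteq> q"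
proof -
  obtain G where G: "G \<subseteq> carrier S" "finite G" "genideal S G = extension q" "enat (card G) = krull_dim S"
    using assms unfolding regular_local_def max_ideal_eq by blast
  have qc: "q \<subseteq> carrier R" using R.ideal_subset[OF R.prime_ideal[OF q]] .
  have "\<exists>a\<in>q. \<exists>s\<in>carrier R. h s \<in> Units S \<and> g \<otimes>\<^bsub>S\<^esub> h s = h a" if "g \<in> G" for g
    using S.genideal_self[OF G(1)] G(3) that unfolding extension_def by blast
  then obtain a where a: "\<And>g. g \<in> G \<Longrightarrow> a g \<in> q \<and> (\<exists>s\<in>carrier R. h s \<in> Units S \<and> g \<otimes>\<^bsub>S\<^esub> h s = h (a g))"
    by metis
  obtain gs where gs: "set gs = G" "distinct gs" using finite_distinct_list[OF G(2)] by blast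
  define xs where "xs = map a gs"
  have xq: "set xs \<subseteq> q" using a gs by (auto simp: xs_def)
  then have xc: "set xs \<subseteq> carrier R" using qc by blast
  have len: "length xs = card G" using distinct_card[OF gs(2)] gs(1) by (simp add: xs_def)
  have I: "ideal (genideal S (h ` set xs)) S" using xc by (intro S.genideal_ideal) auto
  have "G \<subseteq> genideal S (h ` set xs)"
  proof
    fix g assume g: "g \<in> G"
    then obtain s where s: "s \<in> carrier R" "h s \<in> Units S" "g \<otimes>\<^bsub>S\<^esub> h s = h (a g)" using a by blast
    have gc: "g \<in> carrier S" using g G(1) by blast
    have "h (a g) \<in> h ` set xs" using g gs by (auto simp: xs_def)
    moreover have "h ` set xs \<subseteq> genideal S (h ` set xs)" using xc by (intro S.genideal_self) auto
    ultimately have "h (a g) \<in> genideal S (h ` set xs)" by blast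
    then have "h s \<otimes>\<^bsub>S\<^esub> g \<in> genideal S (h ` set xs)"
      unfolding s(3)[symmetric] using S.m_comm[OF gc, of "h s"] s(1) by simp
    then show "g \<in> genideal S (h ` set xs)" using S.unit_cancel[OF s(2) gc I] by blast
  qed
  then have "extension q \<subseteq> extension (adjoins J xs)"
    using S.genideal_minimal[OF I, of G] unfolding G(3) genideal_map[OF xc] by blast
  then have "q \<subseteq> R.sat q (adjoins J xs)"
    using extension_sat adjoins_ideal[OF xc] h_in_extension[OF qc] qc by blast
  moreover have "\<exists>c. prime_chain S (length xs) c"
  proof -
    have "prime_chain S 0 (\<lambda>_. extension q)" using extension_q_prime by (simp add: prime_chain_def spec_def)
    then have "{enat n |n. \<exists>c. prime_chain S n c} \<noteq> {}" by blast
    then have "enat (card G) \<in> {enat n |n. \<exists>c. prime_chain S n c}"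
      using G(4) unfolding krull_dim_def by (intro Sup_enat_attained) simp
    then show ?thesis using len by auto
  qed
  ultimately show ?thesis using xq chain_contraction by blast
qed

text \<open>The image of \<open>xs\<close> is a regular sequence, so \<open>length xs \<le> depth S \<le> dim S\<close>, while the bound on chains gives \<open>dim S \<le> length xs\<close>.\<close>

lemma cohen_macaulay_criterion:
  assumes xq: "set xs \<subseteq> q" and w: "weakly_regular q J xs"
    and bound: "\<And>n c. prime_chain R n c \<Longrightarrow> J \<subseteq> c 0 \<Longrightarrow> c n \<subseteq> q \<Longrightarrow> n \<le> length xs"
  shows "cohen_macaulay_local S"
proof -
  interpret SN: noeth_cring S
    using noetherian[OF noetherian_ring_axioms] S.is_cring by (simp add: noeth_cring_def)
  have qc: "q \<subseteq> carrier R" using R.ideal_subset[OF R.prime_ideal[OF q]] .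
  have xc: "set xs \<subseteq> carrier R" using xq qc by blast
  define ys where "ys = map h xs"
  have gen: "genideal S (set (take i ys)) = extension (adjoins J (take i xs))" for i
    using genideal_map[of "take i xs"] xc set_take_subset[of i xs] by (auto simp: ys_def take_map)
  have reg: "a \<in> genideal S (set (take i ys))"
    if i: "i < length ys" and a: "a \<in> carrier S" "ys ! i \<otimes>\<^bsub>S\<^esub> a \<in> genideal S (set (take i ys))" for i a
  proof -
    let ?A = "adjoins J (take i xs)"
    have A: "ideal ?A R" "J \<subseteq> ?A" using adjoins_ideal[of "take i xs"] xc set_take_subset[of i xs] by blast+
    have il: "i < length xs" using i by (simp add: ys_def)
    have xi: "xs ! i \<in> carrier R" using il xc by auto
    obtain r s where r: "r \<in> carrier R" "s \<in> carrier R" "h s \<in> Units S" "a \<otimes>\<^bsub>S\<^esub> h s = h r" using fraction[OF a(1)] by blast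
    have "h (xs ! i \<otimes> r) = h s \<otimes>\<^bsub>S\<^esub> (ys ! i \<otimes>\<^bsub>S\<^esub> a)"
      unfolding hom_mult[OF xi r(1)] r(4)[symmetric] using il xi a(1) r(2) by (simp add: ys_def S.m_ac)
    also have "\<dots> \<in> extension ?A" using S.ideal_mult[OF extension_ideal[OF A(1)]] a(2) r(2) unfolding gen by simp
    finally have "xs ! i \<otimes> r \<in> R.sat q ?A" using extension_sat[OF A R.m_closed[OF xi r(1)]] by blast
    then have "r \<in> R.sat q ?A" using weakly_regular_nth[OF w il r(1)] by blast
    then have "a \<otimes>\<^bsub>S\<^esub> h s \<in> extension ?A" using extension_sat[OF A r(1)] r(4) by simp
    then have "h s \<otimes>\<^bsub>S\<^esub> a \<in> extension ?A" using S.m_comm[OF a(1), of "h s"] r(2) by simp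
    then show ?thesis unfolding gen using S.unit_cancel[OF r(3) a(1) extension_ideal[OF A(1)]] by blast
  qed
  have yq: "set ys \<subseteq> extension q" using h_in_extension[OF qc] xq by (auto simp: ys_def)
  have yc: "set ys \<subseteq> carrier S" using xc by (auto simp: ys_def)
  have "genideal S (set ys) \<subseteq> extension q" using S.genideal_minimal[OF S.prime_ideal[OF extension_q_prime] yq] .
  then have "genideal S (set ys) \<noteq> carrier S" using S.prime_one[OF extension_q_prime] by auto
  then have "regular_sequence S ys" unfolding regular_sequence_def using yc reg by blast
  then have "enat (length ys) \<le> depth S"
    unfolding depth_def max_ideal_eq using yq by (intro Sup_upper) blast
  moreover have "krull_dim S \<le> enat (length ys)"
    unfolding krull_dim_def
  proof (rule Sup_least)
    fix z assume "z \<in> {enat n |n. \<exists>c. prime_chain S n c}"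
    then obtain n c where z: "z = enat n" "prime_chain S n c" by blast
    have "n \<le> length xs" using chain_contraction[OF z(2)] bound by blast
    then show "z \<le> enat (length ys)" by (simp add: z(1) ys_def)
  qed
  moreover have "depth S \<le> krull_dim S" using SN.depth_le_krull_dim extension_q_prime max_ideal_eq by simp
  ultimately show ?thesis
    unfolding cohen_macaulay_local_def using noetherian_local[OF noetherian_ring_axioms] by auto
qed

end

lemma (in cring) mult_set_prime: "primeideal Q R \<Longrightarrow> mult_set R (carrier R - Q)"
  by unfold_locales (use prime_one prime_mult_notin in auto)

lemma (in cring) local_fraction_hom_loc_prime:
  assumes Q: "primeideal Q R"
  shows "local_fraction_hom R (loc_prime R Q) (loc_map R (carrier R - Q)) {\<zero>} Q"
proof -
  let ?h = "loc_map R (carrier R - Q)"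
  interpret M: mult_set R "carrier R - Q" using mult_set_prime[OF Q] .
  interpret F: fraction_hom R "loc_prime R Q" ?h "{\<zero>}"
    unfolding loc_prime_def by (rule M.fraction_hom_localization)
  have "r \<notin> Q" if r: "r \<in> carrier R" "?h r \<in> Units (loc_prime R Q)" for r
  proof
    assume rQ: "r \<in> Q"
    let ?i = "inv\<^bsub>loc_prime R Q\<^esub> ?h r"
    have i: "?i \<in> carrier (loc_prime R Q)" using r by simp
    then obtain a s where a: "a \<in> carrier R" "s \<in> carrier R - Q" "?i \<otimes>\<^bsub>loc_prime R Q\<^esub> ?h s = ?h a"
      using M.loc_fraction unfolding loc_prime_def by blast
    have sc: "s \<in> carrier R" using a(2) by simp
    have "?h (r \<otimes> a) = (?h r \<otimes>\<^bsub>loc_prime R Q\<^esub> ?i) \<otimes>\<^bsub>loc_prime R Q\<^esub> ?h s"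
      unfolding F.hom_mult[OF r(1) a(1)] a(3)[symmetric] using i r(1) sc by (simp add: F.S.m_assoc)
    then have "?h (r \<otimes> a) = ?h s" using r sc by simp
    then have "?h (r \<otimes> a \<ominus> s) = \<zero>\<^bsub>loc_prime R Q\<^esub>"
      using r(1) a(1) sc by (simp add: F.h_minus F.S.r_neg a_minus_def)
    then obtain t where t: "t \<in> carrier R - Q" "t \<otimes> (r \<otimes> a \<ominus> s) = \<zero>"
      using M.loc_map_eq_zero_iff[of "r \<otimes> a \<ominus> s"] r(1) a(1) sc unfolding loc_prime_def by auto
    have tc: "t \<in> carrier R" using t by simp
    have "t \<otimes> s = (t \<otimes> a) \<otimes> r \<ominus> t \<otimes> (r \<otimes> a \<ominus> s)" using tc sc r(1) a(1) by algebra
    then have "t \<otimes> s = (t \<otimes> a) \<otimes> r" unfolding t(2) using tc a(1) r(1) by (simp add: a_minus_def)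
    then have "t \<otimes> s \<in> Q" using ideal_mult[OF prime_ideal[OF Q] rQ, of "t \<otimes> a"] tc a(1) by simp
    then show False using prime_mult_notin[OF Q tc sc] t(1) a(2) by blast
  qed
  moreover have "?h r \<in> Units (loc_prime R Q)" if "r \<in> carrier R" "r \<notin> Q" for r
    using M.loc_map_unit[of r] that unfolding loc_prime_def by blast
  ultimately show ?thesis
    by (intro local_fraction_hom.intro local_fraction_hom_axioms.intro F.fraction_hom_axioms Q) blast
qed

lemma local_fraction_hom_at_prime:
  assumes f: "fraction_hom R C \<phi> J" and Q: "primeideal Q C"
  shows "local_fraction_hom R (loc_prime C Q) (loc_map C (carrier C - Q) \<circ> \<phi>) J (fraction_hom.contraction R \<phi> Q)"
proof -
  interpret f: fraction_hom R C \<phi> J by fact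
  interpret g: local_fraction_hom C "loc_prime C Q" "loc_map C (carrier C - Q)" "{\<zero>\<^bsub>C\<^esub>}" Q
    using f.S.local_fraction_hom_loc_prime[OF Q] .
  have "\<phi> ` J = {\<zero>\<^bsub>C\<^esub>}" using f.hJ f.R.ideal_zero[OF f.J] by force
  then have "{\<zero>\<^bsub>C\<^esub>} = genideal C (\<phi> ` J)" by (simp add: f.S.genideal_zero)
  then have "fraction_hom R (loc_prime C Q) (loc_map C (carrier C - Q) \<circ> \<phi>) J"
    using fraction_hom_compose[OF f g.fraction_hom_axioms f.J] by simp
  then show ?thesis
    using f.contraction_prime[OF Q] g.unit_iff
    by (intro local_fraction_hom.intro local_fraction_hom_axioms.intro) (auto simp: f.contraction_def)
qed

section \<open>Generic regularity and the main result\<close>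

context cring begin

lemma pow_mem_ipow:
  assumes "ideal J R" "x \<in> J" shows "x [^] n \<in> J [^]\<^bsub>ideals_set R\<^esub> (n::nat)"
proof (induction n)
  case 0
  then show ?case by (simp add: ideals_set_def nat_pow_def)
next
  case (Suc n)
  have "x [^] n \<otimes> x \<in> ideal_prod R (J [^]\<^bsub>ideals_set R\<^esub> n) J"
    using Suc assms(2) by (rule ideal_prod.prod)
  then show ?case by (simp add: ideals_set_def nat_pow_def)
qed

lemma mult_set_powers:
  assumes "f \<in> carrier R" shows "mult_set R (powers R f)"
proof unfold_locales
  show "s \<in> carrier R" if "s \<in> powers R f" for s using that assms by (auto simp: powers_def)
  have "f [^] (0::nat) \<in> powers R f" unfolding powers_def by blast
  then show "\<one> \<in> powers R f" by simp
  fix s t assume "s \<in> powers R f" "t \<in> powers R f"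
  then obtain n m :: nat where "s = f [^] n" "t = f [^] m" unfolding powers_def by blast
  then have "s \<otimes> t = f [^] (n + m)" using assms by (simp add: nat_pow_mult)
  then show "s \<otimes> t \<in> powers R f" unfolding powers_def by blast
qed

lemma fraction_hom_power_quotient:
  assumes f: "f \<in> carrier R" and J: "ideal J R"
  defines "Rf \<equiv> localization R (powers R f)"
  defines "K \<equiv> genideal Rf (loc_map R (powers R f) ` J)"
  shows "fraction_hom R (Rf Quot K) ((+>\<^bsub>Rf\<^esub>) K \<circ> loc_map R (powers R f)) J"
    and "K +>\<^bsub>Rf\<^esub> loc_map R (powers R f) f \<in> Units (Rf Quot K)"
proof -
  interpret M: mult_set R "powers R f" using mult_set_powers[OF f] .
  have F: "fraction_hom R Rf (loc_map R (powers R f)) {\<zero>}"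
    unfolding Rf_def by (rule M.fraction_hom_localization)
  have L: "cring Rf" unfolding Rf_def by (rule M.localization_cring)
  have hom: "loc_map R (powers R f) \<in> ring_hom R Rf" unfolding Rf_def by (rule M.loc_map_hom)
  have "loc_map R (powers R f) ` J \<subseteq> carrier Rf"
    using ideal_subset[OF J] ring_hom_closed[OF hom] by blast
  then have K: "ideal K Rf"
    unfolding K_def using ring.genideal_ideal[OF cring.axioms(1)[OF L]] by blast
  have Q: "fraction_hom Rf (Rf Quot K) ((+>\<^bsub>Rf\<^esub>) K) K" using cring.fraction_hom_quotient[OF L K] .
  show "fraction_hom R (Rf Quot K) ((+>\<^bsub>Rf\<^esub>) K \<circ> loc_map R (powers R f)) J"
    using fraction_hom_compose[OF F Q J] ideal_zero[OF J] K_def by simp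
  have "f [^] (1::nat) \<in> powers R f" unfolding powers_def by blast
  then have "loc_map R (powers R f) f \<in> Units Rf" unfolding Rf_def using M.loc_map_unit[of f] f by simp
  then show "K +>\<^bsub>Rf\<^esub> loc_map R (powers R f) f \<in> Units (Rf Quot K)"
    using ring_hom_unit fraction_hom.axioms(1)[OF Q] by fast
qed

text \<open>The local ring at the generic point is a field: its maximal ideal has the empty set of generators, and its dimension is zero.\<close>

lemma regular_local_at_zero:
  assumes "domain R" "noetherian_ring R" shows "regular_local (loc_prime R {\<zero>})"
proof -
  interpret domain R by fact
  have Z: "primeideal {\<zero>} R" using zeroprimeideal .
  interpret F: local_fraction_hom R "loc_prime R {\<zero>}" "loc_map R (carrier R - {\<zero>})" "{\<zero>}" "{\<zero>}"
    using local_fraction_hom_loc_prime[OF Z] .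
  let ?L = "loc_prime R {\<zero>}"
  have "F.extension {\<zero>} = genideal ?L {}"
    using F.genideal_image[of "{}"] genideal_zero by simp
  then have max: "genideal ?L {} = max_ideal ?L" using F.max_ideal_eq by simp
  have "krull_dim ?L \<le> 0"
    unfolding krull_dim_def
  proof (rule Sup_least)
    fix z assume "z \<in> {enat n |n. \<exists>c. prime_chain ?L n c}"
    then obtain n c where z: "z = enat n" "prime_chain ?L n c" by blast
    have ch: "prime_chain R n (\<lambda>i. F.contraction (c i))" "{\<zero>} \<subseteq> F.contraction (c 0)" "F.contraction (c n) \<subseteq> {\<zero>}"
      using F.chain_contraction[OF z(2)] by auto
    have "n = 0"
    proof (rule ccontr)
      assume "n \<noteq> 0"
      then obtain k where k: "n = Suc k" by (cases n) auto
      have s: "F.contraction (c i) \<subset> F.contraction (c (Suc i))" if "i < n" for i using ch(1) that by (simp add: prime_chain_def)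
      have "F.contraction (c k) \<subset> {\<zero>}" using s[of k] ch(3) k by auto
      then have "F.contraction (c k) = {}" by blast
      moreover have "primeideal (F.contraction (c k)) R" using ch(1) k by (simp add: prime_chain_def spec_def)
      ultimately show False using ideal_zero[OF prime_ideal] by force
    qed
    then show "z \<le> 0" using z by (simp add: zero_enat_def)
  qed
  then have "krull_dim ?L = enat (card ({} :: ('a \<times> 'a) set set))" by (simp flip: zero_enat_def)
  then show ?thesis
    unfolding regular_local_def using F.noetherian_local[OF assms(2)] max by (intro conjI exI[of _ "{}"]) auto
qed

end

text \<open>A copy of \<open>R/P\<close> whose elements are one-element lists, each holding a representative of its coset: the condition on the regular loci of finitely generated algebras speaks
of algebras of lists.\<close>

lemma (in cring) quotient_in_lists:
  assumes P: "primeideal P R"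
  shows "\<exists>(B :: 'a list ring) h. cring B \<and> domain B \<and> h \<in> ring_hom R B \<and> h ` carrier R = carrier B \<and>
    (\<forall>r\<in>carrier R. h r = \<zero>\<^bsub>B\<^esub> \<longleftrightarrow> r \<in> P)"
proof -
  interpret P: primeideal P R by fact
  have PI: "ideal P R" using prime_ideal[OF P] .
  define h :: "'a \<Rightarrow> 'a list" where "h = (\<lambda>r. [SOME x. x \<in> P +> r])"
  have mem: "r \<in> P +> r" if "r \<in> carrier R" for r using P.a_rcos_self[OF that] .
  have h_eq: "h a = h b \<longleftrightarrow> a \<ominus> b \<in> P" if ab: "a \<in> carrier R" "b \<in> carrier R" for a b
  proof
    assume "a \<ominus> b \<in> P"
    then have "P +> a = P +> b" using quotient_eq_iff_same_a_r_cos[OF PI ab] by simp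
    then show "h a = h b" by (simp add: h_def)
  next
    assume "h a = h b"
    then have e: "(SOME x. x \<in> P +> a) = (SOME x. x \<in> P +> b)" by (simp add: h_def)
    have "(SOME x. x \<in> P +> a) \<in> P +> a" "(SOME x. x \<in> P +> b) \<in> P +> b"
      using someI[of "\<lambda>x. x \<in> P +> a"] someI[of "\<lambda>x. x \<in> P +> b"] mem ab by blast+
    then obtain x where x: "x \<in> P +> a" "x \<in> P +> b" using e by auto
    then have "P +> a = P +> b" using a_repr_independence[OF _ ab(1) P.a_subgroup] a_repr_independence[OF _ ab(2) P.a_subgroup] by metis
    then show "a \<ominus> b \<in> P" using quotient_eq_iff_same_a_r_cos[OF PI ab] by simp
  qed
  define B where "B = image_ring h R"
  have W: "weak_ring_morphism h P R" using weak_ring_morphismI[OF PI h_eq] .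
  have hom: "h \<in> ring_hom R B" unfolding B_def using weak_ring_morphism_is_hom[OF W] .
  have car: "h ` carrier R = carrier B" unfolding B_def by (simp add: image_ring_carrier)
  have ker: "h r = \<zero>\<^bsub>B\<^esub> \<longleftrightarrow> r \<in> P" if r: "r \<in> carrier R" for r
    using h_eq[OF r zero_closed] r unfolding B_def image_ring_zero by (simp add: a_minus_def)
  have rB: "ring B" unfolding B_def by (rule image_ring_is_ring[OF W])
  have cB: "cring B"
  proof (rule cring.intro[OF rB], rule monoid.monoid_comm_monoidI)
    show "monoid B" using rB by (simp add: ring_def)
    fix x y assume "x \<in> carrier B" "y \<in> carrier B"
    then obtain a b where ab: "a \<in> carrier R" "b \<in> carrier R" "x = h a" "y = h b" unfolding car[symmetric] by blast
    show "x \<otimes>\<^bsub>B\<^esub> y = y \<otimes>\<^bsub>B\<^esub> x"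
      unfolding ab(3,4) using ring_hom_mult[OF hom ab(1,2)] ring_hom_mult[OF hom ab(2,1)] m_comm[OF ab(1,2)] by simp
  qed
  have "domain B"
  proof (rule domain.intro[OF cB], unfold_locales)
    show "\<one>\<^bsub>B\<^esub> \<noteq> \<zero>\<^bsub>B\<^esub>" using ker[OF one_closed] ring_hom_one[OF hom] prime_one[OF P] by simp
    fix x y assume xy: "x \<otimes>\<^bsub>B\<^esub> y = \<zero>\<^bsub>B\<^esub>" "x \<in> carrier B" "y \<in> carrier B"
    then obtain a b where ab: "a \<in> carrier R" "b \<in> carrier R" "x = h a" "y = h b" unfolding car[symmetric] by blast
    have "a \<otimes> b \<in> P" using ker[of "a \<otimes> b"] xy(1) ring_hom_mult[OF hom ab(1,2)] ab by simp
    then show "x = \<zero>\<^bsub>B\<^esub> \<or> y = \<zero>\<^bsub>B\<^esub>" using prime_mem[OF P _ ab(1,2)] ker ab by blast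
  qed
  then show ?thesis using cB hom car ker by blast
qed

lemma (in cring) fraction_hom_surj:
  assumes "cring B" "h \<in> ring_hom R B" "h ` carrier R = carrier B" "ideal P R"
    "\<And>r. r \<in> carrier R \<Longrightarrow> h r = \<zero>\<^bsub>B\<^esub> \<longleftrightarrow> r \<in> P"
  shows "fraction_hom R B h P"
proof -
  interpret B: cring B by fact
  interpret H: ring_hom_cring R B h using assms(2) by unfold_locales
  have one: "h \<one> \<in> Units B" by simp
  show ?thesis
  proof (intro fraction_hom.intro fraction_hom_axioms.intro H.ring_hom_cring_axioms assms(4))
    show "h a = \<zero>\<^bsub>B\<^esub>" if "a \<in> P" for a using assms(5)[of a] that ideal_subset[OF assms(4)] by blast
  next
    fix c assume c: "c \<in> carrier B"
    then obtain r where "r \<in> carrier R" "c = h r" unfolding assms(3)[symmetric] by blast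
    moreover have "c \<otimes>\<^bsub>B\<^esub> h \<one> = c" using c by simp
    ultimately show "\<exists>r\<in>carrier R. \<exists>s\<in>carrier R. h s \<in> Units B \<and> c \<otimes>\<^bsub>B\<^esub> h s = h r"
      using one one_closed by metis
  next
    fix r assume "r \<in> carrier R" "h r = \<zero>\<^bsub>B\<^esub>"
    then have "\<one> \<otimes> r \<in> P" using assms(5)[of r] by simp
    then show "\<exists>s\<in>carrier R. h s \<in> Units B \<and> s \<otimes> r \<in> P" using one one_closed by blast
  qed
qed

text \<open>The regular locus of \<open>B = R/P\<close> is open and contains the zero prime, so it contains all primes that avoid a nonzero \<open>b\<close>.
A lift \<open>f\<close> of \<open>b\<close> to \<open>R\<close> is the required element.\<close>

lemma (in noeth_cring) J2_generically_regular:
  assumes J2: "J2_ring R" and P: "primeideal P R"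
  shows "\<exists>f \<in> carrier R. f \<notin> P \<and> (\<forall>q. primeideal q R \<longrightarrow> P \<subseteq> q \<longrightarrow> f \<notin> q \<longrightarrow>
    (\<exists>(L :: ('a list \<times> 'a list) set ring) h. local_fraction_hom R L h P q \<and> regular_local L))"
proof -
  obtain B :: "'a list ring" and h where B: "cring B" "domain B" "h \<in> ring_hom R B" "h ` carrier R = carrier B"
    and ker: "\<And>r. r \<in> carrier R \<Longrightarrow> h r = \<zero>\<^bsub>B\<^esub> \<longleftrightarrow> r \<in> P"
    using quotient_in_lists[OF P] by blast
  have F: "fraction_hom R B h P" using fraction_hom_surj[OF B(1,3,4) prime_ideal[OF P] ker] .
  interpret F: fraction_hom R B h P using F .
  have noeth: "noetherian_ring B" using F.noetherian[OF noetherian_ring_axioms] .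
  have "finite_type_algebra R B h"
    unfolding finite_type_algebra_def
  proof (intro conjI B(1,3) exI[of _ "{}"])
    show "generate_ring B (h ` carrier R \<union> {}) = carrier B"
      unfolding B(4) using F.S.generate_ring_incl[of "carrier B"] generate_ring.incl[of _ "carrier B" B] by auto
  qed auto
  then have "zariski_open B (regular_locus B)" using J2 unfolding J2_ring_def by blast
  then obtain A where A: "ideal A B" "regular_locus B = {Q \<in> spec B. \<not> A \<subseteq> Q}" unfolding zariski_open_def by blast
  have "primeideal {\<zero>\<^bsub>B\<^esub>} B" using domain.zeroprimeideal[OF B(2)] .
  then have "{\<zero>\<^bsub>B\<^esub>} \<in> regular_locus B"
    using F.S.regular_local_at_zero[OF B(2) noeth] by (simp add: regular_locus_def spec_def)
  then obtain b where b: "b \<in> A" "b \<noteq> \<zero>\<^bsub>B\<^esub>" using A(2) by auto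
  obtain f where f: "f \<in> carrier R" "b = h f" using b(1) F.S.ideal_subset[OF A(1)] unfolding B(4)[symmetric] by blast
  have fP: "f \<notin> P" using ker[OF f(1)] f(2) b(2) by simp
  have "\<exists>(L :: ('a list \<times> 'a list) set ring) h. local_fraction_hom R L h P q \<and> regular_local L"
    if q: "primeideal q R" "P \<subseteq> q" "f \<notin> q" for q
  proof -
    have qi: "ideal q R" using prime_ideal[OF q(1)] .
    have nonunit: "h s \<notin> Units B" if s: "s \<in> q" for s
    proof
      assume u: "h s \<in> Units B"
      have sc: "s \<in> carrier R" using s ideal_subset[OF qi] by blast
      obtain t where t: "t \<in> carrier R" "h t = inv\<^bsub>B\<^esub> h s"
        using F.S.Units_inv_closed[OF u] unfolding B(4)[symmetric] by (metis imageE)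
      have "h (t \<otimes> s) = h \<one>" using t sc u by simp
      then have "h (t \<otimes> s \<ominus> \<one>) = \<zero>\<^bsub>B\<^esub>" using t(1) sc by (simp add: F.h_minus a_minus_def F.S.r_neg)
      then have 1: "t \<otimes> s \<ominus> \<one> \<in> q" using ker[of "t \<otimes> s \<ominus> \<one>"] t(1) sc q(2) by auto
      have "\<one> = t \<otimes> s \<ominus> (t \<otimes> s \<ominus> \<one>)" using t(1) sc by algebra
      also have "\<dots> \<in> q" using ideal_minus[OF qi ideal_mult[OF qi s t(1)] 1] .
      finally show False using prime_one[OF q(1)] by simp
    qed
    define Q where "Q = F.extension q"
    have Q: "primeideal Q B" "F.contraction Q = q"
      unfolding Q_def using F.extension_prime[OF q(1,2) nonunit] F.contraction_extension_prime[OF q(1,2) nonunit] by auto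
    have "b \<notin> Q" using Q(2) f q(3) by (auto simp: F.contraction_def)
    then have "Q \<in> regular_locus B" using A(2) b(1) Q(1) by (auto simp: spec_def)
    then have "regular_local (loc_prime B Q)" by (simp add: regular_locus_def)
    then show ?thesis using local_fraction_hom_at_prime[OF F Q(1)] Q(2) by auto
  qed
  then show ?thesis using f(1) fP by blast
qed

theorem corollary9:
  fixes R :: "('a, 'm) ring_scheme" and I :: "'a set"
  assumes "excellent_ring R" and "ideal I R" and "I \<noteq> carrier R"
  shows "\<exists>f \<in> carrier R. f \<notin> radical R I \<and>
    (\<forall>n::nat. let Rf = localization R (powers R f) in
       cohen_macaulay (Rf Quot
         genideal Rf (loc_map R (powers R f) ` (I [^]\<^bsub>ideals_set R\<^esub> n))))"
proof -
  have "noetherian_cring R" and J2: "J2_ring R" using assms(1) by (auto simp: excellent_ring_def)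
  then interpret noeth_cring R by (simp add: noetherian_cring_def noeth_cring_def)
  show ?thesis
  proof (rule generic_normal_flatness[OF assms(2,3)])
    fix P f1
    assume P: "primeideal P R" "I \<subseteq> P" and f1: "f1 \<in> carrier R" "f1 \<notin> P"
      and only: "\<And>p. primeideal p R \<Longrightarrow> I \<subseteq> p \<Longrightarrow> f1 \<notin> p \<Longrightarrow> P \<subseteq> p"
      and flat: "\<And>q xs n. primeideal q R \<Longrightarrow> f1 \<notin> q \<Longrightarrow> set xs \<subseteq> carrier R \<Longrightarrow> weakly_regular q P xs \<Longrightarrow> weakly_regular q (ipow I n) xs"
    obtain f2 where f2: "f2 \<in> carrier R" "f2 \<notin> P"
      and reg: "\<And>q. primeideal q R \<Longrightarrow> P \<subseteq> q \<Longrightarrow> f2 \<notin> q \<Longrightarrow>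
        \<exists>(L :: ('a list \<times> 'a list) set ring) h. local_fraction_hom R L h P q \<and> regular_local L"
      using J2_generically_regular[OF J2 P(1)] by blast
    define f where "f = f1 \<otimes>\<^bsub>R\<^esub> f2"
    have f: "f \<in> carrier R" "f \<notin> P" unfolding f_def using f1 f2 prime_mult_notin[OF P(1)] by auto
    have f12: "f1 \<notin> q" "f2 \<notin> q" if "primeideal q R" "f \<notin> q" for q
      using ideal_mult[OF prime_ideal[OF that(1)] _ f1(1), of f2] ideal_mult[OF prime_ideal[OF that(1)] _ f2(1), of f1]
        that(2) m_comm[OF f1(1) f2(1)] unfolding f_def by auto
    have "f \<notin> radical R I"
      using prime_pow_mem[OF P(1) f(1)] f(2) P(2) unfolding radical_def by blast
    moreover have "cohen_macaulay (localization R (powers R f) Quot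
           genideal (localization R (powers R f)) (loc_map R (powers R f) ` (I [^]\<^bsub>ideals_set R\<^esub> n)))" for n :: nat
    proof -
      define J where "J = I [^]\<^bsub>ideals_set R\<^esub> n"
      have Jeq: "J = ipow I n" by (simp add: J_def ipow_def)
      have J: "ideal J R" unfolding Jeq by (rule ipow_ideal[OF assms(2)])
      define Rf where "Rf = localization R (powers R f)"
      define C where "C = Rf Quot genideal Rf (loc_map R (powers R f) ` J)"
      define \<phi> where "\<phi> = (+>\<^bsub>Rf\<^esub>) (genideal Rf (loc_map R (powers R f) ` J)) \<circ> loc_map R (powers R f)"
      have F: "fraction_hom R C \<phi> J" and fu: "\<phi> f \<in> Units C"
        using fraction_hom_power_quotient[OF f(1) J] unfolding C_def \<phi>_def Rf_def by simp_all
      interpret F: fraction_hom R C \<phi> J using F .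
      have "cohen_macaulay_local (loc_prime C Q)" if "Q \<in> spec C" for Q
      proof -
        have Q: "primeideal Q C" using that by (simp add: spec_def)
        define q where "q = F.contraction Q"
        interpret D: local_fraction_hom R "loc_prime C Q" "loc_map C (carrier C - Q) \<circ> \<phi>" J q
          unfolding q_def using local_fraction_hom_at_prime[OF F Q] .
        interpret D: noeth_local_fraction_hom R "loc_prime C Q" "loc_map C (carrier C - Q) \<circ> \<phi>" J q
          by unfold_locales
        have q: "primeideal q R" using D.q .
        have fq: "f \<notin> q"
        proof
          assume "f \<in> q"
          then have "\<phi> f \<in> Q" by (simp add: q_def F.contraction_def)
          then have "\<one>\<^bsub>C\<^esub> \<in> Q"
            using F.S.ideal_mult[OF F.S.prime_ideal[OF Q], of "\<phi> f" "inv\<^bsub>C\<^esub> \<phi> f"] fu by simp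
          then show False using F.S.prime_one[OF Q] by blast
        qed
        \<comment> \<open>After \<open>f\<close> is inverted, \<open>J\<close> and \<open>P\<close> lie in the same primes.  For \<open>n = 0\<close> the ideal \<open>J\<close> is \<open>R\<close>, and
          no prime contains it.\<close>
        have PJ: "P \<subseteq> p" if p: "primeideal p R" "J \<subseteq> p" "f \<notin> p" for p
        proof -
          have "I \<subseteq> p"
          proof
            fix x assume x: "x \<in> I"
            then have "x [^]\<^bsub>R\<^esub> n \<in> p" using pow_mem_ipow[OF assms(2) x, of n] p(2) unfolding J_def by blast
            then show "x \<in> p" using prime_pow_mem[OF p(1)] x ideal_subset[OF assms(2)] by blast
          qed
          then show ?thesis using only[OF p(1)] f12[OF p(1,3)] by blast
        qed
        have Pq: "P \<subseteq> q" using PJ[OF q D.J_q fq] .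
        obtain L :: "('a list \<times> 'a list) set ring" and h where L: "local_fraction_hom R L h P q" "regular_local L"
          using reg[OF q Pq] f12[OF q fq] by blast
        interpret L: noeth_local_fraction_hom R L h P q
          using L(1) noeth_cring_axioms by (simp add: noeth_local_fraction_hom_def)
        obtain xs c where xs: "set xs \<subseteq> q" "q \<subseteq> sat q (adjoins P xs)" "prime_chain R (length xs) c" "P \<subseteq> c 0" "c (length xs) \<subseteq> q"
          using L.regular_local_parameters[OF L(2)] by blast
        have xc: "set xs \<subseteq> carrier R" using xs(1) ideal_subset[OF prime_ideal[OF q]] by blast
        have "weakly_regular q P xs" using regular_imp_weakly_regular[OF q prime_ideal[OF P(1)] xs] by blast
        then have w: "weakly_regular q J xs" unfolding Jeq using flat[OF q f12(1)[OF q fq] xc] by blast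
        have bound: "k \<le> length xs" if d: "prime_chain R k d" "J \<subseteq> d 0" "d k \<subseteq> q" for k d
        proof -
          have "d 0 \<subseteq> d k" using prime_chain_mono[OF d(1)] by simp
          then have "P \<subseteq> d 0" using PJ[OF prime_chain_primeideal[OF d(1)] d(2)] d(3) fq by blast
          then show ?thesis using height_bound[OF q prime_ideal[OF P(1)] xs(1,2) d(1) _ d(3)] by blast
        qed
        show ?thesis using D.cohen_macaulay_criterion[OF xs(1) w bound] .
      qed
      then have "cohen_macaulay C"
        unfolding cohen_macaulay_def noetherian_cring_def
        using F.S.is_cring F.noetherian[OF noetherian_ring_axioms] by blast
      then show ?thesis unfolding C_def Rf_def J_def .
    qed
    ultimately show ?thesis using f(1) unfolding Let_def by blast
  qed
qed

end
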